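(* Let $I_h$ be a signed Choquet integral with representation $I_h(X)=\int_0^1\gamma(u)F_X^{-1}(u)\,du$ and distortion weight function $\gamma$ satisfying $0<\|\gamma\|_2<\infty$. Let $g:\mathbb{R}^n\to\mathbb{R}$ be $K$-Lipschitz with respect to $\|\cdot\|_2$ with decomposition $g(\mathbf{x})=\tilde g(\mathbf{x}^{(1)})+\boldsymbol\beta^T\mathbf{x}^{(2)}$, where $\mathbf{x}=(\mathbf{x}^{(1)},\mathbf{x}^{(2)})$, $\mathbf{x}^{(1)}\in\mathbb{R}^m$, $\mathbf{x}^{(2)}\in\mathbb{R}^{n-m}$ for some $m\le n$, $\boldsymbol\beta\in\mathbb{R}^{n-m}$, and $\tilde g:\mathbb{R}^m\to\mathbb{R}$ is Lipschitz continuous. Let $\mathbf{X}\in\mathcal{L}^p_n$ with $g(\mathbf{X})\in\mathcal{L}^p$. Let $\Phi(\mathbf{x})=\mathbf{x}^TQ\mathbf{x}$, where $Q$ is a positive-definite diagonal $n\times n$ matrix with smallest and largest eigenvalues $q_{\min}>0$ and $q_{\max}>0$, respectively. Then, for any $\epsilon>0$: (i) If $\gamma$ is non-decreasing, then $$I_h(g(\mathbf{X}))+\|\boldsymbol\beta\|_2\sqrt{\tfrac{\epsilon}{q_{\max}}}\,\|\gamma\|_2\le\sup_{\mathbf{Y}\in\mathfrak{B}^n_{\Phi,\epsilon}(\mathbf{X})}I_h\big(g(\mathbf{Y})\big)\le I_h(g(\mathbf{X}))+K\sqrt{\tfrac{\epsilon}{q_{\min}}}\,\|\gamma\|_2.$$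 (ii) If $\gamma$ is non-negative, then $$\int_0^1\gamma(u)\Big(F^{-1}_{g(\mathbf{X})}(u)+\frac1{2q_{\max}\underline\lambda}\gamma(u)\Big)^{\uparrow}du\le\sup_{\mathbf{Y}\in\mathfrak{B}^n_{\Phi,\epsilon}(\mathbf{X})}I_h\big(g(\mathbf{Y})\big)\le\int_0^1\gamma(u)\Big(F^{-1}_{g(\mathbf{X})}(u)+\frac1{2q_{\min}\overline\lambda}\gamma(u)\Big)^{\uparrow}du,$$ where $\overline\lambda$ is the unique positive solution to the equation in $\lambda$ $$\int_0^1\Big(F^{-1}_{g(\mathbf{X})}(u)-\big(F^{-1}_{g(\mathbf{X})}(u)+\frac1{2q_{\min}\lambda}\gamma(u)\big)^{\uparrow}\Big)^2du=\tfrac{K^2\epsilon}{q_{\min}},$$ and $\underline\lambda$ is the unique positive solution to the equation in $\lambda$ $$\int_0^1\Big(F^{-1}_{g(\mathbf{X})}(u)-\big(F^{-1}_{g(\mathbf{X})}(u)+\frac1{2q_{\max}\lambda}\gamma(u)\big)^{\uparrow}\Big)^2du=\tfrac{\|\boldsymbol\beta\|_2^2\epsilon}{q_{\max}}.$$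
   Context: All random variables/vectors live on a fixed non-atomic probability space $(\Omega,\mathcal{B},\mathbb{P})$ with $\mathcal{B}=\mathcal{B}(\mathbb{R}^n)$. Here $p\ge1$ is fixed, $\mathcal{L}^p_n$ is the space of $n$-dimensional random vectors with $\mathbb{E}[\|\mathbf{X}\|_a^p]<\infty$ (for a fixed norm $\|\mathbf{x}\|_a=(\sum_i|x_i|^a)^{1/a}$, $a\ge1$), and $\mathcal{L}^p=\mathcal{L}^p_1$. $F_Y^{-1}$ is the left-continuous quantile function of $Y$. A function $g$ is $K$-Lipschitz with respect to $\|\cdot\|_2$ if $|g(\mathbf{x})-g(\mathbf{y})|\le K\|\mathbf{x}-\mathbf{y}\|_2$ for all $\mathbf{x},\mathbf{y}$. A signed Choquet integral is the mapping $I_h:\mathcal{L}^p\to\mathbb{R}$, $I_h(X)=\int_{-\infty}^0[h(\mathbb{P}(X\ge x))-h(1)]\,dx+\int_0^\infty h(\mathbb{P}(X\ge x))\,dx$, where $h:[0,1]\to\mathbb{R}$ is non-constant, of bounded variation, with $h(0)=0$; it is assumed finite for the random variables considered. When $h$ is absolutely continuous, $I_h(X)=\int_0^1\gamma(u)F_X^{-1}(u)\,du$ with the distortion weight function $\gamma(u)$ equal to the left derivative of $h$ at $1-u$. $\|\gamma\|_2=(\int_0^1\gamma(u)^2du)^{1/2}$. For $\Phi(\mathbf{x})=\mathbf{x}^TQ\mathbf{x}$ the Bregman divergence $B_\Phi(\mathbf{z}_1,\mathbf{z}_2)=\Phi(\mathbf{z}_1)-\Phi(\mathbf{z}_2)-\nabla\Phi(\mathbf{z}_2)\cdot(\mathbf{z}_1-\mathbf{z}_2)$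 equals $(\mathbf{z}_1-\mathbf{z}_2)^TQ(\mathbf{z}_1-\mathbf{z}_2)$ (squared Mahalanobis distance), the Bregman-Wasserstein divergence is $\mathcal{B}^n_\Phi[F,G]=\inf\mathbb{E}[B_\Phi(\mathbf{X},\mathbf{Y})]$ over all couplings with $F_{\mathbf{X}}=F$, $F_{\mathbf{Y}}=G$, and $\mathfrak{B}^n_{\Phi,\epsilon}(\mathbf{X})=\{\mathbf{Z}:\mathcal{B}^n_\Phi[F_{\mathbf{Z}},F_{\mathbf{X}}]\le\epsilon\}$, tacitly assumed to contain at least two elements. The isotonic projection of $\ell\in\mathcal{L}^2((0,1))$ (the square-integrable functions on $(0,1)$) is $\ell^\uparrow=\arg\min_{j\in\mathcal{K}}\int_0^1(j(u)-\ell(u))^2du$, with $\mathcal{K}$ the set of left-continuous non-decreasing square-integrable functions on $(0,1)$. Conventions on the decomposition: if $g$ has no linear components then $m=n$ and $\tilde g=g$ (so $\|\boldsymbol\beta\|_2=0$); otherwise the smallest possible $m$ is chosen. Standing assumption: $g$ is non-constant.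
   Formalization: In (ii), the quantile function of g(X) is assumed square-integrable, since otherwise the isotonic projections are undefined; and if β=0 the equation for the lower λ has no positive solution, so existence and uniqueness are claimed only for β≠0, and the lower bound for β=0 is read with 1/λ=0. *)

theory Defs
  imports "HOL-Probability.Probability"
begin

definition atomless :: "'w measure \<Rightarrow> bool" where
  "atomless M \<longleftrightarrow>
    (\<forall>A\<in>sets M. 0 < emeasure M A \<longrightarrow>
      (\<exists>B\<in>sets M. B \<subseteq> A \<and> 0 < emeasure M B \<and> emeasure M B < emeasure M A))"

definition vec_norm :: "real \<Rightarrow> real ^ 'n \<Rightarrow> real" where
  "vec_norm a x = (\<Sum>i\<in>UNIV. \<bar>x $ i\<bar> powr a) powr (1 / a)"

definition Lp_vec :: "'w measure \<Rightarrow> real \<Rightarrow> real \<Rightarrow> ('w \<Rightarrow> real ^ 'n) set" where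
  "Lp_vec M a p =
    {X \<in> borel_measurable M. integrable M (\<lambda>\<omega>. vec_norm a (X \<omega>) powr p)}"

definition Lp_real :: "'w measure \<Rightarrow> real \<Rightarrow> ('w \<Rightarrow> real) set" where
  "Lp_real M p = {Y \<in> borel_measurable M. integrable M (\<lambda>\<omega>. \<bar>Y \<omega>\<bar> powr p)}"

text \<open>For vectors in \<^typ>\<open>real ^ 'n\<close> the order is the componentwise one, so this is the usual joint
  distribution function.\<close>

definition dist_fun :: "'w measure \<Rightarrow> ('w \<Rightarrow> 'b::ord) \<Rightarrow> 'b \<Rightarrow> real" where
  "dist_fun M X x = measure M {\<omega> \<in> space M. X \<omega> \<le> x}"

definition quantile :: "'w measure \<Rightarrow> ('w \<Rightarrow> real) \<Rightarrow> real \<Rightarrow> real" where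
  "quantile M Y u = Inf {x. u \<le> dist_fun M Y x}"

definition bounded_variation_on_unit :: "(real \<Rightarrow> real) \<Rightarrow> bool" where
  "bounded_variation_on_unit h \<longleftrightarrow>
    (\<exists>B. \<forall>n. \<forall>t :: nat \<Rightarrow> real.
      mono t \<and> range t \<subseteq> {0..1} \<longrightarrow> (\<Sum>i<n. \<bar>h (t (Suc i)) - h (t i)\<bar>) \<le> B)"

definition abs_continuous_on_unit :: "(real \<Rightarrow> real) \<Rightarrow> bool" where
  "abs_continuous_on_unit h \<longleftrightarrow>
    (\<forall>e>0. \<exists>d>0. \<forall>n. \<forall>a b :: nat \<Rightarrow> real.
      (\<forall>i<n. 0 \<le> a i \<and> a i \<le> b i \<and> b i \<le> 1) \<and>
      (\<forall>i<n. \<forall>j<n. i \<noteq> j \<longrightarrow> {a i<..<b i} \<inter> {a j<..<b j} = {}) \<and>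
      (\<Sum>i<n. b i - a i) < d \<longrightarrow>
      (\<Sum>i<n. \<bar>h (b i) - h (a i)\<bar>) < e)"

definition distortion_function :: "(real \<Rightarrow> real) \<Rightarrow> bool" where
  "distortion_function h \<longleftrightarrow>
    h 0 = 0 \<and> \<not> h constant_on {0..1} \<and> bounded_variation_on_unit h"

definition signed_choquet :: "'w measure \<Rightarrow> (real \<Rightarrow> real) \<Rightarrow> ('w \<Rightarrow> real) \<Rightarrow> real" where
  "signed_choquet M h Y =
    (LBINT x:{..<0}. h (measure M {\<omega> \<in> space M. x \<le> Y \<omega>}) - h 1) +
    (LBINT x:{0..}. h (measure M {\<omega> \<in> space M. x \<le> Y \<omega>}))"

definition signed_choquet_finite :: "'w measure \<Rightarrow> (real \<Rightarrow> real) \<Rightarrow> ('w \<Rightarrow> real) \<Rightarrow> bool" where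
  "signed_choquet_finite M h Y \<longleftrightarrow>
    set_integrable lborel {..<0} (\<lambda>x. h (measure M {\<omega> \<in> space M. x \<le> Y \<omega>}) - h 1) \<and>
    set_integrable lborel {0..} (\<lambda>x. h (measure M {\<omega> \<in> space M. x \<le> Y \<omega>}))"

text \<open>An absolutely continuous function may fail to have a left derivative on a null set, so
  the defining equation of the weight is required almost everywhere only.\<close>

definition distortion_weight :: "(real \<Rightarrow> real) \<Rightarrow> (real \<Rightarrow> real) \<Rightarrow> bool" where
  "distortion_weight h \<gamma> \<longleftrightarrow>
    (AE u in lebesgue_on {0<..<1}. (h has_real_derivative \<gamma> u) (at_left (1 - u)))"

definition L2_unit :: "(real \<Rightarrow> real) set" where
  "L2_unit = {f \<in> borel_measurable (lebesgue_on {0<..<1}).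
                integrable (lebesgue_on {0<..<1}) (\<lambda>u. (f u)\<^sup>2)}"

definition norm2_unit :: "(real \<Rightarrow> real) \<Rightarrow> real" where
  "norm2_unit f = sqrt (LINT u|lebesgue_on {0<..<1}. (f u)\<^sup>2)"

definition isotonic_cone :: "(real \<Rightarrow> real) set" where
  "isotonic_cone =
    {j \<in> L2_unit. mono_on {0<..<1} j \<and> (\<forall>u\<in>{0<..<1}. continuous (at_left u) j)}"

text \<open>The minimiser is determined on the open unit interval only; its values elsewhere are
  arbitrary. The projection is meaningful for \<open>l \<in> L2_unit\<close>.\<close>

definition isotonic_proj :: "(real \<Rightarrow> real) \<Rightarrow> real \<Rightarrow> real" where
  "isotonic_proj l =
    arg_min_on (\<lambda>j. LINT u|lebesgue_on {0<..<1}. (j u - l u)\<^sup>2) isotonic_cone"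

text \<open>\<open>frechet_derivative \<Phi> (at z\<^sub>2) v\<close> is the inner product of the gradient at \<open>z\<^sub>2\<close> with \<open>v\<close>.\<close>

definition bregman :: "(real ^ 'n \<Rightarrow> real) \<Rightarrow> real ^ 'n \<Rightarrow> real ^ 'n \<Rightarrow> real" where
  "bregman \<Phi> z\<^sub>1 z\<^sub>2 = \<Phi> z\<^sub>1 - \<Phi> z\<^sub>2 - frechet_derivative \<Phi> (at z\<^sub>2) (z\<^sub>1 - z\<^sub>2)"

text \<open>Both arguments are joint distribution functions. The expectation of the (for convex
  \<open>\<Phi>\<close> non-negative) divergence may be infinite, hence the value in \<^typ>\<open>ennreal\<close>.\<close>

definition bregman_wasserstein ::
    "'w measure \<Rightarrow> (real ^ 'n \<Rightarrow> real) \<Rightarrow> (real ^ 'n \<Rightarrow> real) \<Rightarrow> (real ^ 'n \<Rightarrow> real) \<Rightarrow> ennreal" where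
  "bregman_wasserstein M \<Phi> F G =
    (INF (X, Y) \<in> {(X, Y). X \<in> borel_measurable M \<and> Y \<in> borel_measurable M \<and>
                          dist_fun M X = F \<and> dist_fun M Y = G}.
      \<integral>\<^sup>+ \<omega>. ennreal (bregman \<Phi> (X \<omega>) (Y \<omega>)) \<partial>M)"

definition bw_ball ::
    "'w measure \<Rightarrow> (real ^ 'n \<Rightarrow> real) \<Rightarrow> real \<Rightarrow> ('w \<Rightarrow> real ^ 'n) \<Rightarrow> ('w \<Rightarrow> real ^ 'n) set" where
  "bw_ball M \<Phi> \<epsilon> X =
    {Z \<in> borel_measurable M.
      bregman_wasserstein M \<Phi> (dist_fun M Z) (dist_fun M X) \<le> ennreal \<epsilon>}"

definition diagonal_matrix :: "real ^ 'n ^ 'n \<Rightarrow> bool" where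
  "diagonal_matrix Q \<longleftrightarrow> (\<forall>i j. i \<noteq> j \<longrightarrow> Q $ i $ j = 0)"

definition positive_definite :: "real ^ 'n ^ 'n \<Rightarrow> bool" where
  "positive_definite Q \<longleftrightarrow> transpose Q = Q \<and> (\<forall>x. x \<noteq> 0 \<longrightarrow> 0 < x \<bullet> (Q *v x))"

definition eigenvalues :: "real ^ 'n ^ 'n \<Rightarrow> real set" where
  "eigenvalues Q = {c. \<exists>v. v \<noteq> 0 \<and> Q *v v = c *\<^sub>R v}"

definition coord_proj :: "'n set \<Rightarrow> real ^ 'n \<Rightarrow> real ^ 'n" where
  "coord_proj J x = (\<chi> i. if i \<in> J then x $ i else 0)"

text \<open>For \<open>m = card J\<close>, the set \<open>range (coord_proj J)\<close> is an isometric copy of the Euclidean space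
  of dimension \<open>m\<close>; this also covers \<open>m = 0\<close>, for which there is no type \<^typ>\<open>real ^ 'm\<close>. The two
  blocks of the argument are \<open>coord_proj J x\<close> and \<open>coord_proj (- J) x\<close>, and the coefficient
  vector of the linear part, supported on \<open>- J\<close>, has the norm of its restriction to \<open>- J\<close>.\<close>

definition linear_decomposition ::
    "(real ^ 'n \<Rightarrow> real) \<Rightarrow> 'n set \<Rightarrow> (real ^ 'n \<Rightarrow> real) \<Rightarrow> real ^ 'n \<Rightarrow> bool" where
  "linear_decomposition g J gt \<beta> \<longleftrightarrow>
    (\<exists>L. L-lipschitz_on (range (coord_proj J)) gt) \<and>
    \<beta> \<in> range (coord_proj (- J)) \<and>
    (\<forall>x. g x = gt (coord_proj J x) + \<beta> \<bullet> coord_proj (- J) x)"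

end

theory Submission
  imports Defs
begin

text \<open>Write \<open>q\<^sub>Y\<close> for the quantile function of \<open>g(Y)\<close>. Differences of signed Choquet integrals are differences
  of weighted quantile integrals, \<open>I\<^sub>h(g(Y)) - I\<^sub>h(g(X)) = \<langle>\<gamma>, q\<^sub>Y - q\<^sub>X\<rangle>\<close> in \<open>L\<^sup>2(0,1)\<close>. The Lipschitz condition
  and the optimality of the monotone coupling on the line put every \<open>q\<^sub>Y\<close> with \<open>Y\<close> in the ball within
  distance \<open>K \<surd>(\<epsilon> / q_min)\<close> of \<open>q\<^sub>X\<close>. Conversely, moving \<open>X\<close> along \<open>\<beta>\<close> as a function of the rank of \<open>g(X)\<close>, which is
  available because the space is atomless, attains every non-decreasing profile within distance
  \<open>\<parallel>\<beta>\<parallel> \<surd>(\<epsilon> / q_max)\<close>. This leaves the maximisation of \<open>\<langle>\<gamma>, k\<rangle>\<close> over the non-decreasing \<open>k\<close> in an \<open>L\<^sup>2\<close> ball around \<open>q\<^sub>X\<close>: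
  Cauchy-Schwarz settles it when \<open>\<gamma>\<close> is non-decreasing, and in general the variational inequality
  of the projection of \<open>q\<^sub>X + c \<gamma>\<close> onto the cone shows that this projection is the maximiser at its own radius.\<close>

section \<open>Absolutely continuous functions\<close>

text \<open>The quantile function of \<open>g(X)\<close> need not be square integrable, since
  \<open>p\<close> may be below 2; only its differences with the competing profiles are. Hence
  Choquet integrals are compared rather than computed, and part (ii), which projects the quantile
  function itself, carries the premise \<open>Finv \<in> L2_unit\<close>. The radii come from the
  form \<open>Q\<close>. A Bregman cost \<open>b\<close> bounds the squared displacement by
  \<open>b / q_min\<close>, hence the squared change of \<open>g\<close> by
  \<open>K\<^sup>2 * b / q_min\<close>; a change \<open>d\<close> of \<open>g\<close> is bought by
  the step \<open>(d / (norm \<beta>)\<^sup>2) *\<^sub>R \<beta>\<close>, at cost at most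
  \<open>q_max * d\<^sup>2 / (norm \<beta>)\<^sup>2\<close>. The factor
  \<open>1 / (2 * q * l)\<close> comes from a Lagrange multiplier \<open>l\<close>: completing the
  square in \<open><\<gamma>, k> - q * l * |k - F|^2\<close> shows that the maximiser over the cone
  is the projection of \<open>F + c \<gamma>\<close> with \<open>c = 1 / (2 * q * l)\<close>.
  Solving for \<open>l\<close> is finding the point of this path of projections at a given distance
  from \<open>F\<close>. Projection onto a cone containing all constants preserves means, so the
  mean moves at the rate \<open>mean \<gamma>\<close>; a positive rate drives both existence and
  uniqueness.\<close>

lemma abs_continuous_on_finite_family:
  assumes ac: "abs_continuous_on_unit h" and "0 < e"
  shows "\<exists>d>0. \<forall>P (A :: 'i \<Rightarrow> real) B. finite P \<longrightarrow> (\<forall>i\<in>P. 0 \<le> A i \<and> A i \<le> B i \<and> B i \<le> 1) \<longrightarrow>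
           disjoint_family_on (\<lambda>i. {A i<..<B i}) P \<longrightarrow> (\<Sum>i\<in>P. B i - A i) < d \<longrightarrow>
           (\<Sum>i\<in>P. \<bar>h (B i) - h (A i)\<bar>) < e"
proof -
  obtain d where "0 < d" and d: "\<forall>n (a :: nat \<Rightarrow> real) b.
      (\<forall>i<n. 0 \<le> a i \<and> a i \<le> b i \<and> b i \<le> 1) \<and>
      (\<forall>i<n. \<forall>j<n. i \<noteq> j \<longrightarrow> {a i<..<b i} \<inter> {a j<..<b j} = {}) \<and>
      (\<Sum>i<n. b i - a i) < d \<longrightarrow> (\<Sum>i<n. \<bar>h (b i) - h (a i)\<bar>) < e"
    using ac[unfolded abs_continuous_on_unit_def, THEN spec, THEN mp, OF \<open>0 < e\<close>]
    by (elim exE conjE) (rule that)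
  show ?thesis
  proof (intro exI[of _ d] conjI allI impI \<open>0 < d\<close>)
    fix P and A B :: "'i \<Rightarrow> real"
    assume fin: "finite P" and AB: "\<forall>i\<in>P. 0 \<le> A i \<and> A i \<le> B i \<and> B i \<le> 1"
      and disj: "disjoint_family_on (\<lambda>i. {A i<..<B i}) P" and small: "(\<Sum>i\<in>P. B i - A i) < d"
    \<comment> \<open>Absolute continuity is stated for intervals numbered by naturals; the later
      index sets consist of tagged intervals, so the family is enumerated.\<close>
    obtain f where f: "bij_betw f {..<card P} P"
      using ex_bij_betw_nat_finite[OF fin] by (auto simp: atLeast0LessThan)
    have fP: "f i \<in> P" if "i < card P" for i using f that by (auto simp: bij_betw_def)
    have "(\<Sum>i<card P. \<bar>h (B (f i)) - h (A (f i))\<bar>) < e"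
    proof (rule d[rule_format], intro conjI allI impI)
      show "(\<Sum>i<card P. B (f i) - A (f i)) < d"
        using small sum.reindex_bij_betw[OF f, of "\<lambda>i. B i - A i"] by simp
      fix i assume i: "i < card P"
      show "0 \<le> A (f i)" "A (f i) \<le> B (f i)" "B (f i) \<le> 1" using AB fP[OF i] by auto
      fix j assume j: "j < card P" "i \<noteq> j"
      then have "f i \<noteq> f j" using f i by (auto simp: bij_betw_def inj_on_def)
      then show "{A (f i)<..<B (f i)} \<inter> {A (f j)<..<B (f j)} = {}"
        using disj fP[OF i] fP[OF j(1)] unfolding disjoint_family_on_def by blast
    qed
    then show "(\<Sum>i\<in>P. \<bar>h (B i) - h (A i)\<bar>) < e"
      using sum.reindex_bij_betw[OF f, of "\<lambda>i. \<bar>h (B i) - h (A i)\<bar>"] by simp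
  qed
qed

lemma abs_continuous_imp_continuous:
  assumes "abs_continuous_on_unit h"
  shows "continuous_on {0..1} h"
  unfolding continuous_on_iff
proof safe
  fix x e :: real assume x: "x \<in> {0..1}" and "0 < e"
  obtain d where "0 < d" and d: "\<forall>P (A :: unit \<Rightarrow> real) B. finite P \<longrightarrow> (\<forall>i\<in>P. 0 \<le> A i \<and> A i \<le> B i \<and> B i \<le> 1) \<longrightarrow>
           disjoint_family_on (\<lambda>i. {A i<..<B i}) P \<longrightarrow> (\<Sum>i\<in>P. B i - A i) < d \<longrightarrow>
           (\<Sum>i\<in>P. \<bar>h (B i) - h (A i)\<bar>) < e"
    using abs_continuous_on_finite_family[OF assms \<open>0 < e\<close>] by blast
  have "dist (h y) (h x) < e" if "y \<in> {0..1}" "dist y x < d" for y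
    using d[rule_format, of "{()}" "\<lambda>_. min x y" "\<lambda>_. max x y"] x that
    by (cases "x \<le> y") (auto simp: disjoint_family_on_def dist_real_def)
  then show "\<exists>d>0. \<forall>x'\<in>{0..1}. dist x' x < d \<longrightarrow> dist (h x') (h x) < e"
    using \<open>0 < d\<close> by blast
qed

text \<open>Instead of differentiating the indefinite integral, the proof creeps from \<open>0\<close> to \<open>1\<close>: the increments
  of \<open>h\<close> and of the integral are compared on tagged intervals whose tag is the left end point, and
  the accumulated error is controlled by the Henstock lemma at points of differentiability and by
  absolute continuity on the exceptional null set.\<close>

lemma abs_continuous_right_derivative_integral:
  fixes h f :: "real \<Rightarrow> real"
  assumes ac: "abs_continuous_on_unit h"
    and int: "f integrable_on {0..1}"
    and N: "negligible N" "0 \<in> N"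
    and deriv: "\<And>x. x \<in> {0..<1} - N \<Longrightarrow> (h has_real_derivative f x) (at_right x)"
  shows "h 1 - h 0 = integral {0..1} f"
proof -
  \<comment> \<open>Vanishing on \<open>N\<close> removes the tag term from the Henstock defect at
    tags in \<open>N\<close>, where \<open>f\<close> says nothing about \<open>h\<close>.\<close>
  define F where "F x = (if x \<in> N then 0 else f x)" for x
  have intF: "F integrable_on {0..1}"
    by (rule integrable_spike[OF int N(1)]) (auto simp: F_def)
  have intFab: "F integrable_on {a..b}" if "0 \<le> a" "b \<le> 1" for a b
    by (rule integrable_subinterval_real[OF intF]) (use that in auto)
  define \<Phi> where "\<Phi> t = h t - h 0 - integral {0..t} F" for t
  have cont: "continuous_on {0..1} \<Phi>"
    unfolding \<Phi>_def
    by (intro continuous_intros abs_continuous_imp_continuous[OF ac] indefinite_integral_continuous_1 intF)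
  have small: "\<bar>\<Phi> 1\<bar> \<le> 3 * e" if "0 < e" for e
  proof -
    obtain \<delta> where "0 < \<delta>" and \<delta>: "\<forall>P (A :: real \<times> real set \<Rightarrow> real) B. finite P \<longrightarrow>
           (\<forall>i\<in>P. 0 \<le> A i \<and> A i \<le> B i \<and> B i \<le> 1) \<longrightarrow>
           disjoint_family_on (\<lambda>i. {A i<..<B i}) P \<longrightarrow> (\<Sum>i\<in>P. B i - A i) < \<delta> \<longrightarrow>
           (\<Sum>i\<in>P. \<bar>h (B i) - h (A i)\<bar>) < e"
      using abs_continuous_on_finite_family[OF ac \<open>0 < e\<close>] by blast
    have N0: "N \<in> null_sets lebesgue" using N(1) by (simp add: negligible_iff_null_sets)
    \<comment> \<open>Outer regularity: the gauge will keep every interval tagged in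
      \<open>N\<close> inside \<open>U\<close>, so these intervals have total length below
      \<delta>.\<close>
    then obtain U where U: "open U" "N \<subseteq> U" "emeasure lebesgue (U - N) < ennreal \<delta>"
      using sets_lebesgue_outer_open[OF null_setsD2 \<open>0 < \<delta>\<close>] by metis
    have eU: "emeasure lebesgue U < ennreal \<delta>"
      using U(1,3) emeasure_Diff_null_set[OF N0, of U] by auto
    then have U_lm: "U \<in> lmeasurable"
      using U(1) by (auto simp: fmeasurable_def dest: order.strict_trans[OF _ ennreal_less_top])
    have mU: "measure lebesgue U < \<delta>"
      using eU emeasure_eq_measure2[OF U_lm] by (simp add: ennreal_less_iff)
    have NU: "N \<subseteq> U" using U by simp
    have "\<exists>d1. gauge d1 \<and> (\<forall>p. p tagged_partial_division_of (cbox 0 1) \<longrightarrow> d1 fine p \<longrightarrow>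
        (\<Sum>(x,K)\<in>p. norm (measure lborel K *\<^sub>R F x - integral K F)) < e)"
      by (rule Henstock_lemma[of F 0 1 e]) (use intF \<open>0 < e\<close> in auto)
    then obtain d1 where d1: "gauge d1" "\<And>p. p tagged_partial_division_of (cbox 0 1) \<Longrightarrow> d1 fine p \<Longrightarrow>
        (\<Sum>(x,K)\<in>p. norm (measure lborel K *\<^sub>R F x - integral K F)) < e" by blast
    define d where "d x = d1 x \<inter> (if x \<in> N then U else UNIV)" for x
    \<comment> \<open>The error charged to one tagged interval: its Henstock defect and, at a tag in
      \<open>N\<close>, the whole increment of \<open>h\<close>.\<close>
    define err where "err = (\<lambda>(x,K). norm (measure lborel K *\<^sub>R F x - integral K F)
        + (if x \<in> N then \<bar>h (Sup K) - h (Inf K)\<bar> else 0))"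
    have open_d: "open (d x)" "x \<in> d x" for x
      using d1(1) U(1) NU by (auto simp: d_def gauge_def)
    have err_le: "sum err p \<le> 2 * e" if p: "p tagged_partial_division_of {0..1}" "d fine p" for p
    proof -
      have fin: "finite p" using p(1) by (rule tagged_partial_division_ofD)
      have "d1 fine p" using p(2) by (auto simp: fine_def d_def)
      then have 1: "(\<Sum>(x,K)\<in>p. norm (measure lborel K *\<^sub>R F x - integral K F)) < e"
        using d1(2) p(1) by simp
      define q where "q = {i \<in> p. fst i \<in> N}"
      have q: "finite q" "q \<subseteq> p" using fin by (auto simp: q_def)
      have iv: "\<exists>a b. snd i = {a..b} \<and> 0 \<le> a \<and> a \<le> b \<and> b \<le> 1" if "i \<in> p" for i
      proof -
        obtain x K where i: "i = (x,K)" by force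
        obtain a b where "K = cbox a b"
          using tagged_partial_division_ofD(4)[OF p(1)] \<open>i \<in> p\<close> i by blast
        then have "K = {a..b}" by simp
        moreover have "x \<in> K" "K \<subseteq> {0..1}"
          using tagged_partial_division_ofD(2,3)[OF p(1)] that i by auto
        ultimately show ?thesis using i by auto
      qed
      have "(\<Sum>i\<in>q. \<bar>h (Sup (snd i)) - h (Inf (snd i))\<bar>) < e"
      proof (rule \<delta>[rule_format, OF q(1)])
        show "0 \<le> Inf (snd i) \<and> Inf (snd i) \<le> Sup (snd i) \<and> Sup (snd i) \<le> 1" if "i \<in> q" for i
          using iv[of i] that q by force
        have int: "interior (snd i) = {Inf (snd i)<..<Sup (snd i)}" if "i \<in> p" for i
          using iv[OF that] by auto
        show disj: "disjoint_family_on (\<lambda>i. {Inf (snd i)<..<Sup (snd i)}) q"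
          unfolding disjoint_family_on_def
        proof (intro ballI impI)
          fix i j assume ij: "i \<in> q" "j \<in> q" "i \<noteq> j"
          then have "interior (snd i) \<inter> interior (snd j) = {}"
            using tagged_partial_division_ofD(5)[OF p(1)] q by (metis prod.collapse subsetD)
          then show "{Inf (snd i)<..<Sup (snd i)} \<inter> {Inf (snd j)<..<Sup (snd j)} = {}"
            using int[of i] int[of j] ij q by (simp only: subset_iff)
        qed
        have "(\<Sum>i\<in>q. Sup (snd i) - Inf (snd i)) = (\<Sum>i\<in>q. measure lebesgue {Inf (snd i)<..<Sup (snd i)})"
          using iv q by (intro sum.cong) force+
        also have "\<dots> = measure lebesgue (\<Union>i\<in>q. {Inf (snd i)<..<Sup (snd i)})"
        proof (rule measure_finite_Union[symmetric])
          have "emeasure lebesgue {u<..<v} \<noteq> \<infinity>" for u v :: real by (cases "u \<le> v") auto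
          then show "\<And>i. i \<in> q \<Longrightarrow> emeasure lebesgue {Inf (snd i)<..<Sup (snd i)} \<noteq> \<infinity>" by blast
        qed (use q disj in auto)
        also have "\<dots> \<le> measure lebesgue U"
        proof (rule measure_mono_fmeasurable)
          have "{Inf (snd i)<..<Sup (snd i)} \<subseteq> U" if "i \<in> q" for i
          proof -
            have "snd i \<subseteq> U" using p(2) that unfolding fine_def q_def d_def by force
            moreover have "{Inf (snd i)<..<Sup (snd i)} \<subseteq> snd i" using int q that interior_subset by blast
            ultimately show ?thesis by blast
          qed
          then show "(\<Union>i\<in>q. {Inf (snd i)<..<Sup (snd i)}) \<subseteq> U" by blast
        qed (use q U U_lm in auto)
        finally show "(\<Sum>i\<in>q. Sup (snd i) - Inf (snd i)) < \<delta>" using mU by simp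
      qed
      also have "(\<Sum>i\<in>q. \<bar>h (Sup (snd i)) - h (Inf (snd i))\<bar>) =
          (\<Sum>(x,K)\<in>p. if x \<in> N then \<bar>h (Sup K) - h (Inf K)\<bar> else 0)"
        unfolding q_def case_prod_unfold using fin by (simp add: sum.inter_filter)
      finally have 2: "(\<Sum>(x,K)\<in>p. if x \<in> N then \<bar>h (Sup K) - h (Inf K)\<bar> else 0) < e" .
      show ?thesis using 1 2 by (simp add: err_def case_prod_unfold sum.distrib)
    qed
    define PD where "PD t = {p. p tagged_partial_division_of {0..t} \<and> d fine p}" for t :: real
    \<comment> \<open>The creeping may take infinitely many steps, so no single division is carried
      along. \<open>W t\<close> is the largest error that a fine partial division of
      \<open>{0..t}\<close> can collect; for \<open>t \<le> 1\<close> it stays below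
      \<open>2 * e\<close>, and it grows by at least \<open>err\<close> when an interval is
      appended.\<close>
    define W where "W t = Sup (sum err ` PD t)" for t
    have PD_ne: "{} \<in> PD t" for t by (auto simp: PD_def tagged_partial_division_of_def fine_def)
    have PD_mono: "PD s \<subseteq> PD t" if "s \<le> t" for s t
    proof
      fix p assume "p \<in> PD s"
      then have p: "p tagged_partial_division_of {0..s}" "d fine p" by (auto simp: PD_def)
      have "K \<subseteq> {0..t}" if "(x,K) \<in> p" for x K
        using tagged_partial_division_ofD(3)[OF p(1) that] \<open>s \<le> t\<close> by auto
      then have "p tagged_partial_division_of {0..t}"
        using p(1) unfolding tagged_partial_division_of_def by blast
      then show "p \<in> PD t" using p(2) by (simp add: PD_def)
    qed
    have W_upper: "sum err p \<le> W t" if "p \<in> PD t" "t \<le> 1" for p t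
      unfolding W_def

    proof (rule cSup_upper)
      have "sum err p \<le> 2 * e" if "p \<in> PD t" for p
        using that PD_mono[OF \<open>t \<le> 1\<close>] err_le by (auto simp: PD_def)
      then show "bdd_above (sum err ` PD t)" by (intro bdd_aboveI[of _ "2 * e"]) blast
    qed (use that in blast)
    have W_le: "W t \<le> C" if "\<And>p. p \<in> PD t \<Longrightarrow> sum err p \<le> C" for t C
      unfolding W_def by (rule cSup_least) (use that PD_ne in auto)
    have W_mono: "W s \<le> W t" if "s \<le> t" "t \<le> 1" for s t
      using W_upper[OF _ that(2)] PD_mono[OF that(1)] by (intro W_le) auto
    have W_insert: "W s + err (s,{s..t}) \<le> W t" if "0 \<le> s" "s < t" "t \<le> 1" "{s..t} \<subseteq> d s" for s t
    proof -
      have "W s \<le> W t - err (s,{s..t})"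
      proof (rule W_le)
        fix p assume p: "p \<in> PD s"
        then have tp: "p tagged_partial_division_of {0..s}" and fp: "d fine p" by (auto simp: PD_def)
        have sub: "K \<subseteq> {0..s}" if "(x,K) \<in> p" for x K using tagged_partial_division_ofD(3)[OF tp that] .
        have notin: "(s,{s..t}) \<notin> p" using sub \<open>s < t\<close> by force
        have disj: "interior {s..t} \<inter> interior K = {}" if "(x,K) \<in> p" for x K
          using interior_mono[OF sub[OF that]] by auto
        have "insert (s,{s..t}) p tagged_partial_division_of {0..t}"
          unfolding tagged_partial_division_of_def
        proof (intro conjI allI impI)
          show "finite (insert (s,{s..t}) p)" using tp by (simp add: tagged_partial_division_ofD)
        next
          fix x K assume a: "(x,K) \<in> insert (s,{s..t}) p"
          then show "x \<in> K" using tagged_partial_division_ofD(2)[OF tp] \<open>s < t\<close> by auto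
          show "K \<subseteq> {0..t}" using a sub that by force
          show "\<exists>a b. K = cbox a b" using a tagged_partial_division_ofD(4)[OF tp] by (auto simp flip: interval_cbox)
        next
          fix x K y L assume a: "(x,K) \<in> insert (s,{s..t}) p \<and> (y,L) \<in> insert (s,{s..t}) p \<and> (x,K) \<noteq> (y,L)"
          then show "interior K \<inter> interior L = {}"
            using disj[of y L] disj[of x K] tagged_partial_division_ofD(5)[OF tp, of x K y L] by blast
        qed
        then have "insert (s,{s..t}) p \<in> PD t"
          using fp that(4) by (auto simp: PD_def fine_def)
        from W_upper[OF this that(3)] show "sum err p \<le> W t - err (s,{s..t})"
          using notin tp by (simp add: tagged_partial_division_ofD)
      qed
      then show ?thesis by simp
    qed
    define A where "A = {t \<in> {0..1}. \<bar>\<Phi> t\<bar> \<le> e * t + W t}"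
    have "0 \<le> W 0" using W_upper[OF PD_ne[of 0]] by simp
    then have "0 \<in> A" by (simp add: A_def \<Phi>_def)
    have bdd: "bdd_above A" by (auto simp: A_def)
    define s where "s = Sup A"
    have "s \<le> 1" unfolding s_def
    proof (rule cSup_least)
      show "A \<noteq> {}" using \<open>0 \<in> A\<close> by blast
    qed (simp add: A_def)
    then have s01: "s \<in> {0..1}" using cSup_upper[OF \<open>0 \<in> A\<close> bdd] by (simp add: s_def)
    have le_s: "t \<le> s" if "t \<in> A" for t using that bdd by (auto simp: s_def intro: cSup_upper)
    \<comment> \<open>\<open>W\<close> need not be continuous, so \<open>A\<close> itself may fail
      to be closed. Freezing the bound at its value in \<open>s\<close>, which dominates by
      monotonicity, leaves a condition on the continuous \<Phi> that survives the limit.\<close>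
    have "A \<subseteq> {t \<in> {0..1}. \<bar>\<Phi> t\<bar> \<le> e * s + W s}"
    proof
      fix t assume "t \<in> A"
      then have "t \<le> s" "t \<in> {0..1}" "\<bar>\<Phi> t\<bar> \<le> e * t + W t" using le_s by (auto simp: A_def)
      moreover have "e * t + W t \<le> e * s + W s"
        using \<open>t \<le> s\<close> s01 \<open>0 < e\<close> by (intro add_mono W_mono) auto
      ultimately show "t \<in> {t \<in> {0..1}. \<bar>\<Phi> t\<bar> \<le> e * s + W s}" by auto
    qed
    moreover have "closed {t \<in> {0..1}. \<bar>\<Phi> t\<bar> \<le> e * s + W s}"
    proof -
      have "{t \<in> {0..1}. \<bar>\<Phi> t\<bar> \<le> e * s + W s} = {0..1} \<inter> \<Phi> -` {- (e * s + W s)..e * s + W s}"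
        by (auto simp: abs_le_iff)
      then show ?thesis using continuous_closed_preimage[OF cont] by simp
    qed
    ultimately have "closure A \<subseteq> {t \<in> {0..1}. \<bar>\<Phi> t\<bar> \<le> e * s + W s}" by (rule closure_minimal)
    moreover have "s \<in> closure A" unfolding s_def using \<open>0 \<in> A\<close> bdd by (intro closure_contains_Sup) auto
    ultimately have Ps: "\<bar>\<Phi> s\<bar> \<le> e * s + W s" by auto
    have "s = 1"
    proof (rule ccontr)
      assume "s \<noteq> 1"
      then have s1: "0 \<le> s" "s < 1" using s01 by auto
      obtain r where r: "0 < r" "ball s r \<subseteq> d s" using open_d[of s] open_contains_ball by blast
      obtain r2 where r2: "0 < r2" "\<And>y. s \<notin> N \<Longrightarrow> s < y \<Longrightarrow> y < s + r2 \<Longrightarrow> \<bar>h y - h s - F s * (y - s)\<bar> \<le> e * (y - s)"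
      proof (cases "s \<in> N")
        case True then show ?thesis using that[of 1] by auto
      next
        case False
        then have "(h has_real_derivative F s) (at_right s)" using deriv[of s] s1 by (auto simp: F_def)
        then have "((\<lambda>y. (h y - h s) / (y - s)) \<longlongrightarrow> F s) (at_right s)"
          by (simp add: has_field_derivative_iff)
        then have "\<forall>\<^sub>F y in at_right s. dist ((h y - h s) / (y - s)) (F s) < e"
          using \<open>0 < e\<close> by (rule tendstoD)
        then obtain b where b: "b > s" "\<And>y. s < y \<Longrightarrow> y < b \<Longrightarrow> dist ((h y - h s) / (y - s)) (F s) < e"
          unfolding eventually_at_right_field by auto
        have "\<bar>h y - h s - F s * (y - s)\<bar> \<le> e * (y - s)" if "s < y" "y < s + (b - s)" for y
        proof -
          have "\<bar>h y - h s - F s * (y - s)\<bar> = \<bar>(h y - h s) / (y - s) - F s\<bar> * \<bar>y - s\<bar>"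
            using that by (simp add: abs_mult[symmetric] field_simps)
          also have "\<dots> \<le> e * \<bar>y - s\<bar>" using b(2)[of y] that by (intro mult_right_mono) (auto simp: dist_real_def)
          finally show ?thesis using that by simp
        qed
        then show ?thesis using that[of "b - s"] b by auto
      qed
      define m where "m = min (1 - s) (min r r2)"
      have m: "0 < m" "m \<le> 1 - s" "m \<le> r" "m \<le> r2" using s1 r r2 by (auto simp: m_def)
      define y where "y = s + m / 2"
      have y: "s < y" "y \<le> 1" "y < s + r2" "{s..y} \<subseteq> d s"
      proof -
        show "s < y" "y \<le> 1" "y < s + r2" using m by (auto simp: y_def)
        have "{s..y} \<subseteq> ball s r" using m by (auto simp: y_def dist_real_def)
        then show "{s..y} \<subseteq> d s" using r by blast
      qed
      have split: "integral {0..y} F = integral {0..s} F + integral {s..y} F"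
        using s1 y by (intro Henstock_Kurzweil_Integration.integral_combine[symmetric] intFab) auto
      have "\<bar>\<Phi> y - \<Phi> s\<bar> \<le> e * (y - s) + err (s, {s..y})"
      proof (cases "s \<in> N")
        case True
        then have "\<bar>\<Phi> y - \<Phi> s\<bar> \<le> err (s, {s..y})"
          using y by (simp add: \<Phi>_def err_def split F_def)
        then show ?thesis using y \<open>0 < e\<close> by (smt (verit) mult_nonneg_nonneg)
      next
        case False
        then show ?thesis using r2(2)[OF False y(1,3)] y(1)
          by (simp add: \<Phi>_def err_def split algebra_simps abs_le_iff)
      qed
      moreover have "\<bar>\<Phi> y\<bar> \<le> \<bar>\<Phi> s\<bar> + \<bar>\<Phi> y - \<Phi> s\<bar>" by simp
      ultimately have "\<bar>\<Phi> y\<bar> \<le> e * y + W y"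
        using Ps W_insert[OF s1(1) y(1,2,4)] by (simp add: algebra_simps)
      then have "y \<in> A" using y s1 by (auto simp: A_def)
      then show False using le_s y by force
    qed
    then have "\<bar>\<Phi> 1\<bar> \<le> e + W 1" using Ps by simp
    also have "W 1 \<le> 2 * e" by (rule W_le) (auto simp: PD_def err_le)
    finally show ?thesis by simp
  qed
  have "\<bar>\<Phi> 1\<bar> \<le> 0"
  proof (rule field_le_epsilon)
    fix e :: real assume "0 < e"
    then show "\<bar>\<Phi> 1\<bar> \<le> 0 + e" using small[of "e / 3"] by simp
  qed
  then have "h 1 - h 0 = integral {0..1} F" by (simp add: \<Phi>_def)
  also have "\<dots> = integral {0..1} f"
    by (rule integral_spike[OF N(1)]) (auto simp: F_def)
  finally show ?thesis .
qed

section \<open>Signed Choquet integrals and quantiles\<close>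

abbreviation unit_leb :: "real measure" where
  "unit_leb \<equiv> lebesgue_on {0<..<1}"

lemma unit_leb_prob: "prob_space unit_leb"
  by (rule prob_spaceI) (simp add: emeasure_restrict_space)

interpretation unit: prob_space unit_leb
  by (rule unit_leb_prob)

lemma mono_on_unit_measurable:
  assumes "mono_on {0<..<1} (q :: real \<Rightarrow> real)"
  shows "q \<in> borel_measurable unit_leb"
proof (rule measurableI)
  fix A :: "real set" assume A: "A \<in> sets borel"
  have "q \<in> borel_measurable (restrict_space borel {0<..<1})"
    by (rule borel_measurable_mono_on_fnc[OF assms])
  from measurable_sets[OF this A]
  obtain C where C: "C \<in> sets borel" "q -` A \<inter> {0<..<1} = {0<..<1} \<inter> C"
    by (auto simp: sets_restrict_space space_restrict_space)
  have "{0<..<1} \<inter> C \<in> sets unit_leb"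
    unfolding sets_restrict_space using C(1) by (intro imageI) simp
  then show "q -` A \<inter> space unit_leb \<in> sets unit_leb" using C(2) by simp
qed simp

lemma ident_unit_measurable: "(\<lambda>u. u) \<in> borel_measurable unit_leb"
  by (rule mono_on_unit_measurable) (simp add: mono_on_def)

text \<open>An antitone 1-Lipschitz map sends non-overlapping intervals to non-overlapping intervals
  of no larger total length. It is used for \<open>min t (1 - u)\<close>, which trades left
  derivatives at \<open>1 - u\<close> for right derivatives at \<open>u\<close>.\<close>

lemma abs_continuous_compose_antimono:
  assumes ac: "abs_continuous_on_unit h"
    and kmaps: "\<And>x. x \<in> {0..1} \<Longrightarrow> k x \<in> {0..1}"
    and anti: "\<And>x y. 0 \<le> x \<Longrightarrow> x \<le> y \<Longrightarrow> y \<le> 1 \<Longrightarrow> k y \<le> k x"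
    and lip: "\<And>x y. 0 \<le> x \<Longrightarrow> x \<le> y \<Longrightarrow> y \<le> 1 \<Longrightarrow> k x - k y \<le> y - x"
  shows "abs_continuous_on_unit (\<lambda>x. h (k x))"
  unfolding abs_continuous_on_unit_def
proof (intro allI impI)
  fix e :: real assume "0 < e"
  obtain d where "0 < d" and d: "\<forall>n (a :: nat \<Rightarrow> real) b.
      (\<forall>i<n. 0 \<le> a i \<and> a i \<le> b i \<and> b i \<le> 1) \<and>
      (\<forall>i<n. \<forall>j<n. i \<noteq> j \<longrightarrow> {a i<..<b i} \<inter> {a j<..<b j} = {}) \<and>
      (\<Sum>i<n. b i - a i) < d \<longrightarrow> (\<Sum>i<n. \<bar>h (b i) - h (a i)\<bar>) < e"
    using ac[unfolded abs_continuous_on_unit_def, THEN spec, THEN mp, OF \<open>0 < e\<close>]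
    by (elim exE conjE) (rule that)
  show "\<exists>d>0. \<forall>n (a :: nat \<Rightarrow> real) b. (\<forall>i<n. 0 \<le> a i \<and> a i \<le> b i \<and> b i \<le> 1) \<and>
         (\<forall>i<n. \<forall>j<n. i \<noteq> j \<longrightarrow> {a i<..<b i} \<inter> {a j<..<b j} = {}) \<and>
         (\<Sum>i<n. b i - a i) < d \<longrightarrow> (\<Sum>i<n. \<bar>h (k (b i)) - h (k (a i))\<bar>) < e"
  proof (intro exI[of _ d] conjI allI impI \<open>0 < d\<close>)
    fix n and a b :: "nat \<Rightarrow> real"
    assume asm: "(\<forall>i<n. 0 \<le> a i \<and> a i \<le> b i \<and> b i \<le> 1) \<and>
         (\<forall>i<n. \<forall>j<n. i \<noteq> j \<longrightarrow> {a i<..<b i} \<inter> {a j<..<b j} = {}) \<and> (\<Sum>i<n. b i - a i) < d"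
    then have ab: "0 \<le> a i" "a i \<le> b i" "b i \<le> 1" if "i < n" for i using that by auto
    have "(\<Sum>i<n. \<bar>h (k (a i)) - h (k (b i))\<bar>) < e"
    proof (rule d[rule_format], intro conjI allI impI)
      fix i assume i: "i < n"
      show "0 \<le> k (b i)" "k (a i) \<le> 1" using kmaps[of "a i"] kmaps[of "b i"] ab[OF i] by auto
      show "k (b i) \<le> k (a i)" using anti ab[OF i] by auto
      fix j assume j: "j < n" "i \<noteq> j"
      have "{a i<..<b i} \<inter> {a j<..<b j} = {}" using asm i j by blast
      then have "a i = b i \<or> a j = b j \<or> b i \<le> a j \<or> b j \<le> a i"
        using ab[OF i] ab[OF j(1)] by (auto simp: min_def max_def split: if_splits)
      then have "k (a i) = k (b i) \<or> k (a j) = k (b j) \<or> k (a j) \<le> k (b i) \<or> k (a i) \<le> k (b j)"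
        using anti ab[OF i] ab[OF j(1)] by (elim disjE) auto
      then show "{k (b i)<..<k (a i)} \<inter> {k (b j)<..<k (a j)} = {}" by (elim disjE) auto
    next
      have "(\<Sum>i<n. k (a i) - k (b i)) \<le> (\<Sum>i<n. b i - a i)"
        by (intro sum_mono lip) (use ab in auto)
      then show "(\<Sum>i<n. k (a i) - k (b i)) < d" using asm by linarith
    qed
    then show "(\<Sum>i<n. \<bar>h (k (b i)) - h (k (a i))\<bar>) < e" by (simp add: abs_minus_commute)
  qed
qed

text \<open>The fundamental theorem of calculus for the weight. The function
  \<open>h (min t (1 - u))\<close> runs from \<open>h t\<close> at 0 to \<open>h 0\<close> at 1; it
  is constant up to \<open>1 - t\<close> and has right derivative \<open>- \<gamma> u\<close> almost
  everywhere afterwards.\<close>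

lemma distortion_weight_primitive:
  assumes ac: "abs_continuous_on_unit h" and h0: "h 0 = 0" and w: "distortion_weight h \<gamma>"
    and int: "integrable unit_leb \<gamma>" and t: "t \<in> {0..1}"
  shows "h t = (LINT u|unit_leb. \<gamma> u * of_bool (1 - t < u))"
proof -
  define k where "k u = min t (1 - u)" for u :: real
  define f where "f u = - (\<gamma> u * of_bool (1 - t < u))" for u
  note ident_unit_measurable[measurable]
  have [measurable]: "\<gamma> \<in> borel_measurable unit_leb" using int by auto
  have intf: "integrable unit_leb f"
    unfolding f_def by (rule Bochner_Integration.integrable_bound[OF int]) auto
  have "(f has_integral (LINT u|unit_leb. f u)) {0<..<1}"
    by (rule has_integral_integral_lebesgue_on[OF intf]) simp
  then have f_int: "(f has_integral (LINT u|unit_leb. f u)) {0..1}"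
    by (simp add: has_integral_Icc_iff_Ioo)
  obtain N0 where N0: "N0 \<in> null_sets unit_leb"
      "\<And>u. u \<in> {0<..<1} - N0 \<Longrightarrow> (h has_real_derivative \<gamma> u) (at_left (1 - u))"
    using w unfolding distortion_weight_def eventually_ae_filter by auto
  have "negligible N0" using N0(1) by (auto simp: null_sets_restrict_space negligible_iff_null_sets)
  \<comment> \<open>At the kink \<open>1 - t\<close> the right derivative belongs to the moving
    branch while \<open>f\<close> is still 0; at 0 the weight says nothing.\<close>
  then have negl: "negligible (N0 \<union> {0, 1 - t})" by simp
  have "h (k 1) - h (k 0) = integral {0..1} f"
  proof (rule abs_continuous_right_derivative_integral[OF _ has_integral_integrable[OF f_int] negl])
    show "abs_continuous_on_unit (\<lambda>x. h (k x))"
      by (rule abs_continuous_compose_antimono[OF ac]) (use t in \<open>auto simp: k_def\<close>)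
    fix u assume u: "u \<in> {0..<1} - (N0 \<union> {0, 1 - t})"
    show "((\<lambda>x. h (k x)) has_real_derivative f u) (at_right u)"
    proof (cases "1 - t < u")
      case True
      have img: "(\<lambda>v. 1 - v) ` {u..} = {..1 - u}"
        by (auto simp: image_iff intro: bexI[of _ "1 - _"])
      have "(h has_real_derivative \<gamma> u) (at (1 - u) within (\<lambda>v. 1 - v) ` {u..})"
        using N0(2)[of u] u unfolding img at_within_Iic_at_left by auto
      moreover have "((\<lambda>v. 1 - v) has_real_derivative -1) (at u within {u..})"
        by (auto intro!: derivative_eq_intros)
      ultimately have "(h \<circ> (\<lambda>v. 1 - v) has_real_derivative \<gamma> u * -1) (at u within {u..})"
        by (rule DERIV_image_chain)
      then have "((\<lambda>x. h (k x)) has_real_derivative \<gamma> u * -1) (at u within {u..})"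
        by (rule has_field_derivative_transform_within[where d=1]) (use True in \<open>auto simp: k_def min_def\<close>)
      then show ?thesis using True by (simp add: f_def at_within_Ici_at_right)
    next
      case False
      then have "u < 1 - t" using u by auto
      have "((\<lambda>x. h t) has_real_derivative 0) (at u within {u..})" by simp
      then have "((\<lambda>x. h (k x)) has_real_derivative 0) (at u within {u..})"
        by (rule has_field_derivative_transform_within[where d="1 - t - u"])
          (use \<open>u < 1 - t\<close> in \<open>auto simp: k_def min_def dist_real_def\<close>)
      then show ?thesis using False by (simp add: f_def at_within_Ici_at_right)
    qed
  qed simp
  then have "h t = - integral {0..1} f" using t h0 by (simp add: k_def)
  also have "integral {0..1} f = (LINT u|unit_leb. f u)" using f_int by (rule integral_unique)
  finally show ?thesis by (simp add: f_def)
qed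

text \<open>\<open>q\<close> carries the law of \<open>Y\<close> on the unit interval. Unlike the quantile function it need not be
  left-continuous, so that sums of non-decreasing functions can be used directly.\<close>

definition quantile_repr :: "'w measure \<Rightarrow> ('w \<Rightarrow> real) \<Rightarrow> (real \<Rightarrow> real) \<Rightarrow> bool" where
  "quantile_repr M Y q \<longleftrightarrow> mono_on {0<..<1} q \<and>
    (\<forall>x. measure M {\<omega> \<in> space M. x \<le> Y \<omega>} = measure unit_leb {u \<in> {0<..<1}. x \<le> q u})"

text \<open>An upper level set of a non-decreasing function is a final segment of the unit interval,
  so its measure determines it up to the left end point.\<close>

lemma up_set_AE_eq_tail:
  fixes q :: "real \<Rightarrow> real"
  assumes q: "mono_on {0<..<1} q"
  shows "AE u in unit_leb. x \<le> q u \<longleftrightarrow> 1 - measure unit_leb {u \<in> {0<..<1}. x \<le> q u} < u"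
proof -
  let ?S = "{u \<in> {0<..<1}. x \<le> q u}"
  have [measurable]: "q \<in> borel_measurable unit_leb" by (rule mono_on_unit_measurable[OF q])
  have "{u \<in> space unit_leb. x \<le> q u} \<in> sets unit_leb" by measurable
  then have S: "?S \<in> sets unit_leb" by simp
  \<comment> \<open>An empty level set gets the left end point 1, so that its measure is
    \<open>1 - s\<close> in this case as well.\<close>
  define s where "s = (if ?S = {} then 1 else Inf ?S)"
  have bdd: "bdd_below ?S" by (auto intro!: bdd_belowI[of _ 0])
  have s01: "0 \<le> s" "s \<le> 1"
  proof -
    show "0 \<le> s" unfolding s_def by (auto intro!: cInf_greatest)
    show "s \<le> 1"
    proof (cases "?S = {}")
      case False
      then obtain u where u: "u \<in> ?S" by blast
      have "Inf ?S \<le> u" using u bdd by (rule cInf_lower)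
      also have "u \<le> 1" using u by simp
      finally show ?thesis using False by (simp add: s_def)
    qed (simp add: s_def)
  qed
  have sub1: "{s<..<1} \<subseteq> ?S"
  proof
    fix u assume u: "u \<in> {s<..<1}"
    then have ne: "?S \<noteq> {}" by (auto simp: s_def split: if_splits)
    then have "s = Inf ?S" unfolding s_def by (rule if_not_P)
    then have "Inf ?S < u" using u by simp
    then obtain v where v: "v \<in> ?S" "v < u" using ne bdd by (auto simp: cInf_less_iff)
    then have "q v \<le> q u" using q u by (auto simp: mono_on_def)
    then show "u \<in> ?S" using v u by auto
  qed
  have sub2: "?S \<subseteq> {s..<1}"
  proof
    fix u assume u: "u \<in> ?S"
    then have "Inf ?S \<le> u" using bdd by (rule cInf_lower)
    then show "u \<in> {s..<1}" using u by (auto simp: s_def)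
  qed
  have "measure unit_leb {s<..<1} = 1 - s"
  proof -
    have "measure unit_leb {s<..<1} = measure lebesgue {s<..<1}"
      using s01 by (intro measure_restrict_space) auto
    then show ?thesis using s01 by simp
  qed
  moreover have "measure unit_leb {s<..<1} \<le> measure unit_leb ?S"
    by (rule unit.finite_measure_mono[OF sub1 S])
  moreover have "measure unit_leb ?S \<le> 1 - s"
  proof -
    have "measure unit_leb ?S = measure lebesgue ?S" by (rule measure_restrict_space) auto
    also have "\<dots> \<le> measure lebesgue {s..<1}"
    proof (rule measure_mono_fmeasurable[OF sub2])
      show "?S \<in> sets lebesgue" using S by (simp add: sets_restrict_space_iff)
      show "{s..<1} \<in> lmeasurable" by (rule bounded_set_imp_lmeasurable) auto
    qed
    also have "\<dots> = 1 - s" using s01 by simp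
    finally show ?thesis .
  qed
  ultimately have m: "measure unit_leb ?S = 1 - s" by simp
  have "AE u in lebesgue. u \<noteq> s" using AE_completion[OF AE_lborel_singleton] .
  then have "AE u in unit_leb. u \<noteq> s" by (subst AE_restrict_space_iff) (auto elim: eventually_mono)
  then show ?thesis
  proof (rule AE_mp, intro AE_I2 impI)
    fix u assume u: "u \<in> space unit_leb" "u \<noteq> s"
    show "x \<le> q u \<longleftrightarrow> 1 - measure unit_leb ?S < u"
      unfolding m using sub1 sub2 u by (auto simp: subset_iff)
  qed
qed

text \<open>The level set of \<open>q\<close> above \<open>x\<close> is the final segment whose
  length is the tail probability, and \<open>h\<close> of that length is the integral of \<gamma>
  over it.\<close>

lemma distortion_of_tail:
  assumes ac: "abs_continuous_on_unit h" and h0: "h 0 = 0" and w: "distortion_weight h \<gamma>"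
    and int: "integrable unit_leb \<gamma>" and Y: "quantile_repr M Y q"
  shows "h (measure M {\<omega> \<in> space M. x \<le> Y \<omega>}) = (LINT u|unit_leb. \<gamma> u * of_bool (x \<le> q u))"
proof -
  let ?m = "measure unit_leb {u \<in> {0<..<1}. x \<le> q u}"
  have q: "mono_on {0<..<1} q" using Y by (simp add: quantile_repr_def)
  have [measurable]: "q \<in> borel_measurable unit_leb" by (rule mono_on_unit_measurable[OF q])
  have [measurable]: "\<gamma> \<in> borel_measurable unit_leb" using int by auto
  note ident_unit_measurable[measurable]
  have "h ?m = (LINT u|unit_leb. \<gamma> u * of_bool (1 - ?m < u))"
    by (rule distortion_weight_primitive[OF ac h0 w int]) simp
  also have "\<dots> = (LINT u|unit_leb. \<gamma> u * of_bool (x \<le> q u))"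
    by (rule integral_cong_AE) (use up_set_AE_eq_tail[OF q, of x] in auto)
  finally show ?thesis using Y by (simp add: quantile_repr_def)
qed

text \<open>Each indicator alone has infinite integral over the line; their difference is a signed
  indicator of the interval between \<open>a\<close> and \<open>b\<close>.\<close>

lemma has_bochner_integral_of_bool_diff:
  fixes a b :: real
  shows "has_bochner_integral lborel (\<lambda>x. of_bool (x \<le> a) - of_bool (x \<le> b)) (a - b)"
    and "has_bochner_integral lborel (\<lambda>x. \<bar>of_bool (x \<le> a) - of_bool (x \<le> b)\<bar>) \<bar>a - b\<bar>"
proof -
  have I: "has_bochner_integral lborel (indicator {u<..v}) (v - u)" if "u \<le> v" for u v :: real
    using has_bochner_integral_real_indicator[of "{u<..v}" lborel] that by simp
  consider "b \<le> a" | "a \<le> b" by linarith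
  then have "has_bochner_integral lborel (\<lambda>x. of_bool (x \<le> a) - of_bool (x \<le> b)) (a - b) \<and>
    has_bochner_integral lborel (\<lambda>x. \<bar>of_bool (x \<le> a) - of_bool (x \<le> b)\<bar>) \<bar>a - b\<bar>"
  proof cases
    case 1
    have "(\<lambda>x. of_bool (x \<le> a) - of_bool (x \<le> b)) = (indicator {b<..a} :: real \<Rightarrow> real)"
      "(\<lambda>x. \<bar>of_bool (x \<le> a) - of_bool (x \<le> b)\<bar>) = (indicator {b<..a} :: real \<Rightarrow> real)"
      using 1 by (auto simp: fun_eq_iff indicator_def)
    then show ?thesis using I[OF 1] 1 by simp
  next
    case 2
    have "(\<lambda>x. of_bool (x \<le> a) - of_bool (x \<le> b)) = (\<lambda>x. - indicator {a<..b} x :: real)"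
      "(\<lambda>x. \<bar>of_bool (x \<le> a) - of_bool (x \<le> b)\<bar>) = (indicator {a<..b} :: real \<Rightarrow> real)"
      using 2 by (auto simp: fun_eq_iff indicator_def)
    then show ?thesis using I[OF 2] has_bochner_integral_minus[OF I[OF 2]] 2 by simp
  qed
  then show "has_bochner_integral lborel (\<lambda>x. of_bool (x \<le> a) - of_bool (x \<le> b)) (a - b)"
    and "has_bochner_integral lborel (\<lambda>x. \<bar>of_bool (x \<le> a) - of_bool (x \<le> b)\<bar>) \<bar>a - b\<bar>" by auto
qed

text \<open>Fubini is applied to the difference of the two tail functions, whose \<open>x\<close>-integral converges
  absolutely; no sign condition on \<open>\<gamma>\<close> and no integrability of \<open>\<gamma> q\<^sub>1\<close> or \<open>\<gamma> q\<^sub>2\<close> is involved.\<close>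

lemma signed_choquet_diff:
  assumes ac: "abs_continuous_on_unit h" and h0: "h 0 = 0" and w: "distortion_weight h \<gamma>"
    and int: "integrable unit_leb \<gamma>"
    and Y1: "quantile_repr M Y1 q1" and Y2: "quantile_repr M Y2 q2"
    and intq: "integrable unit_leb (\<lambda>u. \<gamma> u * (q1 u - q2 u))"
    and fin: "signed_choquet_finite M h Y2"
  shows "signed_choquet_finite M h Y1"
    and "signed_choquet M h Y1 = signed_choquet M h Y2 + (LINT u|unit_leb. \<gamma> u * (q1 u - q2 u))"
proof -
  define D where "D x = h (measure M {\<omega> \<in> space M. x \<le> Y1 \<omega>}) - h (measure M {\<omega> \<in> space M. x \<le> Y2 \<omega>})" for x
  define F where "F u x = \<gamma> u * (of_bool (x \<le> q1 u) - of_bool (x \<le> q2 u))" for u x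
  have [measurable]: "q1 \<in> borel_measurable unit_leb" "q2 \<in> borel_measurable unit_leb"
    using Y1 Y2 by (auto simp: quantile_repr_def mono_on_unit_measurable)
  have [measurable]: "\<gamma> \<in> borel_measurable unit_leb" using int by auto
  have D_eq: "D x = (LINT u|unit_leb. F u x)" for x
  proof -
    have "integrable unit_leb (\<lambda>u. \<gamma> u * of_bool (x \<le> q u))" if [measurable]: "q \<in> borel_measurable unit_leb" for q
      by (rule Bochner_Integration.integrable_bound[OF int]) auto
    then show ?thesis
      unfolding D_def F_def distortion_of_tail[OF ac h0 w int Y1] distortion_of_tail[OF ac h0 w int Y2]
      by (subst Bochner_Integration.integral_diff[symmetric]) (auto simp: algebra_simps)
  qed
  interpret P: pair_sigma_finite unit_leb lborel ..
  have F_sec: "has_bochner_integral lborel (F u) (\<gamma> u * (q1 u - q2 u))"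
    "has_bochner_integral lborel (\<lambda>x. norm (F u x)) \<bar>\<gamma> u * (q1 u - q2 u)\<bar>" for u
    unfolding F_def real_norm_def abs_mult
    by (intro has_bochner_integral_mult_right has_bochner_integral_of_bool_diff)+
  have "integrable (unit_leb \<Otimes>\<^sub>M lborel) (case_prod F)"
  proof (rule P.Fubini_integrable)
    show "case_prod F \<in> borel_measurable (unit_leb \<Otimes>\<^sub>M lborel)"
      unfolding F_def case_prod_unfold by measurable
    show "integrable unit_leb (\<lambda>u. LINT x|lborel. norm (case_prod F (u, x)))"
      using intq by (simp add: has_bochner_integral_integral_eq[OF F_sec(2)[unfolded real_norm_def]] integrable_abs)
    show "AE u in unit_leb. integrable lborel (\<lambda>x. case_prod F (u, x))"
      using F_sec(1) by (auto simp: has_bochner_integral_iff)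
  qed
  from P.Fubini_integral[OF this] P.integrable_snd[OF this]
  have D: "integrable lborel D" "(LINT x|lborel. D x) = (LINT u|unit_leb. \<gamma> u * (q1 u - q2 u))"
    by (simp_all add: D_eq[abs_def] has_bochner_integral_integral_eq[OF F_sec(1)])
  have D_set: "set_integrable lborel A D" if "A \<in> sets lborel" for A
    unfolding set_integrable_def by (rule integrable_mult_indicator) (use that D(1) in auto)
  let ?L = "\<lambda>Y x. h (measure M {\<omega> \<in> space M. x \<le> Y \<omega>}) - h 1"
  let ?R = "\<lambda>Y x. h (measure M {\<omega> \<in> space M. x \<le> Y \<omega>})"
  \<comment> \<open>The correction \<open>- h 1\<close> on the negative half-line cancels in the
    difference, so both halves change by the same \<open>D\<close>.\<close>
  have eqL: "?L Y1 = (\<lambda>x. ?L Y2 x + D x)" and eqR: "?R Y1 = (\<lambda>x. ?R Y2 x + D x)"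
    by (auto simp: D_def)
  have fin2: "set_integrable lborel {..<0} (?L Y2)" "set_integrable lborel {0..} (?R Y2)"
    using fin by (auto simp: signed_choquet_finite_def)
  note L = set_integral_add[OF fin2(1) D_set[of "{..<0}"]] and R = set_integral_add[OF fin2(2) D_set[of "{0..}"]]
  show "signed_choquet_finite M h Y1"
    unfolding signed_choquet_finite_def eqL eqR using L(1) R(1) by simp
  have "(LBINT x:{..<0}. D x) + (LBINT x:{0..}. D x) = (LBINT x:{..<0} \<union> {0..}. D x)"
    by (rule set_integral_Un[symmetric]) (auto intro: D_set)
  also have "{..<0} \<union> {0..} = (UNIV :: real set)" by auto
  also have "(LBINT x:UNIV. D x) = (LINT x|lborel. D x)" by (simp add: set_lebesgue_integral_def)
  finally show "signed_choquet M h Y1 = signed_choquet M h Y2 + (LINT u|unit_leb. \<gamma> u * (q1 u - q2 u))"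
    unfolding signed_choquet_def eqL eqR using L(2) R(2) D(2) by simp
qed

text \<open>Comparison with the zero variable, whose Choquet integral is 0 and whose law is carried
  by the zero function.\<close>

lemma signed_choquet_eq_weighted_quantile:
  assumes "prob_space M" and ac: "abs_continuous_on_unit h" and h0: "h 0 = 0" and w: "distortion_weight h \<gamma>"
    and int: "integrable unit_leb \<gamma>"
    and Y: "quantile_repr M Y q" and intq: "integrable unit_leb (\<lambda>u. \<gamma> u * q u)"
  shows "signed_choquet M h Y = (LINT u|unit_leb. \<gamma> u * q u)"
proof -
  interpret prob_space M by fact
  have tail: "measure M {\<omega> \<in> space M. x \<le> 0} = of_bool (x \<le> 0)" for x :: real
    by (simp add: prob_space)
  have "{u :: real. 0 < u \<and> u < 1} = {0<..<1}" by auto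
  then have tail': "measure unit_leb {u \<in> {0<..<1}. x \<le> 0} = of_bool (x \<le> 0)" for x :: real
    by (simp add: measure_restrict_space)
  have Y0: "quantile_repr M (\<lambda>_. 0) (\<lambda>_. 0)"
    unfolding quantile_repr_def tail tail' by (simp add: mono_on_def)
  \<comment> \<open>At \<open>x = 0\<close> the tail of the zero variable is still 1, so the
    integrand is \<open>h 1\<close> at a single point rather than identically zero.\<close>
  have "AE x in lborel. indicator {0..} x *\<^sub>R h (of_bool (x \<le> (0 :: real))) = 0"
    by (rule AE_mp[OF AE_lborel_singleton[of 0]]) (auto simp: indicator_def h0)
  moreover have "(\<lambda>x. indicator {0..} x *\<^sub>R h (of_bool (x \<le> (0 :: real)))) = (\<lambda>x. indicator {0} x *\<^sub>R h 1)"
    by (auto simp: fun_eq_iff indicator_def h0)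
  ultimately have R: "set_integrable lborel {0..} (\<lambda>x. h (of_bool (x \<le> (0 :: real))))"
    "(LBINT x:{0..}. h (of_bool (x \<le> (0 :: real)))) = 0"
    unfolding set_integrable_def set_lebesgue_integral_def by (auto intro!: integral_eq_zero_AE)
  have L0: "(\<lambda>x :: real. indicator {..<0} x *\<^sub>R (h (of_bool (x \<le> 0)) - h 1)) = (\<lambda>_. 0)"
    by (auto simp: fun_eq_iff indicator_def)
  then have L: "set_integrable lborel {..<0} (\<lambda>x. h (of_bool (x \<le> (0 :: real))) - h 1)"
    "(LBINT x:{..<0}. h (of_bool (x \<le> (0 :: real))) - h 1) = 0"
    unfolding set_integrable_def set_lebesgue_integral_def by simp_all
  have "signed_choquet_finite M h (\<lambda>_. 0)" "signed_choquet M h (\<lambda>_. 0) = 0"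
    unfolding signed_choquet_finite_def signed_choquet_def tail using L R by auto
  then show ?thesis
    using signed_choquet_diff(2)[OF ac h0 w int Y Y0] intq by simp
qed

section \<open>Quantile functions and the quantile transform\<close>

lemma emeasure_unit_borel:
  assumes "A \<in> sets borel" "A \<subseteq> {0<..<1}"
  shows "emeasure unit_leb A = emeasure lborel A"
  using assms by (simp add: emeasure_restrict_space)

lemma mono_on_unit_borel_vimage:
  assumes "mono_on {0<..<1} (q :: real \<Rightarrow> real)" "A \<in> sets borel"
  shows "{u \<in> {0<..<1}. q u \<in> A} \<in> sets borel"
proof -
  have "q \<in> borel_measurable (restrict_space borel {0<..<1})"
    by (rule borel_measurable_mono_on_fnc[OF assms(1)])
  from measurable_sets[OF this assms(2)]
  have "q -` A \<inter> {0<..<1} \<in> sets borel"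
    by (auto simp: sets_restrict_space space_restrict_space)
  moreover have "q -` A \<inter> {0<..<1} = {u \<in> {0<..<1}. q u \<in> A}" by auto
  ultimately show ?thesis by simp
qed

context prob_space
begin

lemma dist_fun_eq_cdf:
  assumes "Y \<in> borel_measurable M"
  shows "dist_fun M Y x = cdf (distr M borel Y) x"
  using assms by (auto simp: dist_fun_def cdf_def measure_distr intro!: arg_cong[where f=prob])

lemma cdf_distribution_distr:
  assumes "Y \<in> borel_measurable M"
  shows "cdf_distribution (distr M borel Y)"
  unfolding cdf_distribution_def using assms by (rule real_distribution_distr)

text \<open>The Galois connection between quantile and distribution function; monotonicity, left
  continuity and the transport inequality are read off from it.\<close>

lemma quantile_le_iff:
  assumes Y: "Y \<in> borel_measurable M" and u: "u \<in> {0<..<1}"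
  shows "quantile M Y u \<le> x \<longleftrightarrow> u \<le> dist_fun M Y x"
proof -
  interpret C: cdf_distribution "distr M borel Y" by (rule cdf_distribution_distr[OF Y])
  show ?thesis using C.pseudoinverse[of u x] u by (simp add: quantile_def dist_fun_eq_cdf[OF Y])
qed

lemma mono_on_quantile:
  assumes Y: "Y \<in> borel_measurable M"
  shows "mono_on {0<..<1} (quantile M Y)"
  unfolding mono_on_def
proof (intro allI impI)
  fix r s :: real assume a: "r \<in> {0<..<1} \<and> s \<in> {0<..<1} \<and> r \<le> s"
  then have "s \<le> dist_fun M Y (quantile M Y s)" using quantile_le_iff[OF Y, of s "quantile M Y s"] by simp
  then show "quantile M Y r \<le> quantile M Y s" using a quantile_le_iff[OF Y, of r "quantile M Y s"] by simp
qed

text \<open>By the Galois connection, the quantile at \<open>v\<close> exceeds its value at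
  \<open>u\<close> minus \<open>e\<close> as soon as \<open>v\<close> exceeds the distribution
  function there, a number strictly below \<open>u\<close>. This places quantile functions in
  \<open>isotonic_cone\<close>.\<close>

lemma continuous_at_left_quantile:
  assumes Y: "Y \<in> borel_measurable M" and u: "u \<in> {0<..<1}"
  shows "continuous (at_left u) (quantile M Y)"
  unfolding continuous_within
proof (rule tendstoI)
  fix e :: real assume "0 < e"
  let ?F = "dist_fun M Y (quantile M Y u - e)"
  have F: "?F < u" using quantile_le_iff[OF Y u, of "quantile M Y u - e"] \<open>0 < e\<close> by auto
  have "\<forall>\<^sub>F v in at_left u. max 0 ?F < v \<and> v < u"
    unfolding eventually_at_left_field using F u by (intro exI[of _ "max 0 ?F"]) auto
  then show "\<forall>\<^sub>F v in at_left u. dist (quantile M Y v) (quantile M Y u) < e"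
  proof eventually_elim
    case (elim v)
    then have v: "v \<in> {0<..<1}" using u by auto
    have "quantile M Y v \<le> quantile M Y u" using mono_on_quantile[OF Y] v u elim by (auto simp: mono_on_def)
    moreover have "quantile M Y u - e < quantile M Y v"
      using quantile_le_iff[OF Y v, of "quantile M Y u - e"] elim by auto
    ultimately show ?case by (auto simp: dist_real_def)
  qed
qed

text \<open>The quantile transform, known for Borel measure on the unit interval. Preimages of Borel
  sets under a monotone function are Borel, so passing to the completed measure changes
  nothing.\<close>

lemma emeasure_quantile_vimage:
  assumes Y: "Y \<in> borel_measurable M" and A: "A \<in> sets borel"
  shows "emeasure unit_leb {u \<in> {0<..<1}. quantile M Y u \<in> A} = emeasure M {\<omega> \<in> space M. Y \<omega> \<in> A}"
proof -
  interpret C: cdf_distribution "distr M borel Y" by (rule cdf_distribution_distr[OF Y])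
  let ?U = "restrict_space lborel {0<..<1::real}"
  have q: "quantile M Y = (\<lambda>u. Inf {x. u \<le> cdf (distr M borel Y) x})"
    by (simp add: quantile_def dist_fun_eq_cdf[OF Y] fun_eq_iff)
  have meas: "quantile M Y \<in> borel_measurable ?U"
    using borel_measurable_mono_on_fnc[OF mono_on_quantile[OF Y]]
    by (simp cong: measurable_cong_sets)
  have "emeasure M {\<omega> \<in> space M. Y \<omega> \<in> A} = emeasure (distr M borel Y) A"
    using Y A by (auto simp: emeasure_distr intro!: arg_cong[where f="emeasure M"])
  also have "\<dots> = emeasure (distr ?U borel (quantile M Y)) A"
    unfolding q using C.distr_I_eq_M by simp
  also have "\<dots> = emeasure ?U {u \<in> {0<..<1}. quantile M Y u \<in> A}"
    using meas A by (auto simp: emeasure_distr space_restrict_space intro!: arg_cong[where f="emeasure ?U"])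
  also have "\<dots> = emeasure lborel {u \<in> {0<..<1}. quantile M Y u \<in> A}"
    by (rule emeasure_restrict_space) auto
  also have "\<dots> = emeasure unit_leb {u \<in> {0<..<1}. quantile M Y u \<in> A}"
    using mono_on_unit_borel_vimage[OF mono_on_quantile[OF Y] A]
    by (intro emeasure_unit_borel[symmetric]) auto
  finally show ?thesis by simp
qed

lemma quantile_repr_quantile:
  assumes Y: "Y \<in> borel_measurable M"
  shows "quantile_repr M Y (quantile M Y)"
  unfolding quantile_repr_def
proof (intro conjI allI mono_on_quantile[OF Y])
  show "prob {\<omega> \<in> space M. x \<le> Y \<omega>} = measure unit_leb {u \<in> {0<..<1}. x \<le> quantile M Y u}" for x
    using emeasure_quantile_vimage[OF Y, of "{x..}"] by (simp add: measure_def)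
qed

end

text \<open>Squaring the length of \<open>{b..<a}\<close> writes a squared positive part as an integral of indicators,
  which turns the transport inequality into a comparison of joint tail probabilities.\<close>

lemma nn_integral_square_box:
  fixes a b :: real
  shows "(\<integral>\<^sup>+z. indicator {z. b \<le> fst z \<and> b \<le> snd z \<and> fst z < a \<and> snd z < a} z \<partial>(lborel \<Otimes>\<^sub>M lborel)) =
    ennreal ((max 0 (a - b))\<^sup>2)"
proof -
  have "{z. b \<le> fst z \<and> b \<le> snd z \<and> fst z < a \<and> snd z < a} = {b..<a} \<times> {b..<a}" by auto
  then have "(\<integral>\<^sup>+z. indicator {z. b \<le> fst z \<and> b \<le> snd z \<and> fst z < a \<and> snd z < a} z \<partial>(lborel \<Otimes>\<^sub>M lborel)) =
      emeasure (lborel \<Otimes>\<^sub>M lborel) ({b..<a} \<times> {b..<a})"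
    by (simp add: nn_integral_indicator)
  also have "\<dots> = emeasure lborel {b..<a} * emeasure lborel {b..<a}"
    by (rule lborel.emeasure_pair_measure_Times) auto
  also have "\<dots> = ennreal ((max 0 (a - b))\<^sup>2)"
    by (cases "b \<le> a") (auto simp: max_def power2_eq_square ennreal_mult)
  finally show ?thesis .
qed

text \<open>Tonelli applied to the box identity: for fixed \<open>z\<close>, the condition that
  \<open>z\<close> lies in the box of \<open>w\<close> involves only the smaller and the larger
  coordinate of \<open>z\<close>.\<close>

lemma nn_integral_square_pos_part:
  assumes "sigma_finite_measure N"
    and [measurable]: "A \<in> borel_measurable N" "B \<in> borel_measurable N"
  shows "(\<integral>\<^sup>+w. ennreal ((max 0 (A w - B w))\<^sup>2) \<partial>N) =
    (\<integral>\<^sup>+z. emeasure N {w \<in> space N. B w \<le> min (fst z) (snd z) \<and> max (fst z) (snd z) < A w} \<partial>(lborel \<Otimes>\<^sub>M lborel))"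
proof -
  interpret N: sigma_finite_measure N by fact
  have "sigma_finite_measure (lborel \<Otimes>\<^sub>M lborel :: (real \<times> real) measure)"
    unfolding lborel_prod by (rule lborel.sigma_finite_measure_axioms)
  then interpret P: pair_sigma_finite "lborel \<Otimes>\<^sub>M lborel :: (real \<times> real) measure" N
    by (intro pair_sigma_finite.intro N.sigma_finite_measure_axioms)
  let ?f = "\<lambda>z w. of_bool (B w \<le> fst z \<and> B w \<le> snd z \<and> fst z < A w \<and> snd z < A w) :: ennreal"
  have "(\<integral>\<^sup>+w. ennreal ((max 0 (A w - B w))\<^sup>2) \<partial>N) = (\<integral>\<^sup>+w. \<integral>\<^sup>+z. ?f z w \<partial>(lborel \<Otimes>\<^sub>M lborel) \<partial>N)"
    unfolding nn_integral_square_box[symmetric]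
    by (intro nn_integral_cong) (auto simp: indicator_def of_bool_def)
  also have "\<dots> = (\<integral>\<^sup>+z. \<integral>\<^sup>+w. ?f z w \<partial>N \<partial>(lborel \<Otimes>\<^sub>M lborel))"
    by (rule P.Fubini') measurable
  also have "\<dots> = (\<integral>\<^sup>+z. emeasure N {w \<in> space N. B w \<le> min (fst z) (snd z) \<and> max (fst z) (snd z) < A w} \<partial>(lborel \<Otimes>\<^sub>M lborel))"
  proof (rule nn_integral_cong)
    fix z :: "real \<times> real"
    have "(\<integral>\<^sup>+w. ?f z w \<partial>N) = (\<integral>\<^sup>+w. indicator {w \<in> space N. B w \<le> min (fst z) (snd z) \<and> max (fst z) (snd z) < A w} w \<partial>N)"
      by (intro nn_integral_cong) (auto simp: indicator_def of_bool_def)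
    also have "\<dots> = emeasure N {w \<in> space N. B w \<le> min (fst z) (snd z) \<and> max (fst z) (snd z) < A w}"
      by (intro nn_integral_indicator) measurable
    finally show "(\<integral>\<^sup>+w. ?f z w \<partial>N) = emeasure N {w \<in> space N. B w \<le> min (fst z) (snd z) \<and> max (fst z) (snd z) < A w}" .
  qed
  finally show ?thesis .
qed

context prob_space
begin

text \<open>For every coupling the event \<open>B \<le> s\<close>, \<open>t < A\<close> has
  probability at least the difference of the distribution functions of \<open>B\<close> at
  \<open>s\<close> and of \<open>A\<close> at \<open>t\<close>. Under the quantile coupling it lies
  in an interval of exactly this length, so each tail probability under the integral is smallest
  there.\<close>

lemma quantile_pos_part_le:
  assumes A[measurable]: "A \<in> borel_measurable M" and B[measurable]: "B \<in> borel_measurable M"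
  shows "(\<integral>\<^sup>+u. ennreal ((max 0 (quantile M A u - quantile M B u))\<^sup>2) \<partial>unit_leb)
    \<le> (\<integral>\<^sup>+\<omega>. ennreal ((max 0 (A \<omega> - B \<omega>))\<^sup>2) \<partial>M)"
proof -
  have [measurable]: "quantile M A \<in> borel_measurable unit_leb" "quantile M B \<in> borel_measurable unit_leb"
    by (auto intro: mono_on_unit_measurable mono_on_quantile A B)
  have "emeasure unit_leb {u \<in> space unit_leb. quantile M B u \<le> s \<and> t < quantile M A u}
      \<le> emeasure M {\<omega> \<in> space M. B \<omega> \<le> s \<and> t < A \<omega>}" for s t
  proof -
    let ?E = "{\<omega> \<in> space M. B \<omega> \<le> s \<and> t < A \<omega>}"
    let ?Q = "{u \<in> space unit_leb. quantile M B u \<le> s \<and> t < quantile M A u}"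
    have "emeasure unit_leb ?Q = emeasure lebesgue ?Q"
      by (rule emeasure_restrict_space) auto
    also have "\<dots> \<le> emeasure lebesgue {dist_fun M A t<..dist_fun M B s}"
    proof (rule emeasure_mono)
      show "?Q \<subseteq> {dist_fun M A t<..dist_fun M B s}"
        using quantile_le_iff[OF A, of _ t] quantile_le_iff[OF B, of _ s] by (auto simp: not_le[symmetric])
    qed simp
    also have "\<dots> \<le> ennreal (prob ?E)"
    proof (cases "dist_fun M A t \<le> dist_fun M B s")
      case True
      have "dist_fun M B s \<le> prob ({\<omega> \<in> space M. A \<omega> \<le> t} \<union> ?E)"
        unfolding dist_fun_def by (rule finite_measure_mono) auto
      also have "\<dots> \<le> dist_fun M A t + prob ?E"
        unfolding dist_fun_def by (rule measure_Un_le) measurable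
      finally show ?thesis using True by (simp add: ennreal_leI)
    qed simp
    also have "\<dots> = emeasure M ?E" by (simp add: emeasure_eq_measure)
    finally show ?thesis .
  qed
  note tails = this
  show ?thesis
    unfolding nn_integral_square_pos_part[OF unit.sigma_finite_measure_axioms \<open>quantile M A \<in> _\<close> \<open>quantile M B \<in> _\<close>]
      nn_integral_square_pos_part[OF sigma_finite_measure_axioms A B]
    by (intro nn_integral_mono tails)
qed

text \<open>A square is the sum of the squared positive parts of \<open>a - b\<close> and
  \<open>b - a\<close>; the one-sided bound applies to both orders.\<close>

lemma quantile_square_distance_le:
  assumes A[measurable]: "A \<in> borel_measurable M" and B[measurable]: "B \<in> borel_measurable M"
  shows "(\<integral>\<^sup>+u. ennreal ((quantile M A u - quantile M B u)\<^sup>2) \<partial>unit_leb)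
    \<le> (\<integral>\<^sup>+\<omega>. ennreal ((A \<omega> - B \<omega>)\<^sup>2) \<partial>M)"
proof -
  have [measurable]: "quantile M A \<in> borel_measurable unit_leb" "quantile M B \<in> borel_measurable unit_leb"
    by (auto intro: mono_on_unit_measurable mono_on_quantile A B)
  have split: "ennreal ((a - b)\<^sup>2) = ennreal ((max 0 (a - b))\<^sup>2) + ennreal ((max 0 (b - a))\<^sup>2)" for a b :: real
    by (auto simp: max_def power2_commute)
  show ?thesis unfolding split
    by (subst (1 2) nn_integral_add) (auto intro!: add_mono quantile_pos_part_le)
qed

lemma quantile_cong:
  assumes "dist_fun M Y = dist_fun M Z"
  shows "quantile M Y = quantile M Z"
  by (simp add: quantile_def assms fun_eq_iff)

text \<open>Lower orthants are closed under intersection and generate the Borel sets. The divergence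
  fixes only joint distribution functions, so this is what transfers the law of \<open>g\<close> to
  the members of a coupling.\<close>

lemma distr_eq_of_dist_fun_eq:
  fixes X Y :: "'a \<Rightarrow> real ^ 'n"
  assumes X: "X \<in> borel_measurable M" and Y: "Y \<in> borel_measurable M"
    and eq: "dist_fun M X = dist_fun M Y"
  shows "distr M borel X = distr M borel Y"
proof (rule measure_eqI_generator_eq[where \<Omega>=UNIV and E="range (\<lambda>a. {..a})" and A="\<lambda>i. {..\<chi> j. real i}"])
  have "{..a} \<inter> {..b} = {..\<chi> j. min (a $ j) (b $ j)}" for a b :: "real ^ 'n"
    by (auto simp: less_eq_vec_def)
  then show "Int_stable (range (\<lambda>a :: real ^ 'n. {..a}))"
    by (auto simp: Int_stable_def)
  show "sets (distr M borel X) = sigma_sets UNIV (range (\<lambda>a. {..a}))"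
    "sets (distr M borel Y) = sigma_sets UNIV (range (\<lambda>a. {..a}))"
    by (simp_all add: borel_eq_atMost)
  show "(\<Union>i. {..\<chi> j. real i}) = (UNIV :: (real ^ 'n) set)"
  proof (intro equalityI subsetI UNIV_I)
    fix x :: "real ^ 'n"
    obtain i :: nat where "norm x \<le> real i" using real_arch_simple by blast
    then have "x $ j \<le> real i" for j using component_le_norm_cart[of x j] by linarith
    then show "x \<in> (\<Union>i. {..\<chi> j. real i})" by (auto simp: less_eq_vec_def)
  qed
  fix S :: "(real ^ 'n) set" assume "S \<in> range (\<lambda>a. {..a})"
  then obtain a where S: "S = {..a}" by auto
  have "emeasure (distr M borel Z) {..a} = ennreal (dist_fun M Z a)" if "Z \<in> borel_measurable M" for Z :: "'a \<Rightarrow> real ^ 'n"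
    using that by (auto simp: emeasure_distr dist_fun_def emeasure_eq_measure intro!: arg_cong[where f=prob])
  then show "emeasure (distr M borel X) S = emeasure (distr M borel Y) S"
    using X Y eq by (simp add: S)
next
  fix i
  interpret D: prob_space "distr M borel X" using X by (rule prob_space_distr)
  show "emeasure (distr M borel X) {..\<chi> j. real i} \<noteq> \<infinity>" by simp
qed auto

lemma quantile_compose_cong:
  fixes X Y :: "'a \<Rightarrow> real ^ 'n"
  assumes X: "X \<in> borel_measurable M" and Y: "Y \<in> borel_measurable M"
    and eq: "dist_fun M X = dist_fun M Y" and g: "g \<in> borel_measurable borel"
  shows "quantile M (\<lambda>\<omega>. g (X \<omega>)) = quantile M (\<lambda>\<omega>. g (Y \<omega>))"
proof (rule quantile_cong)
  have "distr M borel (\<lambda>\<omega>. g (X \<omega>)) = distr M borel (\<lambda>\<omega>. g (Y \<omega>))"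
    using distr_distr[OF g X] distr_distr[OF g Y] distr_eq_of_dist_fun_eq[OF X Y eq] by (simp add: comp_def)
  then show "dist_fun M (\<lambda>\<omega>. g (X \<omega>)) = dist_fun M (\<lambda>\<omega>. g (Y \<omega>))"
    using dist_fun_eq_cdf[OF measurable_compose[OF X g]] dist_fun_eq_cdf[OF measurable_compose[OF Y g]]
    by (simp add: fun_eq_iff)
qed

end

section \<open>Uniform variables on atomless spaces\<close>

text \<open>At the first disagreement \<open>m\<close> one sum gains \<open>(1/3) ^ Suc m\<close>,
  while all later terms together amount to at most half of it. Base two would leave a tie
  here.\<close>

lemma cantor_sum_eq_imp_eq:
  fixes a b :: "nat \<Rightarrow> bool"
  assumes eq: "(\<Sum>n. (1/3) ^ Suc n * of_bool (a n)) = (\<Sum>n. (1/3 :: real) ^ Suc n * of_bool (b n))"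
  shows "a = b"
proof (rule ccontr)
  let ?t = "\<lambda>c n. (1/3 :: real) ^ Suc n * of_bool (c n)"
  have summ: "summable (?t c)" for c :: "nat \<Rightarrow> bool"
    by (rule summable_comparison_test'[of "\<lambda>n. (1/3) ^ Suc n"]) (auto simp: summable_Suc_iff[of "power (1/3)"] summable_geometric_iff)
  assume "a \<noteq> b"
  then have ex: "\<exists>n. a n \<noteq> b n" by auto
  define m where "m = (LEAST n. a n \<noteq> b n)"
  have m: "a m \<noteq> b m" unfolding m_def by (rule LeastI_ex[OF ex])
  have m_least: "a n = b n" if "n < m" for n
    using not_less_Least[of n "\<lambda>n. a n \<noteq> b n"] that unfolding m_def by blast
  have gt: "(\<Sum>n. ?t c n) < (\<Sum>n. ?t d n)" if "\<not> c m" "d m" "\<And>n. n < m \<Longrightarrow> c n = d n" for c d :: "nat \<Rightarrow> bool"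
  proof -
    have geo: "(\<lambda>n. (1/3 :: real) ^ Suc (n + Suc m)) sums ((1/3) ^ Suc m / 2)"
    proof -
      have "(\<lambda>n. (1/3) ^ Suc (Suc m) * (1/3 :: real) ^ n) sums ((1/3) ^ Suc (Suc m) * (1 / (1 - 1/3)))"
        by (intro sums_mult geometric_sums) simp
      then show ?thesis by (simp add: power_add mult_ac)
    qed
    have tail: "(\<Sum>n. ?t c (n + Suc m)) \<le> (1/3) ^ Suc m / 2"
    proof -
      have "(\<Sum>n. ?t c (n + Suc m)) \<le> (\<Sum>n. (1/3) ^ Suc (n + Suc m))"
        by (rule suminf_le) (use summ summable_ignore_initial_segment[OF summ, of "Suc m" c] geo in \<open>auto simp: sums_iff\<close>)
      then show ?thesis using geo by (simp add: sums_iff)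
    qed
    have tail0: "0 \<le> (\<Sum>n. ?t d (n + Suc m))"
      by (intro suminf_nonneg summable_ignore_initial_segment[OF summ]) auto
    have c: "(\<Sum>n. ?t c n) = (\<Sum>n. ?t c (n + Suc m)) + (\<Sum>n<Suc m. ?t c n)" by (rule suminf_split_initial_segment[OF summ])
    have d: "(\<Sum>n. ?t d n) = (\<Sum>n. ?t d (n + Suc m)) + (\<Sum>n<Suc m. ?t d n)" by (rule suminf_split_initial_segment[OF summ])
    have "(\<Sum>n<m. ?t c n) = (\<Sum>n<m. ?t d n)" by (rule sum.cong) (auto simp: that(3))
    moreover have "0 < (1/3 :: real) ^ Suc m" by simp
    moreover have "?t c m = 0" "?t d m = (1/3) ^ Suc m" using that(1,2) by simp_all
    ultimately show ?thesis using tail tail0 unfolding c d sum.lessThan_Suc by linarith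
  qed
  show False
  proof (cases "a m")
    case True
    then show False using gt[of b a] m m_least eq by auto
  next
    case False
    then show False using gt[of a b] m m_least eq by auto
  qed
qed

context prob_space
begin

text \<open>A sequence of events splits the space into the cells on which all its indicators are constant. The
  probability that two independent points share a cell attains its infimum over all sequences,
  since countably many sequences can be interleaved, and by atomlessness a sequence with a cell of
  positive measure is not minimal.\<close>

lemma atomless_null_cells:
  assumes "atomless M"
  obtains B :: "nat \<Rightarrow> 'a set" where "\<And>n. B n \<in> events"
    and "\<And>\<omega>0. \<omega>0 \<in> space M \<Longrightarrow> prob {\<omega> \<in> space M. \<forall>n. \<omega> \<in> B n \<longleftrightarrow> \<omega>0 \<in> B n} = 0"
proof -
  interpret P: prob_space "M \<Otimes>\<^sub>M M"
    by (rule prob_space_pair) (rule prob_space_axioms)+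
  define E where "E B = {z \<in> space (M \<Otimes>\<^sub>M M). \<forall>n :: nat. fst z \<in> B n \<longleftrightarrow> snd z \<in> B n}" for B :: "nat \<Rightarrow> 'a set"
  define c where "c B = P.prob (E B)" for B
  define S where "S = {B :: nat \<Rightarrow> 'a set. \<forall>n. B n \<in> events}"
  have E_sets: "E B \<in> sets (M \<Otimes>\<^sub>M M)" if "B \<in> S" for B
  proof -
    have [measurable]: "B n \<in> events" for n using that by (auto simp: S_def)
    show ?thesis unfolding E_def by measurable
  qed
  have S_ne: "S \<noteq> {}" by (auto simp: S_def intro!: exI[of _ "\<lambda>_. {}"])
  have bdd: "bdd_below (c ` S)" by (auto intro!: bdd_belowI[of _ 0] simp: c_def)
  define c0 where "c0 = Inf (c ` S)"
  have c0_le: "c0 \<le> c B" if "B \<in> S" for B unfolding c0_def using bdd that by (auto intro: cInf_lower)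
  have "\<exists>B\<in>S. c B < c0 + 1 / real (Suc k)" for k
  proof -
    have "Inf (c ` S) < c0 + 1 / real (Suc k)" by (simp add: c0_def)
    then show ?thesis using S_ne bdd by (auto simp: cInf_less_iff)
  qed
  then obtain Bs where Bs: "\<And>k. Bs k \<in> S" "\<And>k. c (Bs k) < c0 + 1 / real (Suc k)" by metis
  define B where "B n = Bs (fst (prod_decode n)) (snd (prod_decode n))" for n
  have B_S: "B \<in> S" using Bs(1) by (auto simp: S_def B_def)
  have "c B \<le> c0 + 1 / real (Suc k)" for k
  proof -
    have "E B \<subseteq> E (Bs k)"
    proof
      fix z assume z: "z \<in> E B"
      have "fst z \<in> Bs k n \<longleftrightarrow> snd z \<in> Bs k n" for n
      proof -
        have "fst z \<in> B (prod_encode (k, n)) \<longleftrightarrow> snd z \<in> B (prod_encode (k, n))" using z by (simp add: E_def)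
        then show ?thesis by (simp add: B_def)
      qed
      then show "z \<in> E (Bs k)" using z by (simp add: E_def)
    qed
    then have "c B \<le> c (Bs k)" unfolding c_def by (rule P.finite_measure_mono) (rule E_sets[OF Bs(1)])
    then show ?thesis using Bs(2)[of k] by simp
  qed
  moreover have "(\<lambda>k. c0 + 1 / real (Suc k)) \<longlonglongrightarrow> c0 + 0"
    by (intro tendsto_add tendsto_const lim_1_over_n[THEN LIMSEQ_Suc])
  ultimately have cB: "c B \<le> c0" by (intro LIMSEQ_le_const[of _ c0]) auto
  show ?thesis
  proof (rule that)
    show "B n \<in> events" for n using B_S by (simp add: S_def)
    then have [measurable]: "B n \<in> events" for n .
    fix \<omega>0 assume "\<omega>0 \<in> space M"
    define C where "C = {\<omega> \<in> space M. \<forall>n. \<omega> \<in> B n \<longleftrightarrow> \<omega>0 \<in> B n}"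
    have C[measurable]: "C \<in> events" unfolding C_def by measurable
    show "prob {\<omega> \<in> space M. \<forall>n. \<omega> \<in> B n \<longleftrightarrow> \<omega>0 \<in> B n} = 0"
    proof (rule ccontr)
      assume "\<not> ?thesis"
      then have "0 < emeasure M C" by (simp add: C_def emeasure_eq_measure zero_less_measure_iff)
      then obtain D where D: "D \<in> events" "D \<subseteq> C" "0 < emeasure M D" "emeasure M D < emeasure M C"
        using assms C unfolding atomless_def by blast
      then have pD: "0 < prob D" "prob D < prob C"
        by (simp_all add: emeasure_eq_measure ennreal_less_iff)
      \<comment> \<open>Prepending \<open>D\<close> separates the pairs in
        \<open>D \<times> (C - D)\<close>, which shared the cell \<open>C\<close>; their probability
        \<open>prob D * (prob C - prob D)\<close> is positive.\<close>
      define B' where "B' n = (case n of 0 \<Rightarrow> D | Suc m \<Rightarrow> B m)" for n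
      have B': "B' \<in> S" using D(1) by (auto simp: S_def B'_def split: nat.split)
      have "E B' \<subseteq> E B - D \<times> (C - D)"
      proof
        fix z assume z: "z \<in> E B'"
        then have "fst z \<in> B' (Suc n) \<longleftrightarrow> snd z \<in> B' (Suc n)" for n by (simp add: E_def)
        moreover have "fst z \<in> B' 0 \<longleftrightarrow> snd z \<in> B' 0" using z by (simp add: E_def)
        ultimately show "z \<in> E B - D \<times> (C - D)" using z by (auto simp: E_def B'_def)
      qed
      moreover have sub: "D \<times> (C - D) \<subseteq> E B"
        using D(2) by (auto simp: E_def C_def space_pair_measure)
      moreover have DC: "D \<times> (C - D) \<in> sets (M \<Otimes>\<^sub>M M)" using D(1) C by auto
      ultimately have "c B' \<le> c B - P.prob (D \<times> (C - D))"
        unfolding c_def using E_sets[OF B_S] P.finite_measure_mono[of "E B'" "E B - D \<times> (C - D)"]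
        by (simp add: P.finite_measure_Diff)
      also have "P.prob (D \<times> (C - D)) = prob D * prob (C - D)"
        using D(1) C by (simp add: measure_def emeasure_pair_measure_Times enn2real_mult)
      also have "prob (C - D) = prob C - prob D" using D C by (simp add: finite_measure_Diff)
      finally have "c B' < c B" using pD by (smt (verit) mult_pos_pos)
      then show False using c0_le[OF B'] cB by simp
    qed
  qed
qed

text \<open>The ternary number encodes the cell of a point injectively, so every non-empty level set
  of \<open>W\<close> is contained in one cell and hence null.\<close>

lemma atomless_continuous_variable:
  assumes "atomless M"
  obtains W :: "'a \<Rightarrow> real" where "W \<in> borel_measurable M" "\<And>\<omega>. 0 \<le> W \<omega> \<and> W \<omega> \<le> 1"
    "\<And>w. prob {\<omega> \<in> space M. W \<omega> = w} = 0"
proof -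
  obtain B :: "nat \<Rightarrow> 'a set" where B[measurable]: "\<And>n. B n \<in> events"
    and null: "\<And>\<omega>0. \<omega>0 \<in> space M \<Longrightarrow> prob {\<omega> \<in> space M. \<forall>n. \<omega> \<in> B n \<longleftrightarrow> \<omega>0 \<in> B n} = 0"
    using atomless_null_cells[OF assms] by blast
  define W where "W \<omega> = (\<Sum>n. (1/3 :: real) ^ Suc n * of_bool (\<omega> \<in> B n))" for \<omega>
  have geo: "(\<lambda>n. (1/3 :: real) ^ Suc n) sums (1/2)"
    using sums_mult[OF geometric_sums[of "1/3 :: real"], of "1/3"] by simp
  have summ: "summable (\<lambda>n. (1/3 :: real) ^ Suc n * of_bool (\<omega> \<in> B n))" for \<omega>
    by (rule summable_comparison_test'[OF sums_summable[OF geo]]) auto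
  show ?thesis
  proof (rule that)
    show "W \<in> borel_measurable M" unfolding W_def by measurable
    fix \<omega>
    have "W \<omega> \<le> (\<Sum>n. (1/3 :: real) ^ Suc n)"
      unfolding W_def by (rule suminf_le) (use summ geo in \<open>auto simp: sums_iff\<close>)
    then have "W \<omega> \<le> 1" using geo by (simp add: sums_iff)
    moreover have "0 \<le> W \<omega>" unfolding W_def by (rule suminf_nonneg[OF summ]) simp
    ultimately show "0 \<le> W \<omega> \<and> W \<omega> \<le> 1" by simp
  next
    fix w
    show "prob {\<omega> \<in> space M. W \<omega> = w} = 0"
    proof (cases "\<exists>\<omega>0\<in>space M. W \<omega>0 = w")
      case True
      then obtain \<omega>0 where w: "\<omega>0 \<in> space M" "W \<omega>0 = w" by blast
      have "\<omega> \<in> B n \<longleftrightarrow> \<omega>0 \<in> B n" if "W \<omega> = w" for \<omega> n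
        using cantor_sum_eq_imp_eq[of "\<lambda>n. \<omega> \<in> B n" "\<lambda>n. \<omega>0 \<in> B n"] that w(2) by (auto simp: W_def fun_eq_iff)
      then have "prob {\<omega> \<in> space M. W \<omega> = w} \<le> prob {\<omega> \<in> space M. \<forall>n. \<omega> \<in> B n \<longleftrightarrow> \<omega>0 \<in> B n}"
        by (intro finite_measure_mono) auto
      then show ?thesis using null[OF w(1)] measure_nonneg[of M "{\<omega> \<in> space M. W \<omega> = w}"] by simp
    next
      case False
      then have "{\<omega> \<in> space M. W \<omega> = w} = {}" by auto
      then show ?thesis by (simp only: measure_empty)
    qed
  qed
qed

text \<open>Spreading the atoms of \<open>A\<close> over disjoint intervals yields a variable with continuous
  distribution function of which \<open>A\<close> is a non-decreasing function.\<close>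

lemma atomless_refinement:
  fixes A :: "'a \<Rightarrow> real"
  assumes "atomless M" and A[measurable]: "A \<in> borel_measurable M"
  obtains T :: "'a \<Rightarrow> real" where "T \<in> borel_measurable M"
    "\<And>\<omega> \<omega>'. \<omega> \<in> space M \<Longrightarrow> \<omega>' \<in> space M \<Longrightarrow> A \<omega> < A \<omega>' \<Longrightarrow> T \<omega> < T \<omega>'"
    "\<And>t. prob {\<omega> \<in> space M. T \<omega> = t} = 0"
proof -
  obtain W :: "'a \<Rightarrow> real" where W[measurable]: "W \<in> borel_measurable M" and W01: "\<And>\<omega>. 0 \<le> W \<omega> \<and> W \<omega> \<le> 1"
    and W0: "\<And>w. prob {\<omega> \<in> space M. W \<omega> = w} = 0"
    using atomless_continuous_variable[OF assms(1)] by blast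
  define G where "G a = prob {\<omega> \<in> space M. A \<omega> < a}" for a
  define F where "F a = prob {\<omega> \<in> space M. A \<omega> \<le> a}" for a
  have "mono G" "mono F" unfolding G_def F_def mono_def by (auto intro!: finite_measure_mono)
  then have [measurable]: "G \<in> borel_measurable borel" "F \<in> borel_measurable borel" by (auto intro: borel_measurable_mono)
  have GF: "G a \<le> F a" for a unfolding G_def F_def by (intro finite_measure_mono) auto
  have FG: "F a \<le> G b" if "a < b" for a b unfolding G_def F_def using that by (intro finite_measure_mono) auto
  have atom: "F a - G a = prob {\<omega> \<in> space M. A \<omega> = a}" for a
  proof -
    have "{\<omega> \<in> space M. A \<omega> = a} = {\<omega> \<in> space M. A \<omega> \<le> a} - {\<omega> \<in> space M. A \<omega> < a}" by auto
    then show ?thesis unfolding F_def G_def by (simp add: finite_measure_Diff subset_iff)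
  qed
  \<comment> \<open>The last two summands place \<open>W\<close> inside the jump of the distribution
    function at \<open>A\<close>. They alone could tie across a gap of the law of \<open>A\<close>;
    the summand \<open>A\<close> makes the order strict everywhere.\<close>
  define T where "T \<omega> = A \<omega> + G (A \<omega>) + (F (A \<omega>) - G (A \<omega>)) * W \<omega>" for \<omega>
  have lo: "A \<omega> + G (A \<omega>) \<le> T \<omega>" for \<omega> unfolding T_def using GF[of "A \<omega>"] W01[of \<omega>] by simp
  have hi: "T \<omega> \<le> A \<omega> + F (A \<omega>)" for \<omega>
    unfolding T_def using mult_left_mono[of "W \<omega>" 1 "F (A \<omega>) - G (A \<omega>)"] GF[of "A \<omega>"] W01[of \<omega>] by simp
  have mono: "T \<omega> < T \<omega>'" if "A \<omega> < A \<omega>'" for \<omega> \<omega>'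
    using hi[of \<omega>] lo[of \<omega>'] FG[OF that] that by linarith
  show ?thesis
  proof (rule that)
    show [measurable]: "T \<in> borel_measurable M" unfolding T_def by measurable
    show "T \<omega> < T \<omega>'" if "A \<omega> < A \<omega>'" for \<omega> \<omega>' using mono[OF that] .
    fix t
    show "prob {\<omega> \<in> space M. T \<omega> = t} = 0"
    proof (cases "\<exists>\<omega>0\<in>space M. T \<omega>0 = t")
      case True
      then obtain \<omega>0 where w: "\<omega>0 \<in> space M" "T \<omega>0 = t" by blast
      define a where "a = A \<omega>0"
      have a: "A \<omega> = a" if "T \<omega> = t" for \<omega>
        using mono[of \<omega> \<omega>0] mono[of \<omega>0 \<omega>] that w(2) less_linear[of "A \<omega>" "A \<omega>0"] by (auto simp: a_def)
      have "prob {\<omega> \<in> space M. T \<omega> = t} \<le> 0"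
      \<comment> \<open>Either \<open>A\<close> has no atom at \<open>a\<close>, and the level set
        lies in a null set, or the atom is spread and the level of \<open>T\<close> pins down the
        value of \<open>W\<close>.\<close>
      proof (cases "F a = G a")
        case True
        have "prob {\<omega> \<in> space M. T \<omega> = t} \<le> prob {\<omega> \<in> space M. A \<omega> = a}"
          using a by (intro finite_measure_mono) auto
        then show ?thesis using atom[of a] True by simp
      next
        case False
        have "prob {\<omega> \<in> space M. T \<omega> = t} \<le> prob {\<omega> \<in> space M. W \<omega> = (t - a - G a) / (F a - G a)}"
        proof (intro finite_measure_mono subsetI)
          fix \<omega> assume \<omega>: "\<omega> \<in> {\<omega> \<in> space M. T \<omega> = t}"
          then have Aw: "A \<omega> = a" and Tw: "T \<omega> = t" using a by auto
          have "t = a + G a + (F a - G a) * W \<omega>" using Tw unfolding T_def Aw by simp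
          then have "(F a - G a) * W \<omega> = t - a - G a" by linarith
          then show "\<omega> \<in> {\<omega> \<in> space M. W \<omega> = (t - a - G a) / (F a - G a)}"
            using \<omega> False by (simp add: eq_divide_eq mult.commute)
        qed measurable
        then show ?thesis using W0 by simp
      qed
      then show ?thesis using measure_nonneg[of M "{\<omega> \<in> space M. T \<omega> = t}"] by simp
    next
      case False
      then have "{\<omega> \<in> space M. T \<omega> = t} = {}" by auto
      then show ?thesis by (simp only: measure_empty)
    qed
  qed
qed

text \<open>Where \<open>Y < Z\<close> some rational separates them, and for each \<open>r\<close>
  the event \<open>Y \<le> r < Z\<close> has probability equal to the difference of the two
  distribution functions, which is 0.\<close>

lemma AE_eq_of_le_same_law:
  fixes Y Z :: "'a \<Rightarrow> real"
  assumes [measurable]: "Y \<in> borel_measurable M" "Z \<in> borel_measurable M"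
    and le: "\<And>\<omega>. \<omega> \<in> space M \<Longrightarrow> Y \<omega> \<le> Z \<omega>" and law: "dist_fun M Y = dist_fun M Z"
  shows "AE \<omega> in M. Y \<omega> = Z \<omega>"
proof -
  have "AE \<omega> in M. \<not> (Y \<omega> \<le> r \<and> r < Z \<omega>)" for r
  proof -
    have "prob {\<omega> \<in> space M. Y \<omega> \<le> r \<and> r < Z \<omega>} = prob ({\<omega> \<in> space M. Y \<omega> \<le> r} - {\<omega> \<in> space M. Z \<omega> \<le> r})"
      by (intro arg_cong[where f=prob]) auto
    also have "\<dots> = dist_fun M Y r - dist_fun M Z r"
      unfolding dist_fun_def using le by (intro finite_measure_Diff) (auto intro: order_trans)
    finally have "prob {\<omega> \<in> space M. Y \<omega> \<le> r \<and> r < Z \<omega>} = 0" using law by simp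
    then show ?thesis by (subst (asm) prob_eq_0) (auto elim: eventually_mono)
  qed
  then have "AE \<omega> in M. \<forall>r\<in>\<rat>. \<not> (Y \<omega> \<le> r \<and> r < Z \<omega>)"
    unfolding AE_ball_countable[OF countable_rat] by blast
  then show ?thesis
  proof (rule AE_mp, intro AE_I2 impI)
    fix \<omega> assume \<omega>: "\<omega> \<in> space M" "\<forall>r\<in>\<rat>. \<not> (Y \<omega> \<le> r \<and> r < Z \<omega>)"
    show "Y \<omega> = Z \<omega>"
    proof (rule ccontr)
      assume "Y \<omega> \<noteq> Z \<omega>"
      then obtain r where "r \<in> \<rat>" "Y \<omega> < r" "r < Z \<omega>" using le[OF \<omega>(1)] Rats_dense_in_real[of "Y \<omega>" "Z \<omega>"] by auto
      then show False using \<omega>(2) by auto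
    qed
  qed
qed

text \<open>\<open>U\<close> is the distribution function of the refinement \<open>T\<close>
  evaluated at \<open>T\<close>, uniform because \<open>T\<close> has no atoms. As \<open>T\<close>
  respects the strict order of \<open>A\<close>, the quantile of \<open>A\<close> at
  \<open>U\<close> is at most \<open>A\<close> almost everywhere; both have the same law, hence they
  agree.\<close>

lemma uniform_quantile_coupling:
  fixes A :: "'a \<Rightarrow> real"
  assumes "atomless M" and A[measurable]: "A \<in> borel_measurable M"
  obtains U :: "'a \<Rightarrow> real" where "U \<in> borel_measurable M" "\<And>\<omega>. U \<omega> \<in> {0<..<1}"
    "distr M borel U = distr (restrict_space lborel {0<..<1}) borel (\<lambda>u. u)"
    "AE \<omega> in M. A \<omega> = quantile M A (U \<omega>)"
proof -
  obtain T :: "'a \<Rightarrow> real" where T[measurable]: "T \<in> borel_measurable M"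
    and AT: "\<And>\<omega> \<omega>'. \<omega> \<in> space M \<Longrightarrow> \<omega>' \<in> space M \<Longrightarrow> A \<omega> < A \<omega>' \<Longrightarrow> T \<omega> < T \<omega>'"
    and T0: "\<And>t. prob {\<omega> \<in> space M. T \<omega> = t} = 0"
    using atomless_refinement[OF assms] by blast
  let ?I = "restrict_space lborel {0<..<1::real}"
  define F where "F = dist_fun M T"
  interpret C: cdf_distribution "distr M borel T" by (rule cdf_distribution_distr[OF T])
  have F_cdf: "F = cdf (distr M borel T)" by (simp add: F_def dist_fun_eq_cdf[OF T] fun_eq_iff)
  have [measurable]: "F \<in> borel_measurable borel" unfolding F_cdf by (rule C.measurable_C)
  have F_quantile: "F (quantile M T v) = v" if v: "v \<in> {0<..<1}" for v
  proof (rule antisym)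
    show "v \<le> F (quantile M T v)" using quantile_le_iff[OF T v, of "quantile M T v"] by (simp add: F_def)
    have "isCont F (quantile M T v)"
      unfolding F_cdf using T0[of "quantile M T v"] by (simp add: C.isCont_cdf measure_distr vimage_def Int_def conj_commute)
    then have "(F \<longlongrightarrow> F (quantile M T v)) (at_left (quantile M T v))"
      by (simp add: isCont_def filterlim_at_split)
    moreover have "\<forall>\<^sub>F x in at_left (quantile M T v). F x \<le> v"
    proof (rule eventually_at_leftI[of "quantile M T v - 1"])
      fix x assume "x \<in> {quantile M T v - 1<..<quantile M T v}"
      then show "F x \<le> v" using quantile_le_iff[OF T v, of x] by (auto simp: F_def)
    qed simp
    ultimately show "F (quantile M T v) \<le> v" by (rule tendsto_upperbound) simp
  qed
  have qT: "quantile M T \<in> borel_measurable ?I"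
    using borel_measurable_mono_on_fnc[OF mono_on_quantile[OF T]] by (simp cong: measurable_cong_sets)
  have "distr M borel T = distr ?I borel (quantile M T)"
    using C.distr_I_eq_M unfolding quantile_def F_cdf[unfolded F_def] by simp
  then have "distr (distr M borel T) borel F = distr (distr ?I borel (quantile M T)) borel F" by simp
  then have law: "distr M borel (\<lambda>\<omega>. F (T \<omega>)) = distr ?I borel (\<lambda>v. F (quantile M T v))"
    using qT by (simp add: distr_distr comp_def)
  also have "\<dots> = distr ?I borel (\<lambda>u. u)"
    by (rule distr_cong) (auto simp: F_quantile space_restrict_space)
  finally have law: "distr M borel (\<lambda>\<omega>. F (T \<omega>)) = distr ?I borel (\<lambda>u. u)" .
  have id: "(\<lambda>u. u) \<in> borel_measurable ?I" by (rule measurable_restrict_space1) simp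
  have "AE u in distr M borel (\<lambda>\<omega>. F (T \<omega>)). u \<in> {0<..<1}"
    unfolding law using id by (subst AE_distr_iff) (auto simp: space_restrict_space)
  then have AE01: "AE \<omega> in M. F (T \<omega>) \<in> {0<..<1}" by (subst (asm) AE_distr_iff) auto
  \<comment> \<open>The value \<open>1/2\<close> on a null set keeps \<open>U\<close> in the open
    interval everywhere.\<close>
  define U where "U \<omega> = (if F (T \<omega>) \<in> {0<..<1} then F (T \<omega>) else 1/2)" for \<omega>
  have U[measurable]: "U \<in> borel_measurable M" unfolding U_def by measurable
  have U01: "U \<omega> \<in> {0<..<1}" for \<omega> by (auto simp: U_def)
  have AEU: "AE \<omega> in M. U \<omega> = F (T \<omega>)" using AE01 by eventually_elim (simp add: U_def)
  have lawU: "distr M borel U = distr ?I borel (\<lambda>u. u)"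
    unfolding law[symmetric] by (rule distr_cong_AE) (use AEU in auto)
  define q where "q u = (if u \<in> {0<..<1} then quantile M A u else 0)" for u
  have q[measurable]: "q \<in> borel_measurable borel"
  proof -
    have "quantile M A \<in> borel_measurable (restrict_space borel {0<..<1})"
      by (rule borel_measurable_mono_on_fnc[OF mono_on_quantile[OF A]])
    then show ?thesis unfolding q_def by (subst (asm) measurable_restrict_space_iff[where c=0]) auto
  qed
  have "distr M borel (\<lambda>\<omega>. q (U \<omega>)) = distr (distr M borel U) borel q"
    by (simp add: distr_distr comp_def)
  also have "\<dots> = distr ?I borel q"
    unfolding lawU using id by (simp add: distr_distr comp_def)
  also have "\<dots> = distr ?I borel (quantile M A)"
    by (rule distr_cong) (auto simp: q_def space_restrict_space)
  also have "\<dots> = distr M borel A"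
  proof -
    interpret CA: cdf_distribution "distr M borel A" by (rule cdf_distribution_distr[OF A])
    have "quantile M A = CA.I" by (simp add: quantile_def fun_eq_iff dist_fun_eq_cdf[OF A])
    then show ?thesis using CA.distr_I_eq_M by simp
  qed
  finally have lawA: "dist_fun M (\<lambda>\<omega>. q (U \<omega>)) = dist_fun M A"
    by (simp add: dist_fun_eq_cdf fun_eq_iff)
  \<comment> \<open>Resetting to \<open>A\<close> on the null set where \<open>U\<close> was altered
    makes \<open>q' \<le> A\<close> hold at every point.\<close>
  define q' where "q' \<omega> = (if U \<omega> = F (T \<omega>) then q (U \<omega>) else A \<omega>)" for \<omega>
  have [measurable]: "q' \<in> borel_measurable M" unfolding q'_def by measurable
  have AEq: "AE \<omega> in M. q' \<omega> = q (U \<omega>)" using AEU by eventually_elim (simp add: q'_def)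
  have "AE \<omega> in M. q' \<omega> = A \<omega>"
  proof (rule AE_eq_of_le_same_law)
    have "dist_fun M q' = dist_fun M (\<lambda>\<omega>. q (U \<omega>))"
      unfolding dist_fun_def fun_eq_iff by (intro allI finite_measure_eq_AE) (use AEq in auto)
    then show "dist_fun M q' = dist_fun M A" using lawA by simp
    fix \<omega> assume \<omega>: "\<omega> \<in> space M"
    have "F (T \<omega>) \<le> dist_fun M A (A \<omega>)"
      unfolding F_def dist_fun_def using AT \<omega> by (intro finite_measure_mono) (auto simp: not_less[symmetric])
    then have "quantile M A (F (T \<omega>)) \<le> A \<omega>" if "F (T \<omega>) \<in> {0<..<1}"
      using quantile_le_iff[OF A that] by simp
    then show "q' \<omega> \<le> A \<omega>" using U01[of \<omega>] by (auto simp: q'_def q_def)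
  qed auto
  then have "AE \<omega> in M. A \<omega> = quantile M A (U \<omega>)"
    using AEq by eventually_elim (use U01 in \<open>simp add: q_def\<close>)
  then show ?thesis using that U U01 lawU by blast
qed

end

section \<open>Isotonic projection\<close>

definition inner_unit :: "(real \<Rightarrow> real) \<Rightarrow> (real \<Rightarrow> real) \<Rightarrow> real" where
  "inner_unit f g = (LINT u|unit_leb. f u * g u)"

lemma L2_unit_measurable: "f \<in> L2_unit \<Longrightarrow> f \<in> borel_measurable unit_leb"
  by (simp add: L2_unit_def)

lemma integrable_mult_L2_unit:
  assumes f: "f \<in> L2_unit" and g: "g \<in> L2_unit"
  shows "integrable unit_leb (\<lambda>u. f u * g u)"
proof (rule Bochner_Integration.integrable_bound)
  show "integrable unit_leb (\<lambda>u. (f u)\<^sup>2 + (g u)\<^sup>2)"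
    using f g by (auto simp: L2_unit_def)
  have [measurable]: "f \<in> borel_measurable unit_leb" "g \<in> borel_measurable unit_leb"
    using f g by (auto simp: L2_unit_measurable)
  show "(\<lambda>u. f u * g u) \<in> borel_measurable unit_leb" by measurable
  have "\<bar>x * y\<bar> \<le> x\<^sup>2 + y\<^sup>2" for x y :: real
  proof -
    have "2 * \<bar>x * y\<bar> \<le> x\<^sup>2 + y\<^sup>2" using sum_squares_bound[of "\<bar>x\<bar>" "\<bar>y\<bar>"] by (simp add: abs_mult)
    then show ?thesis using abs_ge_zero[of "x * y"] by linarith
  qed
  then show "AE u in unit_leb. norm (f u * g u) \<le> norm ((f u)\<^sup>2 + (g u)\<^sup>2)"
    by (auto simp: real_norm_def)
qed

lemma L2_unit_const: "(\<lambda>_. c) \<in> L2_unit"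
  by (simp add: L2_unit_def)

lemma L2_unit_integrable: "f \<in> L2_unit \<Longrightarrow> integrable unit_leb f"
  using integrable_mult_L2_unit[OF _ L2_unit_const[of 1], of f] by simp

lemma L2_unit_scale: "f \<in> L2_unit \<Longrightarrow> (\<lambda>u. c * f u) \<in> L2_unit"
  by (auto simp: L2_unit_def power_mult_distrib)

lemma L2_unit_add:
  assumes f: "f \<in> L2_unit" and g: "g \<in> L2_unit"
  shows "(\<lambda>u. f u + g u) \<in> L2_unit"
proof -
  have "integrable unit_leb (\<lambda>u. (f u)\<^sup>2 + (g u)\<^sup>2 + 2 * (f u * g u))"
    using f g integrable_mult_L2_unit[OF f g] by (auto simp: L2_unit_def)
  then show ?thesis using f g by (auto simp: L2_unit_def power2_sum mult.assoc)
qed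

lemma L2_unit_diff:
  assumes f: "f \<in> L2_unit" and g: "g \<in> L2_unit"
  shows "(\<lambda>u. f u - g u) \<in> L2_unit"
  using L2_unit_add[OF f L2_unit_scale[OF g, of "-1"]] by simp

lemma inner_unit_commute: "inner_unit f g = inner_unit g f"
  by (simp add: inner_unit_def mult.commute)

lemma inner_unit_add_left:
  assumes "f \<in> L2_unit" "g \<in> L2_unit" "k \<in> L2_unit"
  shows "inner_unit (\<lambda>u. f u + g u) k = inner_unit f k + inner_unit g k"
  using assms by (simp add: inner_unit_def distrib_right integrable_mult_L2_unit)

lemma inner_unit_diff_left:
  assumes "f \<in> L2_unit" "g \<in> L2_unit" "k \<in> L2_unit"
  shows "inner_unit (\<lambda>u. f u - g u) k = inner_unit f k - inner_unit g k"
  using assms by (simp add: inner_unit_def left_diff_distrib integrable_mult_L2_unit)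

lemma inner_unit_scale_left: "inner_unit (\<lambda>u. c * f u) k = c * inner_unit f k"
  by (simp add: inner_unit_def mult.assoc)

lemma inner_unit_add_right:
  assumes "f \<in> L2_unit" "g \<in> L2_unit" "k \<in> L2_unit"
  shows "inner_unit k (\<lambda>u. f u + g u) = inner_unit k f + inner_unit k g"
  using inner_unit_add_left[OF assms] by (simp add: inner_unit_commute)

lemma inner_unit_diff_right:
  assumes "f \<in> L2_unit" "g \<in> L2_unit" "k \<in> L2_unit"
  shows "inner_unit k (\<lambda>u. f u - g u) = inner_unit k f - inner_unit k g"
  using inner_unit_diff_left[OF assms] by (simp add: inner_unit_commute)

lemma inner_unit_scale_right: "inner_unit k (\<lambda>u. c * f u) = c * inner_unit k f"
  using inner_unit_scale_left[of c f k] by (simp add: inner_unit_commute)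

lemma inner_unit_self_nonneg: "0 \<le> inner_unit f f"
  by (simp add: inner_unit_def)

lemma norm2_unit_eq: "norm2_unit f = sqrt (inner_unit f f)"
  by (simp add: norm2_unit_def inner_unit_def power2_eq_square)

lemma norm2_unit_nonneg: "0 \<le> norm2_unit f"
  by (simp add: norm2_unit_eq inner_unit_self_nonneg)

lemma norm2_unit_square: "(norm2_unit f)\<^sup>2 = inner_unit f f"
  by (simp add: norm2_unit_eq inner_unit_self_nonneg)

lemmas inner_unit_simps = inner_unit_add_left inner_unit_diff_left inner_unit_scale_left
  inner_unit_add_right inner_unit_diff_right inner_unit_scale_right
  L2_unit_add L2_unit_diff L2_unit_scale

lemma inner_unit_Cauchy_Schwarz:
  assumes f: "f \<in> L2_unit" and g: "g \<in> L2_unit"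
  shows "\<bar>inner_unit f g\<bar> \<le> norm2_unit f * norm2_unit g"
proof -
  let ?a = "inner_unit f f" and ?b = "inner_unit g g" and ?c = "inner_unit f g"
  have exp: "?a * s\<^sup>2 - 2 * s * t * ?c + ?b * t\<^sup>2 \<ge> 0" for s t
  proof -
    have "0 \<le> inner_unit (\<lambda>u. s * f u - t * g u) (\<lambda>u. s * f u - t * g u)" by (rule inner_unit_self_nonneg)
    also have "\<dots> = ?a * s\<^sup>2 - 2 * s * t * ?c + ?b * t\<^sup>2"
      using f g by (simp add: inner_unit_simps inner_unit_commute[of g f] algebra_simps power2_eq_square)
    finally show ?thesis .
  qed
  have "?c\<^sup>2 \<le> ?a * ?b"
  proof (cases "?b = 0")
    case True
    have "0 \<le> ?a - 2 * t * ?c" for t using exp[of 1 t] True by simp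
    \<comment> \<open>For non-zero \<open>?c\<close> the non-negative expression would equal
      \<open>-1\<close> at this \<open>t\<close>.\<close>
    from this[of "(?a + 1) / (2 * ?c)"] have "?c = 0" using inner_unit_self_nonneg[of f] by (cases "?c = 0") (auto simp: field_simps)
    then show ?thesis using True by simp
  next
    case False
    then have b: "0 < ?b" using inner_unit_self_nonneg[of g] by simp
    have "0 \<le> ?b * (?a * ?b - ?c\<^sup>2)" using exp[of ?b ?c] by (simp add: power2_eq_square algebra_simps)
    then show ?thesis using b by (simp add: zero_le_mult_iff)
  qed
  then have "\<bar>?c\<bar> \<le> sqrt (?a * ?b)" by (intro real_le_rsqrt) simp
  then show ?thesis by (simp add: norm2_unit_eq real_sqrt_mult)
qed

lemma inner_unit_le_norms: "f \<in> L2_unit \<Longrightarrow> g \<in> L2_unit \<Longrightarrow> inner_unit f g \<le> norm2_unit f * norm2_unit g"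
  using inner_unit_Cauchy_Schwarz[of f g] by simp

lemma norm2_unit_minus_commute: "norm2_unit (\<lambda>u. f u - g u) = norm2_unit (\<lambda>u. g u - f u)"
  by (simp add: norm2_unit_def power2_commute)

lemma norm2_unit_triangle:
  assumes f: "f \<in> L2_unit" and g: "g \<in> L2_unit"
  shows "norm2_unit (\<lambda>u. f u + g u) \<le> norm2_unit f + norm2_unit g"
proof (rule power2_le_imp_le)
  have "(norm2_unit (\<lambda>u. f u + g u))\<^sup>2 = (norm2_unit f)\<^sup>2 + 2 * inner_unit f g + (norm2_unit g)\<^sup>2"
    using f g by (simp add: norm2_unit_square inner_unit_simps inner_unit_commute[of g f])
  also have "\<dots> \<le> (norm2_unit f + norm2_unit g)\<^sup>2"
    using inner_unit_Cauchy_Schwarz[OF f g] by (simp add: power2_sum)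
  finally show "(norm2_unit (\<lambda>u. f u + g u))\<^sup>2 \<le> (norm2_unit f + norm2_unit g)\<^sup>2" .
qed (simp add: norm2_unit_nonneg)

lemma norm2_unit_abs_diff:
  assumes f: "f \<in> L2_unit" and g: "g \<in> L2_unit"
  shows "\<bar>norm2_unit f - norm2_unit g\<bar> \<le> norm2_unit (\<lambda>u. f u - g u)"
  using norm2_unit_triangle[OF L2_unit_diff[OF f g] g] norm2_unit_triangle[OF L2_unit_diff[OF g f] f]
    norm2_unit_minus_commute[of f g] by simp

section \<open>The cone of non-decreasing functions and the projection onto it\<close>

lemma isotonic_cone_L2: "k \<in> isotonic_cone \<Longrightarrow> k \<in> L2_unit"
  by (simp add: isotonic_cone_def)

lemma isotonic_cone_mono: "k \<in> isotonic_cone \<Longrightarrow> mono_on {0<..<1} k"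
  by (simp add: isotonic_cone_def)

lemma isotonic_cone_combine:
  assumes "j \<in> isotonic_cone" "k \<in> isotonic_cone" "0 \<le> s" "0 \<le> t"
  shows "(\<lambda>u. s * j u + t * k u) \<in> isotonic_cone"
  using assms by (auto simp: isotonic_cone_def L2_unit_add L2_unit_scale mono_on_def
      intro!: add_mono mult_left_mono continuous_add continuous_mult_left)

lemma isotonic_cone_const: "(\<lambda>_. c) \<in> isotonic_cone"
  by (auto simp: isotonic_cone_def L2_unit_const mono_on_def)

text \<open>The limit exists only on a co-null set \<open>G\<close> and need not be left-continuous.
  Since \<open>G\<close> is dense, the supremum of the limit over points of \<open>G\<close> to the
  left gives a left-continuous monotone function, equal to the limit wherever that function is
  continuous, hence off a null set.\<close>

lemma AE_limit_isotonic:
  assumes k: "\<And>n. mono_on {0<..<1} (k n :: real \<Rightarrow> real)"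
    and conv: "AE u in unit_leb. convergent (\<lambda>n. k n u)"
  obtains j where "mono_on {0<..<1} j" "\<And>u. u \<in> {0<..<1} \<Longrightarrow> continuous (at_left u) j"
    "AE u in unit_leb. (\<lambda>n. k n u) \<longlonglongrightarrow> j u"
proof -
  define G where "G = {u \<in> {0<..<1}. convergent (\<lambda>n. k n u)}"
  define L where "L u = lim (\<lambda>n. k n u)" for u
  have L: "(\<lambda>n. k n u) \<longlonglongrightarrow> L u" if "u \<in> G" for u
    using that by (simp add: G_def L_def convergent_LIMSEQ_iff)
  have L_mono: "L u \<le> L v" if "u \<in> G" "v \<in> G" "u \<le> v" for u v
    by (rule LIMSEQ_le[OF L[OF that(1)] L[OF that(2)]]) (use k that in \<open>auto simp: G_def mono_on_def\<close>)
  have AE_G: "AE u in unit_leb. u \<in> G" using conv AE_space by eventually_elim (simp add: G_def)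
  have dense: "\<exists>w\<in>G. a < w \<and> w < b" if "0 \<le> a" "a < b" "b \<le> 1" for a b
  proof (rule ccontr)
    assume "\<not> ?thesis"
    then have no: "w \<notin> {a<..<b}" if "w \<in> G" for w using that by auto
    have "AE u in unit_leb. \<not> u \<in> {a<..<b}" using AE_G by eventually_elim (rule no)
    then have "emeasure unit_leb {u \<in> space unit_leb. u \<in> {a<..<b}} = 0" by (rule emeasure_eq_0_AE)
    moreover have "{u \<in> space unit_leb. u \<in> {a<..<b}} = {a<..<b}" using that by auto
    moreover have "emeasure unit_leb {a<..<b} = emeasure lborel {a<..<b}"
      using that by (intro emeasure_unit_borel) auto
    ultimately show False using that by simp
  qed
  have G01: "u \<in> G \<Longrightarrow> 0 < u \<and> u < 1" for u by (simp add: G_def)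
  define j where "j u = Sup (L ` {v \<in> G. v < u})" for u
  have ne: "L ` {v \<in> G. v < u} \<noteq> {}" if "u \<in> {0<..<1}" for u
    using dense[of 0 u] that by auto
  have bdd: "bdd_above (L ` {v \<in> G. v < u})" if "u \<in> {0<..<1}" for u
  proof -
    obtain w where "w \<in> G" "u < w" using dense[of u 1] \<open>u \<in> _\<close> by auto
    then show ?thesis by (intro bdd_aboveI[of _ "L w"]) (auto intro: L_mono)
  qed
  have j_ge: "L v \<le> j u" if "v \<in> G" "v < u" "u \<in> {0<..<1}" for u v
    unfolding j_def using that by (intro cSup_upper bdd) auto
  have j_le: "j u \<le> C" if "u \<in> {0<..<1}" "\<And>v. v \<in> G \<Longrightarrow> v < u \<Longrightarrow> L v \<le> C" for u C
    unfolding j_def using that by (intro cSup_least ne) auto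
  have j_mono: "mono_on {0<..<1} j"
    unfolding mono_on_def
  proof (intro allI impI)
    fix r s :: real assume rs: "r \<in> {0<..<1} \<and> s \<in> {0<..<1} \<and> r \<le> s"
    then show "j r \<le> j s" by (intro j_le) (auto intro: j_ge)
  qed
  have j_left: "continuous (at_left u) j" if u: "u \<in> {0<..<1}" for u
    unfolding continuous_within
  proof (rule tendstoI)
    fix e :: real assume "0 < e"
    then have "j u - e < Sup (L ` {v \<in> G. v < u})" by (simp add: j_def)
    then obtain v where v: "v \<in> G" "v < u" "j u - e < L v"
      using ne[OF u] bdd[OF u] by (auto simp: less_cSup_iff)
    have "\<forall>\<^sub>F w in at_left u. v < w \<and> w < u"
      unfolding eventually_at_left_field using v by auto
    then show "\<forall>\<^sub>F w in at_left u. dist (j w) (j u) < e"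
    proof eventually_elim
      case (elim w)
      then have w: "w \<in> {0<..<1}" using u G01[OF v(1)] by auto
      have "j w \<le> j u" using j_mono w u elim by (auto simp: mono_on_def)
      moreover have "L v \<le> j w" using v elim w by (intro j_ge) auto
      ultimately show ?case using v by (auto simp: dist_real_def)
    qed
  qed
  have "countable {u \<in> {0<..<1}. \<not> isCont j u}"
    using mono_on_ctble_discont_open[of "{0<..<1}" j] j_mono by simp
  then have "{u \<in> {0<..<1}. \<not> isCont j u} \<in> null_sets lebesgue"
    by (intro null_sets_completionI countable_imp_null_set_lborel)
  then have "AE u in lebesgue. \<not> (u \<in> {0<..<1} \<and> \<not> isCont j u)"
    by (auto dest: AE_not_in)
  then have AE_cont: "AE u in unit_leb. isCont j u"
    by (subst AE_restrict_space_iff) (auto elim: eventually_mono)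
  have "AE u in unit_leb. (\<lambda>n. k n u) \<longlonglongrightarrow> j u"
    using AE_cont AE_G
  proof eventually_elim
    case (elim u)
    then have u: "u \<in> {0<..<1}" using G01 by auto
    have "j u \<le> L u" using elim u by (intro j_le) (auto intro: L_mono)
    moreover have "L u \<le> j u"
    proof (rule tendsto_lowerbound)
      show "(j \<longlongrightarrow> j u) (at_right u)" using elim(1) by (simp add: isCont_def filterlim_at_split)
      show "\<forall>\<^sub>F w in at_right u. L u \<le> j w"
        by (rule eventually_at_rightI[of _ 1]) (use u elim(2) in \<open>auto intro!: j_ge\<close>)
    qed simp
    ultimately show ?case using L[OF elim(2)] by simp
  qed
  then show ?thesis using that j_mono j_left by blast
qed

text \<open>A minimising sequence is Cauchy in mean square by the parallelogram identity. Choosing it with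
  geometrically small defects makes the increments summable almost everywhere, which replaces the
  completeness of the space of square-integrable functions.\<close>

lemma isotonic_minimiser_exists:
  assumes l: "l \<in> L2_unit"
  obtains j where "j \<in> isotonic_cone"
    "\<And>k. k \<in> isotonic_cone \<Longrightarrow> (LINT u|unit_leb. (j u - l u)\<^sup>2) \<le> (LINT u|unit_leb. (k u - l u)\<^sup>2)"
proof -
  define J where "J k = inner_unit (\<lambda>u. k u - l u) (\<lambda>u. k u - l u)" for k
  define d where "d = Inf (J ` isotonic_cone)"
  have bdd: "bdd_below (J ` isotonic_cone)"
    by (auto intro!: bdd_belowI[of _ 0] simp: J_def inner_unit_self_nonneg)
  have d_le: "d \<le> J k" if "k \<in> isotonic_cone" for k
    unfolding d_def using bdd that by (auto intro: cInf_lower)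
  \<comment> \<open>With defects \<open>(1/4) ^ n\<close> the increments have norm at most
    \<open>2 * (1/2) ^ n\<close>, which is summable.\<close>
  have "\<exists>k\<in>isotonic_cone. J k < d + (1/4) ^ n" for n :: nat
  proof -
    have "Inf (J ` isotonic_cone) < d + (1/4) ^ n" by (simp add: d_def)
    then show ?thesis using isotonic_cone_const[of 0] bdd by (subst (asm) cInf_less_iff) auto
  qed
  then obtain k where k: "\<And>n. k n \<in> isotonic_cone" "\<And>n. J (k n) < d + (1/4) ^ n" by metis
  note kL2 = isotonic_cone_L2[OF k(1)]
  have [measurable]: "k n \<in> borel_measurable unit_leb" for n by (rule L2_unit_measurable[OF kL2])
  have [measurable]: "l \<in> borel_measurable unit_leb" by (rule L2_unit_measurable[OF l])
  let ?D = "\<lambda>n u. k (Suc n) u - k n u"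
  have D_L2: "?D n \<in> L2_unit" for n by (rule L2_unit_diff[OF kL2 kL2])
  have "inner_unit (?D n) (?D n) \<le> 4 * (1/4) ^ n" for n
  proof -
    define h :: real where "h = 1/2"
    have "inner_unit (?D n) (?D n) = 2 * J (k n) + 2 * J (k (Suc n)) - 4 * J (\<lambda>u. h * k n u + h * k (Suc n) u)"
      using kL2[of n] kL2[of "Suc n"] l unfolding J_def
      by (simp add: inner_unit_simps)
        (simp add: h_def inner_unit_commute[of l "k n"] inner_unit_commute[of l "k (Suc n)"]
          inner_unit_commute[of "k (Suc n)" "k n"] field_simps)
    \<comment> \<open>The midpoint stays in the cone, so the infimum bounds its value from below and
      the multiples of \<open>d\<close> cancel.\<close>
    moreover have "d \<le> J (\<lambda>u. h * k n u + h * k (Suc n) u)"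
      by (intro d_le isotonic_cone_combine k) (auto simp: h_def)
    ultimately have "inner_unit (?D n) (?D n) \<le> 2 * (1/4) ^ n + 2 * (1/4) ^ Suc n"
      using k(2)[of n] k(2)[of "Suc n"] by linarith
    also have "\<dots> \<le> 4 * (1/4) ^ n" by simp
    finally show ?thesis .
  qed
  then have normD: "norm2_unit (?D n) \<le> 2 * (1/2) ^ n" for n
  proof -
    have "norm2_unit (?D n) \<le> sqrt (4 * (1/4) ^ n)" unfolding norm2_unit_eq using \<open>\<And>n. inner_unit _ _ \<le> _\<close> by simp
    also have "sqrt (4 * (1/4) ^ n) = 2 * (1/2 :: real) ^ n" by (simp add: real_sqrt_mult real_sqrt_power real_sqrt_divide)
    finally show ?thesis by simp
  qed
  have intD: "(LINT u|unit_leb. \<bar>?D n u\<bar>) \<le> 2 * (1/2) ^ n" for n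
  proof -
    have abs_L2: "(\<lambda>u. \<bar>?D n u\<bar>) \<in> L2_unit" using D_L2[of n] by (auto simp: L2_unit_def)
    have "(LINT u|unit_leb. \<bar>?D n u\<bar>) = inner_unit (\<lambda>u. \<bar>?D n u\<bar>) (\<lambda>_. 1)" by (simp add: inner_unit_def)
    also have "\<dots> \<le> norm2_unit (\<lambda>u. \<bar>?D n u\<bar>) * norm2_unit (\<lambda>_. 1)"
      using inner_unit_Cauchy_Schwarz[OF abs_L2 L2_unit_const[of 1]] by simp
    also have "norm2_unit (\<lambda>_. 1) = 1" using unit.prob_space by (simp add: norm2_unit_def)
    also have "norm2_unit (\<lambda>u. \<bar>?D n u\<bar>) = norm2_unit (?D n)" by (simp add: norm2_unit_def)
    finally show ?thesis using normD[of n] by simp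
  qed
  have "(\<integral>\<^sup>+u. (\<Sum>n. ennreal \<bar>?D n u\<bar>) \<partial>unit_leb) = (\<Sum>n. \<integral>\<^sup>+u. ennreal \<bar>?D n u\<bar> \<partial>unit_leb)"
    by (rule nn_integral_suminf) measurable
  also have "\<dots> = (\<Sum>n. ennreal (LINT u|unit_leb. \<bar>?D n u\<bar>))"
    using L2_unit_integrable[OF D_L2] by (intro suminf_cong nn_integral_eq_integral) auto
  also have "\<dots> \<le> (\<Sum>n. ennreal (2 * (1/2) ^ n))"
    by (intro suminf_le ennreal_leI intD) auto
  also have "\<dots> < \<top>"
    by (subst suminf_ennreal2) (auto intro!: summable_mult summable_geometric)
  finally have "AE u in unit_leb. (\<Sum>n. ennreal \<bar>?D n u\<bar>) \<noteq> \<infinity>"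
    by (intro nn_integral_noteq_infinite) auto
  then have "AE u in unit_leb. convergent (\<lambda>n. k n u)"
  proof eventually_elim
    case (elim u)
    then have "summable (\<lambda>n. \<bar>?D n u\<bar>)" by (intro summable_suminf_not_top) auto
    then have "summable (\<lambda>n. ?D n u)" by (rule summable_rabs_cancel)
    then have "convergent (\<lambda>n. \<Sum>i<n. ?D i u)" by (simp add: summable_iff_convergent)
    moreover have "(\<Sum>i<n. ?D i u) = k n u - k 0 u" for n
      using sum_lessThan_telescope[of "\<lambda>i. k i u" n] by simp
    ultimately have "convergent (\<lambda>n. (k n u - k 0 u) + k 0 u)"
      by (intro convergent_add convergent_const) simp
    then show ?case by simp
  qed
  from AE_limit_isotonic[OF isotonic_cone_mono[OF k(1)] this]
  obtain j where j: "mono_on {0<..<1} j" "\<And>u. u \<in> {0<..<1} \<Longrightarrow> continuous (at_left u) j"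
    "AE u in unit_leb. (\<lambda>n. k n u) \<longlonglongrightarrow> j u" by blast
  have [measurable]: "j \<in> borel_measurable unit_leb" by (rule mono_on_unit_measurable[OF j(1)])
  have d0: "0 \<le> d" unfolding d_def using isotonic_cone_const by (auto intro!: cInf_greatest simp: J_def inner_unit_self_nonneg)
  have J_nn: "(\<integral>\<^sup>+u. ennreal ((k n u - l u)\<^sup>2) \<partial>unit_leb) = ennreal (J (k n))" for n
    unfolding J_def inner_unit_def power2_eq_square[symmetric]
    using L2_unit_diff[OF kL2[of n] l] by (intro nn_integral_eq_integral) (auto simp: L2_unit_def)
  \<comment> \<open>Fatou's lemma passes the bound \<open>d\<close> to the limit; square
    integrability of \<open>j\<close> then follows from that bound.\<close>
  have "(\<integral>\<^sup>+u. ennreal ((j u - l u)\<^sup>2) \<partial>unit_leb) = (\<integral>\<^sup>+u. liminf (\<lambda>n. ennreal ((k n u - l u)\<^sup>2)) \<partial>unit_leb)"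
  proof (rule nn_integral_cong_AE)
    show "AE u in unit_leb. ennreal ((j u - l u)\<^sup>2) = liminf (\<lambda>n. ennreal ((k n u - l u)\<^sup>2))"
      using j(3)
    proof eventually_elim
      case (elim u)
      then have "(\<lambda>n. ennreal ((k n u - l u)\<^sup>2)) \<longlonglongrightarrow> ennreal ((j u - l u)\<^sup>2)"
        by (intro tendsto_ennrealI tendsto_intros)
      then show ?case by (intro lim_imp_Liminf[symmetric]) auto
    qed
  qed
  also have "\<dots> \<le> liminf (\<lambda>n. \<integral>\<^sup>+u. ennreal ((k n u - l u)\<^sup>2) \<partial>unit_leb)"
    by (rule nn_integral_liminf) measurable
  also have "\<dots> \<le> liminf (\<lambda>n. ennreal (d + (1/4) ^ n))"
    unfolding J_nn using k(2) by (intro Liminf_mono always_eventually) (auto intro: ennreal_leI less_imp_le)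
  also have "\<dots> = ennreal (d + 0)"
    by (intro lim_imp_Liminf tendsto_ennrealI tendsto_intros LIMSEQ_power_zero) auto
  finally have le: "(\<integral>\<^sup>+u. ennreal ((j u - l u)\<^sup>2) \<partial>unit_leb) \<le> ennreal d" by simp
  have jl: "integrable unit_leb (\<lambda>u. (j u - l u)\<^sup>2)"
    using le by (intro integrableI_nonneg) (auto intro: le_less_trans)
  then have "(\<lambda>u. j u - l u) \<in> L2_unit" by (simp add: L2_unit_def)
  from L2_unit_add[OF this l] have jL2: "j \<in> L2_unit" by simp
  have "ennreal (LINT u|unit_leb. (j u - l u)\<^sup>2) \<le> ennreal d"
    using le nn_integral_eq_integral[OF jl] by simp
  then have Jj: "(LINT u|unit_leb. (j u - l u)\<^sup>2) \<le> d" using d0 by simp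
  show ?thesis
  proof (rule that)
    show "j \<in> isotonic_cone" using j jL2 by (simp add: isotonic_cone_def)
    show "(LINT u|unit_leb. (j u - l u)\<^sup>2) \<le> (LINT u|unit_leb. (k u - l u)\<^sup>2)" if "k \<in> isotonic_cone" for k
      using Jj d_le[OF that] by (simp add: J_def inner_unit_def power2_eq_square)
  qed
qed

text \<open>\<open>isotonic_proj\<close> is a choice among minimisers, so these properties hold only
  once a minimiser is known to exist.\<close>

lemma isotonic_proj_minimises:
  assumes l: "l \<in> L2_unit"
  shows "isotonic_proj l \<in> isotonic_cone"
    and "\<And>k. k \<in> isotonic_cone \<Longrightarrow>
      inner_unit (\<lambda>u. isotonic_proj l u - l u) (\<lambda>u. isotonic_proj l u - l u) \<le> inner_unit (\<lambda>u. k u - l u) (\<lambda>u. k u - l u)"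
proof -
  let ?J = "\<lambda>j. LINT u|unit_leb. (j u - l u)\<^sup>2"
  obtain j where j: "j \<in> isotonic_cone" "\<And>k. k \<in> isotonic_cone \<Longrightarrow> ?J j \<le> ?J k"
    using isotonic_minimiser_exists[OF l] by blast
  then have "is_arg_min ?J (\<lambda>x. x \<in> isotonic_cone) j"
    by (auto simp: is_arg_min_def not_less)
  then have "is_arg_min ?J (\<lambda>x. x \<in> isotonic_cone) (isotonic_proj l)"
    unfolding isotonic_proj_def arg_min_on_def arg_min_def
    by (rule someI[of "is_arg_min ?J (\<lambda>x. x \<in> isotonic_cone)" j])
  then show "isotonic_proj l \<in> isotonic_cone"
    and "\<And>k. k \<in> isotonic_cone \<Longrightarrow>
      inner_unit (\<lambda>u. isotonic_proj l u - l u) (\<lambda>u. isotonic_proj l u - l u) \<le> inner_unit (\<lambda>u. k u - l u) (\<lambda>u. k u - l u)"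
    by (auto simp: is_arg_min_def not_less inner_unit_def power2_eq_square)
qed

text \<open>The obtuse angle criterion: otherwise a short step from the projection towards
  \<open>k\<close>, which stays in the convex cone, would come closer to \<open>l\<close>.\<close>

lemma isotonic_proj_variational:
  assumes l: "l \<in> L2_unit" and k: "k \<in> isotonic_cone"
  shows "inner_unit (\<lambda>u. l u - isotonic_proj l u) (\<lambda>u. k u - isotonic_proj l u) \<le> 0"
proof (rule ccontr)
  let ?j = "isotonic_proj l"
  note j = isotonic_proj_minimises[OF l]
  note jL2 = isotonic_cone_L2[OF j(1)] and kL2 = isotonic_cone_L2[OF k]
  define p where "p = inner_unit (\<lambda>u. l u - ?j u) (\<lambda>u. k u - ?j u)"
  define s where "s = inner_unit (\<lambda>u. k u - ?j u) (\<lambda>u. k u - ?j u)"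
  assume "\<not> ?thesis"
  then have p: "0 < p" by (simp add: p_def)
  have s: "0 \<le> s" by (simp add: s_def inner_unit_self_nonneg)
  \<comment> \<open>A step of length \<open>t\<close> changes the squared distance by
    \<open>t * (t * s - 2 * p)\<close>; the bound \<open>t * s < 2 * p\<close> makes this negative,
    and \<open>s + 1\<close> avoids division by zero.\<close>
  define t where "t = min 1 (p / (s + 1))"
  have t: "0 < t" "t \<le> 1" "t * s < 2 * p"
  proof -
    show "0 < t" "t \<le> 1" using p s by (auto simp: t_def)
    have "t * s \<le> p / (s + 1) * s" using s by (intro mult_right_mono) (auto simp: t_def)
    also have "\<dots> \<le> p" using p s by (simp add: field_simps)
    finally show "t * s < 2 * p" using p by simp
  qed
  have "(\<lambda>u. (1 - t) * ?j u + t * k u) \<in> isotonic_cone"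
    using t by (intro isotonic_cone_combine j k) auto
  from j(2)[OF this] have "0 \<le> t * (t * s - 2 * p)"
    using l jL2 kL2 unfolding p_def s_def
    by (simp add: inner_unit_simps) (simp add: inner_unit_commute algebra_simps)
  then show False using t by (simp add: zero_le_mult_iff)
qed

text \<open>A non-negative function with vanishing integral is zero almost everywhere, against the
  positive norm. This is how the sign condition on \<gamma> enters part (ii).\<close>

lemma inner_unit_one_pos:
  assumes g: "\<gamma> \<in> L2_unit" and nonneg: "\<And>u. u \<in> {0<..<1} \<Longrightarrow> 0 \<le> \<gamma> u" and pos: "0 < norm2_unit \<gamma>"
  shows "0 < inner_unit \<gamma> (\<lambda>_. 1)"
proof -
  have nn: "AE u in unit_leb. 0 \<le> \<gamma> u" using nonneg by (intro AE_I2) simp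
  have "(LINT u|unit_leb. \<gamma> u) \<noteq> 0"
  proof
    assume "(LINT u|unit_leb. \<gamma> u) = 0"
    then have "AE u in unit_leb. \<gamma> u = 0"
      using integral_nonneg_eq_0_iff_AE[OF L2_unit_integrable[OF g] nn] by simp
    then have "AE u in unit_leb. (\<gamma> u)\<^sup>2 = 0" by eventually_elim simp
    then have "(LINT u|unit_leb. (\<gamma> u)\<^sup>2) = 0" by (rule integral_eq_zero_AE)
    then show False using pos by (simp add: norm2_unit_def)
  qed
  then show ?thesis using integral_nonneg_AE[OF nn] by (simp add: inner_unit_def)
qed

section \<open>The path of projections of \<open>F + c \<gamma>\<close>\<close>

context
  fixes F \<gamma> :: "real \<Rightarrow> real"
  assumes F: "F \<in> isotonic_cone" and g: "\<gamma> \<in> L2_unit"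
begin

definition proj_path :: "real \<Rightarrow> real \<Rightarrow> real" where
  "proj_path c = isotonic_proj (\<lambda>u. F u + c * \<gamma> u)"

definition proj_dist :: "real \<Rightarrow> real" where
  "proj_dist c = norm2_unit (\<lambda>u. proj_path c u - F u)"

lemmas F_L2 = isotonic_cone_L2[OF F]

lemma perturbed_L2: "(\<lambda>u. F u + c * \<gamma> u) \<in> L2_unit"
  by (intro L2_unit_add L2_unit_scale F_L2 g)

lemma proj_path_cone: "proj_path c \<in> isotonic_cone"
  unfolding proj_path_def by (rule isotonic_proj_minimises(1)[OF perturbed_L2])

lemmas proj_path_L2 = isotonic_cone_L2[OF proj_path_cone]

lemma proj_path_variational:
  assumes k: "k \<in> isotonic_cone"
  shows "inner_unit (\<lambda>u. F u + c * \<gamma> u - proj_path c u) (\<lambda>u. k u - proj_path c u) \<le> 0"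
  unfolding proj_path_def by (rule isotonic_proj_variational[OF perturbed_L2 k])

text \<open>The variational inequality rewritten with all displacements measured from
  \<open>F\<close>; the right-hand side is then open to Cauchy-Schwarz.\<close>

lemma proj_path_gain_le:
  assumes k: "k \<in> isotonic_cone"
  shows "c * inner_unit \<gamma> (\<lambda>u. k u - proj_path c u) \<le>
    inner_unit (\<lambda>u. proj_path c u - F u) (\<lambda>u. k u - F u) - (proj_dist c)\<^sup>2"
  using proj_path_variational[OF k, of c] isotonic_cone_L2[OF k] F_L2 g proj_path_L2[of c]
  unfolding proj_dist_def norm2_unit_square
  by (simp add: inner_unit_simps inner_unit_commute algebra_simps)

text \<open>Adding a constant of either sign to the projection stays in the cone, so the variational
  inequality is an equality in the direction of constants.\<close>

lemma proj_path_mean: "inner_unit (proj_path c) (\<lambda>_. 1) = inner_unit F (\<lambda>_. 1) + c * inner_unit \<gamma> (\<lambda>_. 1)"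
proof -
  have "s * inner_unit (\<lambda>u. F u + c * \<gamma> u - proj_path c u) (\<lambda>_. 1) \<le> 0" for s
  proof -
    have "(\<lambda>u. 1 * proj_path c u + 1 * s) \<in> isotonic_cone"
      by (intro isotonic_cone_combine proj_path_cone isotonic_cone_const) auto
    from proj_path_variational[OF this, of c] show ?thesis
      using inner_unit_scale_right[of _ s "\<lambda>_. 1"] by simp
  qed
  from this[of 1] this[of "-1"] have "inner_unit (\<lambda>u. F u + c * \<gamma> u - proj_path c u) (\<lambda>_. 1) = 0" by simp
  then show ?thesis using F_L2 g proj_path_L2[of c] L2_unit_const[of 1] by (simp add: inner_unit_simps)
qed

text \<open>Each of the two projections is tested in the variational inequality of the other;
  \<open>F\<close> cancels in the sum.\<close>

lemma proj_path_nonexpansive: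
  "norm2_unit (\<lambda>u. proj_path c u - proj_path d u) \<le> \<bar>c - d\<bar> * norm2_unit \<gamma>"
proof -
  let ?E = "\<lambda>u. proj_path c u - proj_path d u"
  note L2 = F_L2 g proj_path_L2[of c] proj_path_L2[of d]
  have E: "?E \<in> L2_unit" by (intro L2_unit_diff proj_path_L2)
  have "inner_unit ?E ?E \<le> (c - d) * inner_unit \<gamma> ?E"
    using proj_path_variational[OF proj_path_cone[of d], of c] proj_path_variational[OF proj_path_cone[of c], of d] L2
    by (simp add: inner_unit_simps) (simp add: inner_unit_commute algebra_simps)
  also have "\<dots> \<le> \<bar>c - d\<bar> * \<bar>inner_unit \<gamma> ?E\<bar>" by (simp add: abs_mult[symmetric])
  also have "\<dots> \<le> \<bar>c - d\<bar> * (norm2_unit \<gamma> * norm2_unit ?E)"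
    by (intro mult_left_mono inner_unit_Cauchy_Schwarz g E) simp
  finally have "norm2_unit ?E * norm2_unit ?E \<le> (\<bar>c - d\<bar> * norm2_unit \<gamma>) * norm2_unit ?E"
    by (simp add: norm2_unit_square[symmetric] power2_eq_square mult.assoc)
  then show ?thesis
    using norm2_unit_nonneg[of ?E] norm2_unit_nonneg[of \<gamma>]
    by (cases "norm2_unit ?E = 0") (auto simp: mult_le_cancel_right)
qed

lemma continuous_proj_dist: "continuous_on A proj_dist"
proof (cases "norm2_unit \<gamma> = 0")
  case False
  then have pos: "0 < norm2_unit \<gamma>" using norm2_unit_nonneg[of \<gamma>] by simp
  have lip: "\<bar>proj_dist c - proj_dist d\<bar> \<le> norm2_unit \<gamma> * \<bar>c - d\<bar>" for c d
  proof -
    have "\<bar>proj_dist c - proj_dist d\<bar> \<le>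
        norm2_unit (\<lambda>u. (proj_path c u - F u) - (proj_path d u - F u))"
      unfolding proj_dist_def by (intro norm2_unit_abs_diff L2_unit_diff proj_path_L2 F_L2)
    then show ?thesis using proj_path_nonexpansive[of c d] by (simp add: mult.commute)
  qed
  have "(norm2_unit \<gamma>)-lipschitz_on A proj_dist"
    using lip pos by (intro lipschitz_onI) (auto simp: dist_real_def)
  then show ?thesis by (rule lipschitz_on_continuous_on)
next
  case True
  have "proj_dist c = proj_dist d" for c d
  proof -
    have "\<bar>proj_dist c - proj_dist d\<bar> \<le>
        norm2_unit (\<lambda>u. (proj_path c u - F u) - (proj_path d u - F u))"
      unfolding proj_dist_def by (intro norm2_unit_abs_diff L2_unit_diff proj_path_L2 F_L2)
    then show ?thesis using proj_path_nonexpansive[of c d] True by simp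
  qed
  then have "proj_dist = (\<lambda>_. proj_dist 0)" by (simp add: fun_eq_iff)
  then show ?thesis by (metis continuous_on_const)
qed

lemma proj_dist_0: "proj_dist 0 = 0"
proof -
  have "inner_unit (\<lambda>u. proj_path 0 u - F u) (\<lambda>u. proj_path 0 u - F u) \<le> inner_unit (\<lambda>u. F u - F u) (\<lambda>u. F u - F u)"
    using isotonic_proj_minimises(2)[OF perturbed_L2[of 0] F] by (simp add: proj_path_def)
  also have "\<dots> = 0" by (simp add: inner_unit_def)
  finally have "inner_unit (\<lambda>u. proj_path 0 u - F u) (\<lambda>u. proj_path 0 u - F u) = 0"
    using inner_unit_self_nonneg by (rule antisym)
  then show ?thesis by (simp add: proj_dist_def norm2_unit_eq)
qed

text \<open>Distance zero from \<open>F\<close> is what is at hand, and Cauchy-Schwarz turns it into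
  equal values. This serves \<open>\<beta> = 0\<close>, where the lower bound is taken at
  \<open>c = 0\<close>.\<close>

lemma inner_proj_path_0: "inner_unit \<gamma> (proj_path 0) = inner_unit \<gamma> F"
proof -
  have "\<bar>inner_unit \<gamma> (\<lambda>u. proj_path 0 u - F u)\<bar> \<le> norm2_unit \<gamma> * proj_dist 0"
    unfolding proj_dist_def by (intro inner_unit_Cauchy_Schwarz L2_unit_diff proj_path_L2 F_L2 g)
  then show ?thesis using proj_dist_0 F_L2 g proj_path_L2[of 0] by (simp add: inner_unit_simps)
qed

lemma norm2_unit_one: "norm2_unit (\<lambda>_. 1) = 1"
  using unit.prob_space by (simp add: norm2_unit_def)

text \<open>Cauchy-Schwarz against the constant 1: the distance is at least the shift of the mean.
  For positive mean of \<gamma> the path thus leaves every ball around \<open>F\<close>.\<close>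

lemma proj_dist_lower: "c * inner_unit \<gamma> (\<lambda>_. 1) \<le> proj_dist c"
proof -
  have "inner_unit (\<lambda>u. proj_path c u - F u) (\<lambda>_. 1) \<le> proj_dist c * norm2_unit (\<lambda>_. 1)"
    unfolding proj_dist_def
    by (intro inner_unit_le_norms L2_unit_diff proj_path_L2 F_L2 L2_unit_const)
  then show ?thesis
    using proj_path_mean[of c] F_L2 proj_path_L2[of c] L2_unit_const[of 1] norm2_unit_one by (simp add: inner_unit_simps)
qed

text \<open>For \<open>k\<close> no farther from \<open>F\<close> than the projection,
  Cauchy-Schwarz bounds the inner product of the displacements by the squared radius, so the gain of
  \<open>k\<close> over the projection is not positive.\<close>

lemma proj_path_optimal:
  assumes "0 < c" and k: "k \<in> isotonic_cone" and dist: "norm2_unit (\<lambda>u. k u - F u) \<le> proj_dist c"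
  shows "inner_unit \<gamma> k \<le> inner_unit \<gamma> (proj_path c)"
proof -
  have "inner_unit (\<lambda>u. proj_path c u - F u) (\<lambda>u. k u - F u) \<le> proj_dist c * norm2_unit (\<lambda>u. k u - F u)"
    unfolding proj_dist_def using isotonic_cone_L2[OF k]
    by (intro inner_unit_le_norms L2_unit_diff proj_path_L2 F_L2)
  also have "\<dots> \<le> (proj_dist c)\<^sup>2"
    unfolding power2_eq_square using dist by (intro mult_left_mono) (simp_all add: proj_dist_def norm2_unit_nonneg)
  finally have "c * inner_unit \<gamma> (\<lambda>u. k u - proj_path c u) \<le> 0" using proj_path_gain_le[OF k, of c] by simp
  then have "inner_unit \<gamma> (\<lambda>u. k u - proj_path c u) \<le> 0" using \<open>0 < c\<close> by (simp add: mult_le_0_iff)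
  then show ?thesis using isotonic_cone_L2[OF k] g proj_path_L2[of c] by (simp add: inner_unit_simps)
qed

text \<open>If two points of the path have the same distance \<open>R\<close> from \<open>F\<close>, each is optimal at that radius; this
  forces them to coincide, and the means then determine the parameter.\<close>

lemma proj_dist_inj:
  assumes c: "0 < c" and d: "0 < d" and eq: "proj_dist c = proj_dist d" and mean: "0 < inner_unit \<gamma> (\<lambda>_. 1)"
  shows "c = d"
proof -
  let ?P = "\<lambda>u. proj_path c u - F u" and ?Q = "\<lambda>u. proj_path d u - F u"
  note L2 = F_L2 g proj_path_L2[of c] proj_path_L2[of d]
  define x where "x = inner_unit \<gamma> (proj_path d) - inner_unit \<gamma> (proj_path c)"
  define I where "I = inner_unit ?P ?Q"
  define R where "R = proj_dist c"
  have I_le: "I \<le> R\<^sup>2"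
  proof -
    have "I \<le> proj_dist c * proj_dist d"
      unfolding I_def proj_dist_def
      by (intro inner_unit_le_norms L2_unit_diff proj_path_L2 F_L2)
    then show ?thesis using eq by (simp add: R_def power2_eq_square)
  qed
  have "c * x \<le> I - R\<^sup>2"
    using proj_path_gain_le[OF proj_path_cone[of d], of c] L2 by (simp add: x_def I_def R_def inner_unit_diff_right)
  moreover have "d * (- x) \<le> I - R\<^sup>2"
    using proj_path_gain_le[OF proj_path_cone[of c], of d] L2 inner_unit_commute[of ?P ?Q]
    by (simp add: x_def I_def R_def eq inner_unit_diff_right)
  ultimately have cx: "c * x \<le> 0" "0 \<le> d * x" and xI: "c * x \<le> I - R\<^sup>2" using I_le by auto
  then have "x = 0" using c d by (auto simp: mult_le_0_iff zero_le_mult_iff)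
  then have "R\<^sup>2 \<le> I" using xI by simp
  have "(norm2_unit (\<lambda>u. proj_path c u - proj_path d u))\<^sup>2 = (proj_dist c)\<^sup>2 - 2 * I + (proj_dist d)\<^sup>2"
    using L2 unfolding I_def proj_dist_def norm2_unit_square
    by (simp add: inner_unit_simps) (simp add: inner_unit_commute algebra_simps)
  also have "\<dots> \<le> 0" using \<open>R\<^sup>2 \<le> I\<close> eq by (simp add: R_def)
  finally have "norm2_unit (\<lambda>u. proj_path c u - proj_path d u) = 0" by simp
  moreover have "\<bar>inner_unit (\<lambda>u. proj_path c u - proj_path d u) (\<lambda>_. 1)\<bar> \<le>
      norm2_unit (\<lambda>u. proj_path c u - proj_path d u) * norm2_unit (\<lambda>_. 1)"
    by (intro inner_unit_Cauchy_Schwarz L2_unit_diff proj_path_L2 L2_unit_const)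
  ultimately have "inner_unit (proj_path c) (\<lambda>_. 1) = inner_unit (proj_path d) (\<lambda>_. 1)"
    using L2 L2_unit_const[of 1] by (simp add: inner_unit_simps)
  then show ?thesis using proj_path_mean[of c] proj_path_mean[of d] mean by simp
qed

lemma proj_dist_attains:
  assumes R: "0 < R" and mean: "0 < inner_unit \<gamma> (\<lambda>_. 1)"
  shows "\<exists>!c. 0 < c \<and> proj_dist c = R"
proof -
  \<comment> \<open>By the linear lower bound the distance at \<open>C\<close> is at least
    \<open>R\<close>, which gives the right end for the intermediate value theorem.\<close>
  define C where "C = R / inner_unit \<gamma> (\<lambda>_. 1)"
  have C: "0 < C" "R \<le> proj_dist C" using proj_dist_lower[of C] R mean by (auto simp: C_def)
  obtain c where c: "0 \<le> c" "c \<le> C" "proj_dist c = R"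
    using IVT'[of proj_dist 0 R C] C R proj_dist_0 continuous_proj_dist by auto
  then have "0 < c" using proj_dist_0 R by (cases "c = 0") auto
  then show ?thesis using c proj_dist_inj mean by (intro ex1I[of _ c]) auto
qed

end

section \<open>Mahalanobis balls\<close>

lemma diagonal_matrix_vector_mult:
  assumes "diagonal_matrix Q"
  shows "(Q *v x) $ i = Q $ i $ i * x $ i"
proof -
  have "(Q *v x) $ i = (\<Sum>j\<in>UNIV. Q $ i $ j * x $ j)" by (simp add: matrix_vector_mult_def)
  also have "\<dots> = (\<Sum>j\<in>UNIV. if j = i then Q $ i $ i * x $ i else 0)"
    by (rule sum.cong) (use assms in \<open>auto simp: diagonal_matrix_def\<close>)
  finally show ?thesis by simp
qed

lemma diagonal_matrix_inner:
  assumes "diagonal_matrix Q"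
  shows "x \<bullet> (Q *v y) = (\<Sum>i\<in>UNIV. Q $ i $ i * (x $ i * y $ i))"
  unfolding inner_vec_def by (simp add: diagonal_matrix_vector_mult[OF assms] mult_ac)

lemma eigenvalues_diagonal_matrix:
  assumes Q: "diagonal_matrix Q"
  shows "eigenvalues Q = range (\<lambda>i. Q $ i $ i)"
proof (intro equalityI subsetI)
  fix c assume "c \<in> eigenvalues Q"
  then obtain v where v: "v \<noteq> 0" "Q *v v = c *\<^sub>R v" by (auto simp: eigenvalues_def)
  then obtain i where "v $ i \<noteq> 0" by (auto simp: vec_eq_iff)
  moreover have "Q $ i $ i * v $ i = c * v $ i"
    using arg_cong[OF v(2), of "\<lambda>w. w $ i"] by (simp add: diagonal_matrix_vector_mult[OF Q])
  ultimately show "c \<in> range (\<lambda>i. Q $ i $ i)" by auto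
next
  fix c assume "c \<in> range (\<lambda>i. Q $ i $ i)"
  then obtain i where c: "c = Q $ i $ i" by auto
  have "Q *v axis i 1 = c *\<^sub>R axis i 1"
    by (auto simp: vec_eq_iff diagonal_matrix_vector_mult[OF Q] c axis_def)
  moreover have "axis i (1 :: real) \<noteq> 0" by (simp add: axis_eq_0_iff)
  ultimately show "c \<in> eigenvalues Q" unfolding eigenvalues_def by blast
qed

lemma positive_definite_diagonal_pos:
  assumes Q: "diagonal_matrix Q" and pd: "positive_definite Q"
  shows "0 < Q $ i $ i"
proof -
  have "axis i (1 :: real) \<noteq> 0" by (simp add: axis_eq_0_iff)
  then have "0 < axis i 1 \<bullet> (Q *v axis i 1)" using pd by (simp add: positive_definite_def)
  also have "\<dots> = Q $ i $ i"
    by (simp add: inner_axis' diagonal_matrix_vector_mult[OF Q])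
  finally show ?thesis .
qed

lemma diagonal_matrix_form_bounds:
  fixes Q :: "real ^ 'n ^ 'n"
  assumes Q: "diagonal_matrix Q"
  shows "Min (eigenvalues Q) * (norm x)\<^sup>2 \<le> x \<bullet> (Q *v x)"
    and "x \<bullet> (Q *v x) \<le> Max (eigenvalues Q) * (norm x)\<^sup>2"
proof -
  have n: "(norm x)\<^sup>2 = (\<Sum>i\<in>UNIV. x $ i * x $ i)"
    unfolding power2_norm_eq_inner inner_vec_def by simp
  have "Min (eigenvalues Q) \<le> Q $ i $ i" "Q $ i $ i \<le> Max (eigenvalues Q)" for i
    unfolding eigenvalues_diagonal_matrix[OF Q] by auto
  then show "Min (eigenvalues Q) * (norm x)\<^sup>2 \<le> x \<bullet> (Q *v x)"
    and "x \<bullet> (Q *v x) \<le> Max (eigenvalues Q) * (norm x)\<^sup>2"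
    unfolding n diagonal_matrix_inner[OF Q] sum_distrib_left by (auto intro!: sum_mono mult_right_mono)
qed

lemma bregman_quadratic_form:
  assumes Q: "diagonal_matrix Q"
  shows "bregman (\<lambda>x. x \<bullet> (Q *v x)) z1 z2 = (z1 - z2) \<bullet> (Q *v (z1 - z2))"
proof -
  have sym: "x \<bullet> (Q *v y) = y \<bullet> (Q *v x)" for x y
    by (simp add: diagonal_matrix_inner[OF Q] mult_ac)
  have "((\<lambda>x. x \<bullet> (Q *v x)) has_derivative (\<lambda>v. z2 \<bullet> (Q *v v) + v \<bullet> (Q *v z2))) (at z2)"
    by (intro has_derivative_inner has_derivative_ident
        bounded_linear.has_derivative[OF matrix_vector_mul_bounded_linear] )
  from frechet_derivative_at[OF this, symmetric]
  have "frechet_derivative (\<lambda>x. x \<bullet> (Q *v x)) (at z2) (z1 - z2) = 2 * (z2 \<bullet> (Q *v (z1 - z2)))"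
    by (simp add: sym[of "z1 - z2" z2])
  then show ?thesis
    using sym[of z1 z2]
    by (simp add: bregman_def matrix_vector_mult_diff_distrib inner_diff_left inner_diff_right)
qed

lemma lipschitz_bregman_bound:
  fixes g :: "real ^ 'n \<Rightarrow> real"
  assumes lip: "K-lipschitz_on UNIV g" and Q: "diagonal_matrix Q" and pd: "positive_definite Q"
  shows "(g x - g y)\<^sup>2 \<le> K\<^sup>2 / Min (eigenvalues Q) * bregman (\<lambda>x. x \<bullet> (Q *v x)) x y"
    and "0 < Min (eigenvalues Q)" and "0 < Max (eigenvalues Q)"
proof -
  have fin: "finite (eigenvalues Q)" "eigenvalues Q \<noteq> {}"
    by (auto simp: eigenvalues_diagonal_matrix[OF Q])
  have pos: "0 < c" if "c \<in> eigenvalues Q" for c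
    using that positive_definite_diagonal_pos[OF Q pd] by (auto simp: eigenvalues_diagonal_matrix[OF Q])
  show q: "0 < Min (eigenvalues Q)" "0 < Max (eigenvalues Q)" using pos fin by auto
  have "\<bar>g x - g y\<bar> \<le> K * norm (x - y)"
    using lipschitz_onD[OF lip, of x y] by (simp add: dist_norm)
  then have "(g x - g y)\<^sup>2 \<le> (K * norm (x - y))\<^sup>2"
    using lipschitz_on_nonneg[OF lip] by (intro power2_le_iff_abs_le[THEN iffD2]) auto
  also have "\<dots> = K\<^sup>2 / Min (eigenvalues Q) * (Min (eigenvalues Q) * (norm (x - y))\<^sup>2)"
    using q by (simp add: power_mult_distrib)
  also have "\<dots> \<le> K\<^sup>2 / Min (eigenvalues Q) * bregman (\<lambda>x. x \<bullet> (Q *v x)) x y"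
    unfolding bregman_quadratic_form[OF Q] using q
    by (intro mult_left_mono diagonal_matrix_form_bounds[OF Q]) auto
  finally show "(g x - g y)\<^sup>2 \<le> K\<^sup>2 / Min (eigenvalues Q) * bregman (\<lambda>x. x \<bullet> (Q *v x)) x y" .
qed

text \<open>\<beta> is supported on \<open>- J\<close>, so the step leaves the argument of
  \<open>gt\<close> alone while the linear part gains
  \<open>s * (\<beta> \<bullet> \<beta>)\<close>, the same at every \<open>x\<close>.\<close>

lemma linear_decomposition_shift:
  assumes "linear_decomposition g J gt \<beta>"
  shows "g (x + s *\<^sub>R \<beta>) = g x + s * (norm \<beta>)\<^sup>2"
proof -
  have g: "g x = gt (coord_proj J x) + \<beta> \<bullet> coord_proj (- J) x" for x
    using assms by (simp add: linear_decomposition_def)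
  have supp: "\<beta> $ i = 0" if "i \<in> J" for i
    using assms that by (auto simp: linear_decomposition_def coord_proj_def)
  have 1: "coord_proj J (x + s *\<^sub>R \<beta>) = coord_proj J x"
    by (auto simp: coord_proj_def vec_eq_iff supp)
  have 2: "coord_proj (- J) (x + s *\<^sub>R \<beta>) = coord_proj (- J) x + s *\<^sub>R \<beta>"
    by (auto simp: coord_proj_def vec_eq_iff supp)
  show ?thesis unfolding g[of "x + s *\<^sub>R \<beta>"] g[of x] 1 2
    by (simp add: inner_add_right power2_norm_eq_inner)
qed

section \<open>Quantile functions of \<open>g(Y)\<close> for \<open>Y\<close> in a ball\<close>

context prob_space
begin

lemma nn_integral_uniform:
  fixes f :: "real \<Rightarrow> real"
  assumes U[measurable]: "U \<in> borel_measurable M" and U01: "\<And>\<omega>. U \<omega> \<in> {0<..<1}"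
    and law: "distr M borel U = distr (restrict_space lborel {0<..<1}) borel (\<lambda>u. u)"
    and f: "f \<in> borel_measurable (restrict_space borel {0<..<1})"
  shows "(\<integral>\<^sup>+\<omega>. ennreal (f (U \<omega>)) \<partial>M) = (\<integral>\<^sup>+u. ennreal (f u) \<partial>unit_leb)"
proof -
  let ?I = "restrict_space lborel {0<..<1::real}"
  define f0 where "f0 u = (if u \<in> {0<..<1} then f u else 0)" for u
  have [measurable]: "f0 \<in> borel_measurable borel"
    unfolding f0_def using f by (subst (asm) measurable_restrict_space_iff[where c=0]) auto
  have id: "(\<lambda>u. u) \<in> borel_measurable ?I" by (rule measurable_restrict_space1) simp
  have "(\<integral>\<^sup>+\<omega>. ennreal (f (U \<omega>)) \<partial>M) = (\<integral>\<^sup>+\<omega>. ennreal (f0 (U \<omega>)) \<partial>M)"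
    using U01 by (simp add: f0_def)
  also have "\<dots> = (\<integral>\<^sup>+u. ennreal (f0 u) \<partial>distr M borel U)" by (rule nn_integral_distr[symmetric]) auto
  also have "\<dots> = (\<integral>\<^sup>+u. ennreal (f0 u) \<partial>?I)" unfolding law using id by (subst nn_integral_distr) auto
  also have "\<dots> = (\<integral>\<^sup>+u. ennreal (f0 u) * indicator {0<..<1} u \<partial>lborel)"
    by (rule nn_integral_restrict_space) simp
  also have "\<dots> = (\<integral>\<^sup>+u. ennreal (f0 u) * indicator {0<..<1} u \<partial>lebesgue)"
    by (rule nn_integral_completion[symmetric])
  also have "\<dots> = (\<integral>\<^sup>+u. ennreal (f0 u) \<partial>unit_leb)"
    by (rule nn_integral_restrict_space[symmetric]) simp
  also have "\<dots> = (\<integral>\<^sup>+u. ennreal (f u) \<partial>unit_leb)"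
    by (rule nn_integral_cong) (simp add: f0_def)
  finally show ?thesis .
qed

lemma quantile_repr_uniform:
  assumes U[measurable]: "U \<in> borel_measurable M" and U01: "\<And>\<omega>. U \<omega> \<in> {0<..<1}"
    and law: "distr M borel U = distr (restrict_space lborel {0<..<1}) borel (\<lambda>u. u)"
    and k: "mono_on {0<..<1} k" and Y[measurable]: "Y \<in> borel_measurable M" and AE: "AE \<omega> in M. Y \<omega> = k (U \<omega>)"
  shows "quantile_repr M Y k"
  unfolding quantile_repr_def
proof (intro conjI allI k)
  fix x
  let ?f = "\<lambda>u. of_bool (x \<le> k u) :: real"
  have [measurable]: "k \<in> borel_measurable (restrict_space borel {0<..<1})"
    by (rule borel_measurable_mono_on_fnc[OF k])
  have [measurable]: "k \<in> borel_measurable unit_leb" by (rule mono_on_unit_measurable[OF k])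
  have "emeasure M {\<omega> \<in> space M. x \<le> Y \<omega>} = (\<integral>\<^sup>+\<omega>. indicator {\<omega> \<in> space M. x \<le> Y \<omega>} \<omega> \<partial>M)" by simp
  also have "\<dots> = (\<integral>\<^sup>+\<omega>. ennreal (?f (U \<omega>)) \<partial>M)"
    by (rule nn_integral_cong_AE) (use AE AE_space in \<open>eventually_elim, auto simp: indicator_def\<close>)
  also have "\<dots> = (\<integral>\<^sup>+u. ennreal (?f u) \<partial>unit_leb)"
    by (rule nn_integral_uniform[OF U U01 law]) measurable
  also have "\<dots> = (\<integral>\<^sup>+u. indicator {u \<in> space unit_leb. x \<le> k u} u \<partial>unit_leb)"
    by (rule nn_integral_cong) (auto simp: indicator_def)
  also have "\<dots> = emeasure unit_leb {u \<in> space unit_leb. x \<le> k u}"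
    by (rule nn_integral_indicator) measurable
  finally show "prob {\<omega> \<in> space M. x \<le> Y \<omega>} = measure unit_leb {u \<in> {0<..<1}. x \<le> k u}"
    by (simp add: measure_def)
qed

text \<open>The infimum over couplings is not known to be attained, so a coupling of cost below
  \<open>\<epsilon> + \<delta>\<close> is used. It consists of copies of \<open>Y\<close> and
  \<open>X\<close>, which have the same quantile functions after applying \<open>g\<close>; finally
  \<delta> tends to 0.\<close>

lemma bw_ball_quantile_distance:
  fixes X Y :: "'a \<Rightarrow> real ^ 'n"
  assumes lip: "K-lipschitz_on UNIV g" and Q: "diagonal_matrix Q" "positive_definite Q" and eps: "0 < \<epsilon>"
    and X: "X \<in> borel_measurable M" and Y: "Y \<in> bw_ball M (\<lambda>x. x \<bullet> (Q *v x)) \<epsilon> X"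
  shows "(\<lambda>u. quantile M (\<lambda>\<omega>. g (Y \<omega>)) u - quantile M (\<lambda>\<omega>. g (X \<omega>)) u) \<in> L2_unit"
    and "norm2_unit (\<lambda>u. quantile M (\<lambda>\<omega>. g (Y \<omega>)) u - quantile M (\<lambda>\<omega>. g (X \<omega>)) u)
      \<le> K * sqrt (\<epsilon> / Min (eigenvalues Q))"
proof -
  let ?\<Phi> = "\<lambda>x. x \<bullet> (Q *v x)"
  let ?D = "\<lambda>u. quantile M (\<lambda>\<omega>. g (Y \<omega>)) u - quantile M (\<lambda>\<omega>. g (X \<omega>)) u"
  define q where "q = Min (eigenvalues Q)"
  note bound = lipschitz_bregman_bound[OF lip Q]
  have q: "0 < q" using bound(2) by (simp add: q_def)
  have K: "0 \<le> K" by (rule lipschitz_on_nonneg[OF lip])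
  have g[measurable]: "g \<in> borel_measurable borel"
    by (rule borel_measurable_continuous_onI) (rule lipschitz_on_continuous_on[OF lip])
  have Ym: "Y \<in> borel_measurable M" and bw: "bregman_wasserstein M ?\<Phi> (dist_fun M Y) (dist_fun M X) \<le> ennreal \<epsilon>"
    using Y by (auto simp: bw_ball_def)
  have [measurable]: "quantile M (\<lambda>\<omega>. g (Y \<omega>)) \<in> borel_measurable unit_leb" "quantile M (\<lambda>\<omega>. g (X \<omega>)) \<in> borel_measurable unit_leb"
    using measurable_compose[OF Ym g] measurable_compose[OF X g] by (auto intro: mono_on_unit_measurable mono_on_quantile)
  have close: "(\<integral>\<^sup>+u. ennreal ((?D u)\<^sup>2) \<partial>unit_leb) \<le> ennreal (K\<^sup>2 / q * (\<epsilon> + \<delta>))" if "0 < \<delta>" for \<delta>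
  proof -
    have "bregman_wasserstein M ?\<Phi> (dist_fun M Y) (dist_fun M X) < ennreal (\<epsilon> + \<delta>)"
      using bw by (rule le_less_trans) (use eps that in \<open>simp add: ennreal_less_iff\<close>)
    then obtain Z W where ZW: "Z \<in> borel_measurable M" "W \<in> borel_measurable M"
        "dist_fun M Z = dist_fun M Y" "dist_fun M W = dist_fun M X"
        "(\<integral>\<^sup>+\<omega>. ennreal (bregman ?\<Phi> (Z \<omega>) (W \<omega>)) \<partial>M) < ennreal (\<epsilon> + \<delta>)"
      unfolding bregman_wasserstein_def INF_less_iff by auto
    note [measurable] = ZW(1,2)
    have "(\<integral>\<^sup>+u. ennreal ((?D u)\<^sup>2) \<partial>unit_leb) \<le> (\<integral>\<^sup>+\<omega>. ennreal ((g (Z \<omega>) - g (W \<omega>))\<^sup>2) \<partial>M)"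
      unfolding quantile_compose_cong[OF Ym ZW(1) ZW(3)[symmetric] g] quantile_compose_cong[OF X ZW(2) ZW(4)[symmetric] g]
      by (rule quantile_square_distance_le) measurable
    also have "\<dots> \<le> (\<integral>\<^sup>+\<omega>. ennreal (K\<^sup>2 / q) * ennreal (bregman ?\<Phi> (Z \<omega>) (W \<omega>)) \<partial>M)"
      using bound(1) q by (intro nn_integral_mono) (simp add: q_def ennreal_mult'[symmetric] ennreal_leI)
    also have "\<dots> = ennreal (K\<^sup>2 / q) * (\<integral>\<^sup>+\<omega>. ennreal (bregman ?\<Phi> (Z \<omega>) (W \<omega>)) \<partial>M)"
    proof (rule nn_integral_cmult)
      have "continuous_on UNIV (\<lambda>v. v \<bullet> (Q *v v))"
        by (intro continuous_intros matrix_vector_mult_linear_continuous_on)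
      then have [measurable]: "(\<lambda>v. v \<bullet> (Q *v v)) \<in> borel_measurable borel"
        by (rule borel_measurable_continuous_onI)
      show "(\<lambda>\<omega>. ennreal (bregman ?\<Phi> (Z \<omega>) (W \<omega>))) \<in> borel_measurable M"
        unfolding bregman_quadratic_form[OF Q(1)]
        by (intro measurable_compose[OF _ measurable_ennreal] measurable_compose[OF _ \<open>(\<lambda>v. v \<bullet> (Q *v v)) \<in> _\<close>]) measurable
    qed
    also have "\<dots> \<le> ennreal (K\<^sup>2 / q) * ennreal (\<epsilon> + \<delta>)"
      using ZW(5) by (intro mult_left_mono) auto
    also have "\<dots> = ennreal (K\<^sup>2 / q * (\<epsilon> + \<delta>))"
      using q eps that by (intro ennreal_mult[symmetric]) auto
    finally show ?thesis .
  qed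
  have int: "integrable unit_leb (\<lambda>u. (?D u)\<^sup>2)"
    using close[of 1] by (intro integrableI_nonneg) (auto intro: le_less_trans)
  show L2: "?D \<in> L2_unit" using int by (simp add: L2_unit_def)
  have "(LINT u|unit_leb. (?D u)\<^sup>2) \<le> K\<^sup>2 / q * (\<epsilon> + \<delta>)" if "0 < \<delta>" for \<delta>
    using close[OF that] nn_integral_eq_integral[OF int] q eps that by simp
  then have "(LINT u|unit_leb. (?D u)\<^sup>2) \<le> K\<^sup>2 / q * \<epsilon> + K\<^sup>2 / q * \<delta>" if "0 < \<delta>" for \<delta>
    using that by (simp add: distrib_left)
  then have "(LINT u|unit_leb. (?D u)\<^sup>2) \<le> K\<^sup>2 / q * \<epsilon> + e" if "0 < e" for e
  proof (cases "K = 0")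
    case False
    \<comment> \<open>This choice of \<delta> turns the slack term into \<open>e\<close>.\<close>
    then show ?thesis using \<open>\<And>\<delta>. 0 < \<delta> \<Longrightarrow> _ \<le> K\<^sup>2 / q * \<epsilon> + K\<^sup>2 / q * \<delta>\<close>[of "e * q / K\<^sup>2"] q that by simp
  next
    case True
    then show ?thesis using \<open>\<And>\<delta>. 0 < \<delta> \<Longrightarrow> _ \<le> K\<^sup>2 / q * \<epsilon> + K\<^sup>2 / q * \<delta>\<close>[of 1] that by simp
  qed
  then have "(LINT u|unit_leb. (?D u)\<^sup>2) \<le> K\<^sup>2 / q * \<epsilon>" by (rule field_le_epsilon)
  then have "norm2_unit ?D \<le> sqrt (K\<^sup>2 * (\<epsilon> / q))" by (simp add: norm2_unit_def)
  also have "\<dots> = K * sqrt (\<epsilon> / q)" using K by (simp add: real_sqrt_mult real_sqrt_divide)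
  finally show "norm2_unit ?D \<le> K * sqrt (\<epsilon> / Min (eigenvalues Q))" by (simp add: q_def)
qed

text \<open>The pair \<open>(Y, X)\<close> is itself an admissible coupling, and the largest
  eigenvalue bounds its cost.\<close>

lemma bw_ballI:
  fixes X Y :: "'a \<Rightarrow> real ^ 'n"
  assumes Q: "diagonal_matrix Q" and X: "X \<in> borel_measurable M" and Y: "Y \<in> borel_measurable M"
    and cost: "(\<integral>\<^sup>+\<omega>. ennreal (Max (eigenvalues Q) * (norm (Y \<omega> - X \<omega>))\<^sup>2) \<partial>M) \<le> ennreal \<epsilon>"
  shows "Y \<in> bw_ball M (\<lambda>x. x \<bullet> (Q *v x)) \<epsilon> X"
proof -
  have "bregman_wasserstein M (\<lambda>x. x \<bullet> (Q *v x)) (dist_fun M Y) (dist_fun M X)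
      \<le> (\<integral>\<^sup>+\<omega>. ennreal (bregman (\<lambda>x. x \<bullet> (Q *v x)) (Y \<omega>) (X \<omega>)) \<partial>M)"
    unfolding bregman_wasserstein_def by (rule INF_lower2[of "(Y, X)"]) (use X Y in auto)
  also have "\<dots> \<le> (\<integral>\<^sup>+\<omega>. ennreal (Max (eigenvalues Q) * (norm (Y \<omega> - X \<omega>))\<^sup>2) \<partial>M)"
    unfolding bregman_quadratic_form[OF Q] by (intro nn_integral_mono ennreal_leI diagonal_matrix_form_bounds[OF Q])
  finally show ?thesis using cost Y by (simp add: bw_ball_def)
qed

text \<open>Moving \<open>X\<close> along \<open>\<beta>\<close> by an amount that depends only on the rank \<open>U\<close> of \<open>g(X)\<close> realises any
  non-decreasing profile \<open>k\<close> as the quantile function of \<open>g(Y)\<close>.\<close>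

lemma bw_ball_profile:
  fixes X :: "'a \<Rightarrow> real ^ 'n"
  assumes "atomless M" and X: "X \<in> borel_measurable M" and lip: "K-lipschitz_on UNIV g"
    and dec: "linear_decomposition g J gt \<beta>" and Q: "diagonal_matrix Q" "positive_definite Q"
    and k: "mono_on {0<..<1} k"
    and L2: "(\<lambda>u. k u - quantile M (\<lambda>\<omega>. g (X \<omega>)) u) \<in> L2_unit"
    and dist: "norm2_unit (\<lambda>u. k u - quantile M (\<lambda>\<omega>. g (X \<omega>)) u) \<le> norm \<beta> * sqrt (\<epsilon> / Max (eigenvalues Q))"
    and \<beta>: "\<beta> \<noteq> 0" and eps: "0 < \<epsilon>"
  obtains Y where "Y \<in> bw_ball M (\<lambda>x. x \<bullet> (Q *v x)) \<epsilon> X" "quantile_repr M (\<lambda>\<omega>. g (Y \<omega>)) k"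
proof -
  define F where "F = quantile M (\<lambda>\<omega>. g (X \<omega>))"
  define q where "q = Max (eigenvalues Q)"
  have q: "0 < q" using lipschitz_bregman_bound(3)[OF lip Q] by (simp add: q_def)
  have g[measurable]: "g \<in> borel_measurable borel"
    by (rule borel_measurable_continuous_onI) (rule lipschitz_on_continuous_on[OF lip])
  note X[measurable]
  have gX: "(\<lambda>\<omega>. g (X \<omega>)) \<in> borel_measurable M" by measurable
  obtain U where U[measurable]: "U \<in> borel_measurable M" and U01: "\<And>\<omega>. U \<omega> \<in> {0<..<1}"
    and law: "distr M borel U = distr (restrict_space lborel {0<..<1}) borel (\<lambda>u. u)"
    and gXU: "AE \<omega> in M. g (X \<omega>) = F (U \<omega>)"
    using uniform_quantile_coupling[OF assms(1) gX] unfolding F_def by blast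
  have U': "U \<in> measurable M (restrict_space borel {0<..<1})"
    using U U01 by (intro measurable_restrict_space2) auto
  have km: "k \<in> borel_measurable (restrict_space borel {0<..<1})"
    "F \<in> borel_measurable (restrict_space borel {0<..<1})"
    unfolding F_def by (intro borel_measurable_mono_on_fnc k mono_on_quantile gX)+
  have [measurable]: "(\<lambda>\<omega>. k (U \<omega>)) \<in> borel_measurable M" "(\<lambda>\<omega>. F (U \<omega>)) \<in> borel_measurable M"
    using measurable_compose[OF U' km(1)] measurable_compose[OF U' km(2)] .
  \<comment> \<open>A step \<open>s *\<^sub>R \<beta>\<close> changes \<open>g\<close> by
    \<open>s * (norm \<beta>)\<^sup>2\<close>; dividing by this factor makes \<open>g\<close> change
    by exactly \<open>k - F\<close> at the rank \<open>U\<close>.\<close>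
  define Y where "Y \<omega> = X \<omega> + ((k (U \<omega>) - F (U \<omega>)) / (norm \<beta>)\<^sup>2) *\<^sub>R \<beta>" for \<omega>
  have Y[measurable]: "Y \<in> borel_measurable M" unfolding Y_def by measurable
  have n: "0 < norm \<beta>" using \<beta> by simp
  have gY: "g (Y \<omega>) = g (X \<omega>) + (k (U \<omega>) - F (U \<omega>))" for \<omega>
    unfolding Y_def linear_decomposition_shift[OF dec] using n by simp
  have int: "integrable unit_leb (\<lambda>u. (k u - F u)\<^sup>2)" using L2 by (simp add: L2_unit_def F_def)
  have cost: "q * (norm (Y \<omega> - X \<omega>))\<^sup>2 = q / (norm \<beta>)\<^sup>2 * (k (U \<omega>) - F (U \<omega>))\<^sup>2" for \<omega>
  proof -
    have "norm (Y \<omega> - X \<omega>) = \<bar>k (U \<omega>) - F (U \<omega>)\<bar> / norm \<beta>"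
      using n by (simp add: Y_def power2_eq_square)
    then show ?thesis by (simp add: power_divide)
  qed
  have "(norm2_unit (\<lambda>u. k u - F u))\<^sup>2 \<le> (norm \<beta> * sqrt (\<epsilon> / q))\<^sup>2"
    using dist norm2_unit_nonneg by (intro power_mono) (auto simp: F_def q_def)
  then have d2: "q / (norm \<beta>)\<^sup>2 * (LINT u|unit_leb. (k u - F u)\<^sup>2) \<le> \<epsilon>"
    using q n eps by (simp add: norm2_unit_def power_mult_distrib field_simps)
  have "(\<integral>\<^sup>+\<omega>. ennreal (q * (norm (Y \<omega> - X \<omega>))\<^sup>2) \<partial>M) =
      (\<integral>\<^sup>+u. ennreal (q / (norm \<beta>)\<^sup>2 * (k u - F u)\<^sup>2) \<partial>unit_leb)"
    unfolding cost using km by (intro nn_integral_uniform[OF U U01 law]) measurable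
  also have "\<dots> = ennreal (q / (norm \<beta>)\<^sup>2 * (LINT u|unit_leb. (k u - F u)\<^sup>2))"
    using int q by (subst nn_integral_eq_integral) auto
  also have "\<dots> \<le> ennreal \<epsilon>" using d2 by (rule ennreal_leI)
  finally have ball: "Y \<in> bw_ball M (\<lambda>x. x \<bullet> (Q *v x)) \<epsilon> X"
    by (intro bw_ballI[OF Q(1) X Y]) (simp add: q_def)
  have "AE \<omega> in M. g (Y \<omega>) = k (U \<omega>)" using gXU by eventually_elim (simp add: gY)
  then have "quantile_repr M (\<lambda>\<omega>. g (Y \<omega>)) k"
    by (intro quantile_repr_uniform[OF U U01 law k]) measurable
  then show ?thesis using that ball by blast
qed

lemma self_in_bw_ball:
  fixes X :: "'a \<Rightarrow> real ^ 'n"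
  assumes "diagonal_matrix Q" and "X \<in> borel_measurable M"
  shows "X \<in> bw_ball M (\<lambda>x. x \<bullet> (Q *v x)) \<epsilon> X"
  by (rule bw_ballI) (use assms in auto)

end

text \<open>\<open>S\<close> is a supremum in the extended reals, so the upper bounds also exclude
  the value infinity. For \<open>\<beta> = 0\<close> the equation for the lower parameter has
  right-hand side 0 and, since the distance grows at least linearly in \<open>c\<close>, no positive
  solution; the bound is then taken at \<open>c = 0\<close>, the limit of an infinite
  multiplier.\<close>

theorem proposition8:
  fixes M :: "'w measure" and X :: "'w \<Rightarrow> real ^ 'n"
    and g gt \<Phi> :: "real ^ 'n \<Rightarrow> real" and \<beta> :: "real ^ 'n" and J :: "'n set"
    and Q :: "real ^ 'n ^ 'n" and h \<gamma> Finv :: "real \<Rightarrow> real"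
    and K p a \<epsilon> q_min q_max :: real and S :: ereal
  assumes "prob_space M" and "atomless M"
    and "1 \<le> p" and "1 \<le> a"
    and "distortion_function h" and "abs_continuous_on_unit h" and "distortion_weight h \<gamma>"
    and "\<gamma> \<in> L2_unit" and "0 < norm2_unit \<gamma>"
    and "K-lipschitz_on UNIV g" and "\<not> g constant_on UNIV"
    and "linear_decomposition g J gt \<beta>"
    and "X \<in> Lp_vec M a p" and "(\<lambda>\<omega>. g (X \<omega>)) \<in> Lp_real M p"
    and "signed_choquet_finite M h (\<lambda>\<omega>. g (X \<omega>))"
    and "diagonal_matrix Q" and "positive_definite Q"
    and "q_min = Min (eigenvalues Q)" and "q_max = Max (eigenvalues Q)"
    and "\<Phi> = (\<lambda>x. x \<bullet> (Q *v x))"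
    and "0 < \<epsilon>"
    and "Finv = quantile M (\<lambda>\<omega>. g (X \<omega>))"
    and "S = (SUP Y \<in> bw_ball M \<Phi> \<epsilon> X. ereal (signed_choquet M h (\<lambda>\<omega>. g (Y \<omega>))))"
  shows
    "(mono_on {0<..<1} \<gamma> \<longrightarrow>
        ereal (signed_choquet M h (\<lambda>\<omega>. g (X \<omega>)) + norm \<beta> * sqrt (\<epsilon> / q_max) * norm2_unit \<gamma>) \<le> S \<and>
        S \<le> ereal (signed_choquet M h (\<lambda>\<omega>. g (X \<omega>)) + K * sqrt (\<epsilon> / q_min) * norm2_unit \<gamma>))
     \<and>
     ((\<forall>u\<in>{0<..<1}. 0 \<le> \<gamma> u) \<and> Finv \<in> L2_unit \<longrightarrow>
        (let proj = (\<lambda>c. isotonic_proj (\<lambda>u. Finv u + c * \<gamma> u));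
             value_at = (\<lambda>c. LINT u|lebesgue_on {0<..<1}. \<gamma> u * proj c u);
             sq_dist = (\<lambda>c. LINT u|lebesgue_on {0<..<1}. (Finv u - proj c u)\<^sup>2);
             upper_sol = (\<lambda>l. 0 < l \<and> sq_dist (1 / (2 * q_min * l)) = K\<^sup>2 * \<epsilon> / q_min);
             lower_sol = (\<lambda>l. 0 < l \<and> sq_dist (1 / (2 * q_max * l)) = (norm \<beta>)\<^sup>2 * \<epsilon> / q_max)
         in (\<exists>!l. upper_sol l) \<and>
            (\<forall>l. upper_sol l \<longrightarrow> S \<le> ereal (value_at (1 / (2 * q_min * l)))) \<and>
            (\<beta> \<noteq> 0 \<longrightarrow>
              (\<exists>!l. lower_sol l) \<and>
              (\<forall>l. lower_sol l \<longrightarrow> ereal (value_at (1 / (2 * q_max * l))) \<le> S)) \<and>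
            (\<beta> = 0 \<longrightarrow> ereal (value_at 0) \<le> S)))"
proof -
  interpret prob_space M by fact
  note atomless = assms(2) and ac = assms(6) and w = assms(7) and g2 = assms(8) and g2_pos = assms(9)
    and lip = assms(10) and nonconst = assms(11) and dec = assms(12) and fin = assms(15)
    and Q = assms(16,17) and q_eqs = assms(18,19) and \<Phi> = assms(20) and eps = assms(21)
    and Finv = assms(22) and S = assms(23)
  let ?I = "\<lambda>Y. signed_choquet M h (\<lambda>\<omega>. g (Y \<omega>))"
  let ?B = "bw_ball M \<Phi> \<epsilon> X"
  have h0: "h 0 = 0" using assms(5) by (simp add: distortion_function_def)
  have X[measurable]: "X \<in> borel_measurable M" using assms(13) by (simp add: Lp_vec_def)
  have gm[measurable]: "g \<in> borel_measurable borel"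
    by (rule borel_measurable_continuous_onI) (rule lipschitz_on_continuous_on[OF lip])
  have gX: "(\<lambda>\<omega>. g (X \<omega>)) \<in> borel_measurable M" by measurable
  have gint: "integrable unit_leb \<gamma>" by (rule L2_unit_integrable[OF g2])
  have q_min: "0 < q_min" and q_max: "0 < q_max"
    using lipschitz_bregman_bound(2,3)[OF lip Q] by (auto simp: q_eqs)
  \<comment> \<open>A non-constant \<open>g\<close> makes the radius
    \<open>K * sqrt (\<epsilon> / q_min)\<close> positive, so that the equation for the upper
    parameter is solvable.\<close>
  have K: "0 < K"
  proof -
    have "K \<noteq> 0"
    proof
      assume "K = 0"
      then have "dist (g x) (g y) \<le> 0" for x y using lipschitz_onD[OF lip, of x y] by simp
      then have "g x = g 0" for x by (metis dist_le_zero_iff)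
      then show False using nonconst by (auto simp: constant_on_def)
    qed
    then show ?thesis using lipschitz_on_nonneg[OF lip] by simp
  qed
  have reprX: "quantile_repr M (\<lambda>\<omega>. g (X \<omega>)) Finv" unfolding Finv by (rule quantile_repr_quantile[OF gX])
  have mono_F: "mono_on {0<..<1} Finv" unfolding Finv by (rule mono_on_quantile[OF gX])
  have profile_value: "signed_choquet M h Y = ?I X + inner_unit \<gamma> (\<lambda>u. k u - Finv u)"
    if "quantile_repr M Y k" "(\<lambda>u. k u - Finv u) \<in> L2_unit" for Y k
    using signed_choquet_diff(2)[OF ac h0 w gint that(1) reprX integrable_mult_L2_unit[OF g2 that(2)] fin]
    by (simp add: inner_unit_def)
  have ball: "(\<lambda>u. quantile M (\<lambda>\<omega>. g (Y \<omega>)) u - Finv u) \<in> L2_unit"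
    "norm2_unit (\<lambda>u. quantile M (\<lambda>\<omega>. g (Y \<omega>)) u - Finv u) \<le> K * sqrt (\<epsilon> / q_min)"
    "quantile_repr M (\<lambda>\<omega>. g (Y \<omega>)) (quantile M (\<lambda>\<omega>. g (Y \<omega>)))"
    "(\<lambda>\<omega>. g (Y \<omega>)) \<in> borel_measurable M"
    if "Y \<in> ?B" for Y
  proof -
    show m: "(\<lambda>\<omega>. g (Y \<omega>)) \<in> borel_measurable M"
      using that by (auto simp: bw_ball_def intro: measurable_compose[OF _ gm])
    show "quantile_repr M (\<lambda>\<omega>. g (Y \<omega>)) (quantile M (\<lambda>\<omega>. g (Y \<omega>)))" by (rule quantile_repr_quantile[OF m])
    show "(\<lambda>u. quantile M (\<lambda>\<omega>. g (Y \<omega>)) u - Finv u) \<in> L2_unit"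
      "norm2_unit (\<lambda>u. quantile M (\<lambda>\<omega>. g (Y \<omega>)) u - Finv u) \<le> K * sqrt (\<epsilon> / q_min)"
      using bw_ball_quantile_distance[OF lip Q eps X that[unfolded \<Phi>]] by (simp_all add: Finv q_eqs)
  qed
  have upper: "S \<le> ereal C" if "\<And>Y. Y \<in> ?B \<Longrightarrow> ?I X + inner_unit \<gamma> (\<lambda>u. quantile M (\<lambda>\<omega>. g (Y \<omega>)) u - Finv u) \<le> C" for C
    unfolding S
  proof (rule SUP_least)
    fix Y assume Y: "Y \<in> ?B"
    show "ereal (?I Y) \<le> ereal C" using that[OF Y] profile_value[OF ball(3)[OF Y] ball(1)[OF Y]] by simp
  qed
  have lower0: "ereal (?I X) \<le> S"
    unfolding S by (rule SUP_upper2[of X]) (use self_in_bw_ball[OF Q(1) X] \<Phi> in auto)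
  have lower: "ereal (?I X + inner_unit \<gamma> (\<lambda>u. k u - Finv u)) \<le> S"
    if k: "mono_on {0<..<1} k" and L2: "(\<lambda>u. k u - Finv u) \<in> L2_unit"
      and dist: "norm2_unit (\<lambda>u. k u - Finv u) \<le> norm \<beta> * sqrt (\<epsilon> / q_max)" and \<beta>: "\<beta> \<noteq> 0" for k
  proof -
    obtain Y where Y: "Y \<in> ?B" "quantile_repr M (\<lambda>\<omega>. g (Y \<omega>)) k"
      using bw_ball_profile[OF atomless X lip dec Q k L2[unfolded Finv] dist[unfolded Finv q_eqs] \<beta> eps]
      unfolding \<Phi> by blast
    show ?thesis
      unfolding S by (rule SUP_upper2[OF Y(1)]) (simp add: profile_value[OF Y(2) L2])
  qed
  have part1: "ereal (?I X + norm \<beta> * sqrt (\<epsilon> / q_max) * norm2_unit \<gamma>) \<le> S \<and>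
      S \<le> ereal (?I X + K * sqrt (\<epsilon> / q_min) * norm2_unit \<gamma>)" if mono: "mono_on {0<..<1} \<gamma>"
  proof
    show "ereal (?I X + norm \<beta> * sqrt (\<epsilon> / q_max) * norm2_unit \<gamma>) \<le> S"
    proof (cases "\<beta> = 0")
      case True
      then show ?thesis using lower0 by simp
    next
      case False
      \<comment> \<open>The multiple of \<gamma> whose norm is the full radius: Cauchy-Schwarz is an
        equality in this direction, and a non-decreasing \<gamma> keeps the profile
        monotone.\<close>
      define c where "c = norm \<beta> * sqrt (\<epsilon> / q_max) / norm2_unit \<gamma>"
      have c: "0 \<le> c" using g2_pos eps q_max by (simp add: c_def)
      have "ereal (?I X + inner_unit \<gamma> (\<lambda>u. (Finv u + c * \<gamma> u) - Finv u)) \<le> S"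
      proof (rule lower[OF _ _ _ False])
        show "mono_on {0<..<1} (\<lambda>u. Finv u + c * \<gamma> u)"
          using mono mono_F c by (auto simp: mono_on_def intro!: add_mono mult_left_mono)
        show "(\<lambda>u. Finv u + c * \<gamma> u - Finv u) \<in> L2_unit" using L2_unit_scale[OF g2] by simp
        have "norm2_unit (\<lambda>u. c * \<gamma> u) = c * norm2_unit \<gamma>"
          using c by (simp add: norm2_unit_eq inner_unit_scale_left inner_unit_scale_right real_sqrt_mult mult.assoc[symmetric])
        then show "norm2_unit (\<lambda>u. Finv u + c * \<gamma> u - Finv u) \<le> norm \<beta> * sqrt (\<epsilon> / q_max)"
          using g2_pos by (simp add: c_def)
      qed
      moreover have "inner_unit \<gamma> (\<lambda>u. (Finv u + c * \<gamma> u) - Finv u) = norm \<beta> * sqrt (\<epsilon> / q_max) * norm2_unit \<gamma>"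
        using g2_pos by (simp add: inner_unit_scale_right norm2_unit_square[symmetric]) (simp add: c_def power2_eq_square)
      ultimately show ?thesis by simp
    qed
    show "S \<le> ereal (?I X + K * sqrt (\<epsilon> / q_min) * norm2_unit \<gamma>)"
    proof (rule upper)
      fix Y assume Y: "Y \<in> ?B"
      have "inner_unit \<gamma> (\<lambda>u. quantile M (\<lambda>\<omega>. g (Y \<omega>)) u - Finv u)
          \<le> norm2_unit \<gamma> * norm2_unit (\<lambda>u. quantile M (\<lambda>\<omega>. g (Y \<omega>)) u - Finv u)"
        by (rule inner_unit_le_norms[OF g2 ball(1)[OF Y]])
      also have "\<dots> \<le> norm2_unit \<gamma> * (K * sqrt (\<epsilon> / q_min))"
        by (intro mult_left_mono ball(2)[OF Y] norm2_unit_nonneg)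
      finally show "?I X + inner_unit \<gamma> (\<lambda>u. quantile M (\<lambda>\<omega>. g (Y \<omega>)) u - Finv u)
          \<le> ?I X + K * sqrt (\<epsilon> / q_min) * norm2_unit \<gamma>" by (simp add: mult_ac)
    qed
  qed
  have part2: "let proj = (\<lambda>c. isotonic_proj (\<lambda>u. Finv u + c * \<gamma> u));
             value_at = (\<lambda>c. LINT u|lebesgue_on {0<..<1}. \<gamma> u * proj c u);
             sq_dist = (\<lambda>c. LINT u|lebesgue_on {0<..<1}. (Finv u - proj c u)\<^sup>2);
             upper_sol = (\<lambda>l. 0 < l \<and> sq_dist (1 / (2 * q_min * l)) = K\<^sup>2 * \<epsilon> / q_min);
             lower_sol = (\<lambda>l. 0 < l \<and> sq_dist (1 / (2 * q_max * l)) = (norm \<beta>)\<^sup>2 * \<epsilon> / q_max)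
         in (\<exists>!l. upper_sol l) \<and>
            (\<forall>l. upper_sol l \<longrightarrow> S \<le> ereal (value_at (1 / (2 * q_min * l)))) \<and>
            (\<beta> \<noteq> 0 \<longrightarrow>
              (\<exists>!l. lower_sol l) \<and>
              (\<forall>l. lower_sol l \<longrightarrow> ereal (value_at (1 / (2 * q_max * l))) \<le> S)) \<and>
            (\<beta> = 0 \<longrightarrow> ereal (value_at 0) \<le> S)"
    if nonneg: "\<forall>u\<in>{0<..<1}. 0 \<le> \<gamma> u" and FL2: "Finv \<in> L2_unit"
  proof -
    have F_cone: "Finv \<in> isotonic_cone"
      using FL2 mono_F continuous_at_left_quantile[OF gX] by (simp add: isotonic_cone_def Finv)
    have mean: "0 < inner_unit \<gamma> (\<lambda>_. 1)" using inner_unit_one_pos[OF g2 _ g2_pos] nonneg by blast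
    let ?P = "proj_path Finv \<gamma>" and ?D = "proj_dist Finv \<gamma>"
    note PL2 = proj_path_L2[OF F_cone g2]
    \<comment> \<open>Square integrability of \<open>Finv\<close> makes the weighted integral of the
      quantile function itself finite, so values can replace differences.\<close>
    have IX: "?I X = inner_unit \<gamma> Finv"
      using signed_choquet_eq_weighted_quantile[OF assms(1) ac h0 w gint reprX integrable_mult_L2_unit[OF g2 FL2]]
      by (simp add: inner_unit_def)
    have proj: "isotonic_proj (\<lambda>u. Finv u + c * \<gamma> u) = ?P c" for c
      using proj_path_def[OF F_cone g2] by simp
    have val: "(LINT u|unit_leb. \<gamma> u * ?P c u) = inner_unit \<gamma> (?P c)" for c
      by (simp add: inner_unit_def)
    have sq: "(LINT u|unit_leb. (Finv u - ?P c u)\<^sup>2) = (?D c)\<^sup>2" for c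
      unfolding proj_dist_def[OF F_cone g2] norm2_unit_square
      by (simp add: inner_unit_def power2_eq_square[symmetric] power2_commute)
    have D_nonneg: "0 \<le> ?D c" for c by (simp add: proj_dist_def[OF F_cone g2] norm2_unit_nonneg)
    have sq_iff: "(?D c)\<^sup>2 = r\<^sup>2 * \<epsilon> / q \<longleftrightarrow> ?D c = r * sqrt (\<epsilon> / q)" if "0 \<le> r" "0 < q" for c r q
    proof -
      have "r\<^sup>2 * \<epsilon> / q = (r * sqrt (\<epsilon> / q))\<^sup>2" using that eps by (simp add: power_mult_distrib)
      moreover have "0 \<le> r * sqrt (\<epsilon> / q)" using that eps by simp
      ultimately show ?thesis using D_nonneg[of c] by (simp add: power2_eq_iff_nonneg)
    qed
    have sol: "\<exists>!l. 0 < l \<and> (?D (1 / (2 * q * l)))\<^sup>2 = r\<^sup>2 * \<epsilon> / q" if "0 < r" "0 < q" for r q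
    proof -
      have "0 < r * sqrt (\<epsilon> / q)" using that eps by simp
      from proj_dist_attains[OF F_cone g2 this mean]
      obtain c where c: "0 < c" "?D c = r * sqrt (\<epsilon> / q)"
        and uniq: "\<And>d. 0 < d \<Longrightarrow> ?D d = r * sqrt (\<epsilon> / q) \<Longrightarrow> d = c"
        by blast
      have c_sq: "(?D c)\<^sup>2 = r\<^sup>2 * \<epsilon> / q" using iffD2[OF sq_iff c(2)] that by simp
      show ?thesis
      proof (rule ex1I)
        \<comment> \<open>The map \<open>l \<mapsto> 1 / (2 * q * l)\<close> is its own inverse on
          the positive reals, so unique existence carries over from \<open>c\<close> to
          \<open>l\<close>.\<close>
        show "0 < 1 / (2 * q * c) \<and> (?D (1 / (2 * q * (1 / (2 * q * c)))))\<^sup>2 = r\<^sup>2 * \<epsilon> / q"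
          using c(1) c_sq that by simp
        fix l assume l: "0 < l \<and> (?D (1 / (2 * q * l)))\<^sup>2 = r\<^sup>2 * \<epsilon> / q"
        then have "1 / (2 * q * l) = c" using that by (intro uniq) (auto simp: sq_iff)
        then show "l = 1 / (2 * q * c)" using l that c by (auto simp: field_simps)
      qed
    qed
    have up: "S \<le> ereal (inner_unit \<gamma> (?P c))" if c: "0 < c" "(?D c)\<^sup>2 = K\<^sup>2 * \<epsilon> / q_min" for c
    proof (rule upper)
      fix Y assume Y: "Y \<in> ?B"
      let ?k = "quantile M (\<lambda>\<omega>. g (Y \<omega>))"
      have "?k \<in> L2_unit" using L2_unit_add[OF ball(1)[OF Y] FL2] by simp
      then have k: "?k \<in> isotonic_cone"
        using mono_on_quantile[OF ball(4)[OF Y]] continuous_at_left_quantile[OF ball(4)[OF Y]]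
        by (simp add: isotonic_cone_def)
      have "norm2_unit (\<lambda>u. ?k u - Finv u) \<le> ?D c"
        using ball(2)[OF Y] c K q_min by (simp add: sq_iff)
      from proj_path_optimal[OF F_cone g2 c(1) k this]
      show "?I X + inner_unit \<gamma> (\<lambda>u. ?k u - Finv u) \<le> inner_unit \<gamma> (?P c)"
        using \<open>?k \<in> L2_unit\<close> FL2 g2 by (simp add: IX inner_unit_diff_right)
    qed
    have low: "ereal (inner_unit \<gamma> (?P c)) \<le> S" if c: "0 < c" "(?D c)\<^sup>2 = (norm \<beta>)\<^sup>2 * \<epsilon> / q_max" and \<beta>: "\<beta> \<noteq> 0" for c
    proof -
      have "norm2_unit (\<lambda>u. ?P c u - Finv u) \<le> norm \<beta> * sqrt (\<epsilon> / q_max)"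
        using c q_max by (simp add: sq_iff proj_dist_def[OF F_cone g2, symmetric])
      from lower[OF isotonic_cone_mono[OF proj_path_cone[OF F_cone g2]] L2_unit_diff[OF PL2 FL2] this \<beta>]
      show ?thesis using PL2[of c] FL2 g2 by (simp add: IX inner_unit_diff_right)
    qed
    have zero: "ereal (inner_unit \<gamma> (?P 0)) \<le> S"
      using lower0 inner_proj_path_0[OF F_cone g2] by (simp add: IX)
    show ?thesis
      unfolding Let_def proj val sq
      using sol[OF K q_min] sol[of "norm \<beta>" q_max] q_max q_min up low zero by auto
  qed
  show ?thesis using part1 part2 by blast
qed

end
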